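(* Consider two bilinear systems $(A,N_1,\dots,N_n,B,C)$ on $X$ and $(\widetilde A,\widetilde N_1,\dots,\widetilde N_n,\widetilde B,\widetilde C)$ on $\widetilde X$ with the same input space $\mathbb R^n$ and the same output space $\mathcal H\simeq\mathbb R^m$, each satisfying the stability condition $M^2\Gamma^2(2\nu)^{-1}<1$ with its own constants. Let $G_k,\widetilde G_k$ be their transfer functions, $\Delta(G_k)=G_k-\widetilde G_k$, and $\Delta(H)=H-\widetilde H$ the difference of their Hankel operators. Then $$\sum_{k=1}^\infty\Big(\|\Delta(G_{2k-2})\|_{\mathscr H^\infty_k\mathscr H^2_{2k-2}}+\|\Delta(G_{2k-1})\|_{\mathscr H^\infty_k\mathscr H^2_{2k-1}}\Big)\le4\|\Delta(H)\|_{\mathrm{TC}}.$$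
   Context: A bilinear system: $X$ separable real Hilbert space, $A$ generator of a $C_0$-semigroup $(T(t))$ with $\|T(t)\|\le Me^{-\nu t}$ ($M\ge1,\nu>0$), $N_1,\dots,N_n\in\mathcal L(X)$, $Bu=\sum_{i=1}^n\psi_iu_i$ with $\psi_i\in X$, $C\in\mathcal L(X,\mathbb R^m)$, $\Gamma=(\sum_i\|N_iN_i^*\|)^{1/2}$. With $\widehat e_i$ the standard basis of $\mathbb R^n$, for $t\in(0,\infty)^{k+1}$: $O_0(t_1)=CT(t_1)$, $P_0(t_1)=T(t_1)^*$, and for $k\ge1$, $O_k(t)y=\sum_{n_1,\dots,n_k}CT(t_1)N_{n_1}T(t_2)\cdots N_{n_k}T(t_{k+1})y\otimes(\widehat e_{n_1}\otimes\dots\otimes\widehat e_{n_k})\in\mathbb R^m\otimes(\mathbb R^n)^{\otimes k}$, $P_k(t)y=\sum_{n_1,\dots,n_k}T(t_1)^*N_{n_1}^*\cdots T(t_k)^*N_{n_k}^*T(t_{k+1})^*y\otimes(\widehat e_{n_1}\otimes\dots\otimes\widehat e_{n_k})$. Fock spaces: $F^n_k(K)=L^2((0,\infty)^k,K\otimes(\mathbb R^n)^{\otimes(k-1)})$, $F^n(K)=\bigoplus_{k\ge1}F^n_k(K)$. Observability map $W:X\to F^n(\mathbb R^m)$, $Wx=(O_k(\cdot)x)_{k\ge0}$; reachability map $R:F^n(\mathbb R^n)\to X$, $R((f_k)_{k\ge0})=\sum_k\int_{(0,\infty)^{k+1}}P_k(s)^*(B\otimes\mathrm{id})f_k(s)ds$;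 Hankel operator $H=WR:F^n(\mathbb R^n)\to F^n(\mathbb R^m)$ (trace class when the output space is finite-dimensional); $\|\cdot\|_{\mathrm{TC}}$ is the trace norm. Volterra kernel $h_{k,0}(t)=O_k(t)B\in\mathrm{HS}(\mathbb R^n,\mathbb R^m\otimes(\mathbb R^n)^{\otimes k})$, $t\in(0,\infty)^{k+1}$; transfer function $G_k(s)=\int_{(0,\infty)^{k+1}}h_{k,0}(t)e^{-\langle s,t\rangle}dt$ for $s\in\mathbb C_+^{k+1}$, $\mathbb C_+$ the open right half-plane. For a function $F:\mathbb C_+^p\to K$, $\|F\|_{\mathscr H^2}=\sup_{x\in(0,\infty)^p}(2\pi)^{-p/2}(\int_{\mathbb R^p}\|F(x+iy)\|_K^2dy)^{1/2}$; for $g:\mathbb C_+^{p}\to K$ the mixed norm is $\|g\|_{\mathscr H^\infty_i\mathscr H^2_{p-1}}=\sup_{z\in\mathbb C_+}\|g(\cdot,\dots,\cdot,z,\cdot,\dots,\cdot)\|_{\mathscr H^2}$, where $z$ is placed in the $i$-th variable and the $\mathscr H^2$ norm is taken in the remaining $p-1$ variables (here $K$ is the complexified Hilbert–Schmidt space). *)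

theory Defs
  imports "HOL-Analysis.Analysis"
begin

text \<open>Multi-indices (n_1,...,n_k) with entries in {0..<n} (0-based), i.e. the standard
  basis of (R^n)^{tensor k}.\<close>
definition idxs :: "nat \<Rightarrow> nat \<Rightarrow> nat list set" where
  "idxs n k = {ns. length ns = k \<and> set ns \<subseteq> {..<n}}"

definition Tmeas :: "nat \<Rightarrow> (nat \<Rightarrow> real) measure" where
  "Tmeas k = PiM {..k} (\<lambda>_. restrict_space lborel {0<..})"

fun oprod :: "(real \<Rightarrow> 'a \<Rightarrow> 'a) \<Rightarrow> (nat \<Rightarrow> 'a \<Rightarrow> 'a) \<Rightarrow> nat list \<Rightarrow> (nat \<Rightarrow> real) \<Rightarrow> nat \<Rightarrow> 'a \<Rightarrow> 'a" where
  "oprod T N [] t i x = T (t i) x"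
| "oprod T N (n # ns) t i x = T (t i) (N n (oprod T N ns t (Suc i) x))"

text \<open>Standing assumptions on a bilinear system with semigroup T (generated by A),
  bounded N_0..N_{n-1}, B u = sum psi_i u_i, C = (C_0,...,C_{m-1}) bounded functionals,
  ||T t|| <= M exp(-nu t), and the stability condition M^2 Gamma^2 / (2 nu) < 1.\<close>
definition Gamma :: "nat \<Rightarrow> (nat \<Rightarrow> 'a::real_inner \<Rightarrow> 'a) \<Rightarrow> real" where
  "Gamma n N = sqrt (\<Sum>i<n. onorm (N i \<circ> adjoint (N i)))"

definition stable_bilinear_system ::
  "nat \<Rightarrow> nat \<Rightarrow> (real \<Rightarrow> 'a::{real_inner,banach} \<Rightarrow> 'a) \<Rightarrow> (nat \<Rightarrow> 'a \<Rightarrow> 'a) \<Rightarrow>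
   (nat \<Rightarrow> 'a) \<Rightarrow> (nat \<Rightarrow> 'a \<Rightarrow> real) \<Rightarrow> real \<Rightarrow> real \<Rightarrow> bool" where
  "stable_bilinear_system n m T N psi C M \<nu> \<longleftrightarrow>
     \<comment> \<open>C_0-semigroup\<close>
     (\<forall>t\<ge>0. bounded_linear (T t)) \<and> T 0 = id \<and>
     (\<forall>s\<ge>0. \<forall>t\<ge>0. T (s + t) = T s \<circ> T t) \<and>
     (\<forall>x. continuous_on {0..} (\<lambda>t. T t x)) \<and>
     \<comment> \<open>exponential stability bound\<close>
     M \<ge> 1 \<and> \<nu> > 0 \<and> (\<forall>t\<ge>0. onorm (T t) \<le> M * exp (- \<nu> * t)) \<and>
     \<comment> \<open>bounded bilinear and output operators\<close>
     (\<forall>i<n. bounded_linear (N i)) \<and> (\<forall>j<m. bounded_linear (C j)) \<and>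
     \<comment> \<open>stability condition\<close>
     M\<^sup>2 * (Gamma n N)\<^sup>2 / (2 * \<nu>) < 1"

text \<open>An element of F^n(R^d) is represented by f with f k t i ns the component
  (i, ns) (i < d, ns in idxs n k) of the level-k function f_k at time t in (0,inf)^(k+1).\<close>
type_synonym fock = "nat \<Rightarrow> (nat \<Rightarrow> real) \<Rightarrow> nat \<Rightarrow> nat list \<Rightarrow> real"

definition fock_space :: "nat \<Rightarrow> nat \<Rightarrow> fock set" where
  "fock_space d n = {f. (\<forall>k i ns. (\<lambda>t. f k t i ns) \<in> borel_measurable (Tmeas k)) \<and>
      (\<Sum>k. \<integral>\<^sup>+ t. ennreal (\<Sum>i<d. \<Sum>ns\<in>idxs n k. (f k t i ns)\<^sup>2) \<partial>Tmeas k) < \<infinity>}"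

definition fock_inner :: "nat \<Rightarrow> nat \<Rightarrow> fock \<Rightarrow> fock \<Rightarrow> real" where
  "fock_inner d n f g = (\<Sum>k. \<integral> t. (\<Sum>i<d. \<Sum>ns\<in>idxs n k. f k t i ns * g k t i ns) \<partial>Tmeas k)"

definition fock_orthonormal :: "nat \<Rightarrow> nat \<Rightarrow> nat \<Rightarrow> (nat \<Rightarrow> fock) \<Rightarrow> bool" where
  "fock_orthonormal d n L e \<longleftrightarrow> (\<forall>l<L. e l \<in> fock_space d n) \<and>
     (\<forall>l<L. \<forall>l'<L. fock_inner d n (e l) (e l') = (if l = l' then 1 else 0))"

text \<open>Trace norm of an operator K : F^n(R^d1) -> F^n(R^d2):
  sup of sum_l |<K e_l, g_l>| over (finite) orthonormal systems (e_l), (g_l);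
  equals the sum of the singular values, and is infinity if K is not trace class.\<close>
definition trace_norm_fock :: "nat \<Rightarrow> nat \<Rightarrow> nat \<Rightarrow> (fock \<Rightarrow> fock) \<Rightarrow> ennreal" where
  "trace_norm_fock d1 d2 n K = (SUP (L, e, g) \<in> {(L, e, g). fock_orthonormal d1 n L e \<and> fock_orthonormal d2 n L g}.
      ennreal (\<Sum>l<L. \<bar>fock_inner d2 n (K (e l)) (g l)\<bar>))"

definition obs_map :: "(real \<Rightarrow> 'a \<Rightarrow> 'a) \<Rightarrow> (nat \<Rightarrow> 'a \<Rightarrow> 'a) \<Rightarrow> (nat \<Rightarrow> 'a \<Rightarrow> real) \<Rightarrow> 'a \<Rightarrow> fock" where
  "obs_map T N C x = (\<lambda>k t j ns. C j (oprod T N ns t 0 x))"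

text \<open>P_k(s)^* (x tensor e_ns) = T(s_k) N_{n_k} T(s_{k-1}) ... N_{n_1} T(s_0) x.\<close>
definition Pstar :: "(real \<Rightarrow> 'a \<Rightarrow> 'a) \<Rightarrow> (nat \<Rightarrow> 'a \<Rightarrow> 'a) \<Rightarrow> nat list \<Rightarrow> (nat \<Rightarrow> real) \<Rightarrow> 'a \<Rightarrow> 'a" where
  "Pstar T N ns s x = oprod T N (rev ns) (\<lambda>l. s (length ns - l)) 0 x"

text \<open>R f = sum_k int P_k(s)^* (B tensor id) f_k(s) ds.\<close>
definition reach_map :: "nat \<Rightarrow> (real \<Rightarrow> 'a::{real_inner,banach,second_countable_topology} \<Rightarrow> 'a) \<Rightarrow>
    (nat \<Rightarrow> 'a \<Rightarrow> 'a) \<Rightarrow> (nat \<Rightarrow> 'a) \<Rightarrow> fock \<Rightarrow> 'a" where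
  "reach_map n T N psi f = (\<Sum>k. \<integral> s. (\<Sum>i<n. \<Sum>ns\<in>idxs n k. f k s i ns *\<^sub>R Pstar T N ns s (psi i)) \<partial>Tmeas k)"

definition hankel :: "nat \<Rightarrow> (real \<Rightarrow> 'a::{real_inner,banach,second_countable_topology} \<Rightarrow> 'a) \<Rightarrow>
    (nat \<Rightarrow> 'a \<Rightarrow> 'a) \<Rightarrow> (nat \<Rightarrow> 'a) \<Rightarrow> (nat \<Rightarrow> 'a \<Rightarrow> real) \<Rightarrow> fock \<Rightarrow> fock" where
  "hankel n T N psi C f = obs_map T N C (reach_map n T N psi f)"

text \<open>G_k(s)_{(j,ns),i} = int h_{k,0}(t)_{(j,ns),i} exp(-<s,t>) dt, for s in C_+^(k+1)
  (variables s 0, ..., s k), with h_{k,0}(t) = O_k(t) B.\<close>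
definition transfer :: "(real \<Rightarrow> 'a::{real_inner,banach,second_countable_topology} \<Rightarrow> 'a) \<Rightarrow>
    (nat \<Rightarrow> 'a \<Rightarrow> 'a) \<Rightarrow> (nat \<Rightarrow> 'a) \<Rightarrow> (nat \<Rightarrow> 'a \<Rightarrow> real) \<Rightarrow> nat \<Rightarrow> (nat \<Rightarrow> complex) \<Rightarrow>
    nat \<Rightarrow> nat list \<Rightarrow> nat \<Rightarrow> complex" where
  "transfer T N psi C k s j ns i =
     (\<integral> t. complex_of_real (C j (oprod T N ns t 0 (psi i))) * exp (- (\<Sum>l\<le>k. s l * complex_of_real (t l))) \<partial>Tmeas k)"

text \<open>Squared (complexified) Hilbert--Schmidt norm of Delta(G_k)(s).\<close>
definition dG_sq :: "nat \<Rightarrow> nat \<Rightarrow> (real \<Rightarrow> 'a::{real_inner,banach,second_countable_topology} \<Rightarrow> 'a) \<Rightarrow>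
    (nat \<Rightarrow> 'a \<Rightarrow> 'a) \<Rightarrow> (nat \<Rightarrow> 'a) \<Rightarrow> (nat \<Rightarrow> 'a \<Rightarrow> real) \<Rightarrow>
    (real \<Rightarrow> 'b::{real_inner,banach,second_countable_topology} \<Rightarrow> 'b) \<Rightarrow>
    (nat \<Rightarrow> 'b \<Rightarrow> 'b) \<Rightarrow> (nat \<Rightarrow> 'b) \<Rightarrow> (nat \<Rightarrow> 'b \<Rightarrow> real) \<Rightarrow> nat \<Rightarrow> (nat \<Rightarrow> complex) \<Rightarrow> real" where
  "dG_sq n m T N psi C T' N' psi' C' k s =
     (\<Sum>j<m. \<Sum>ns\<in>idxs n k. \<Sum>i<n.
        (cmod (transfer T N psi C k s j ns i - transfer T' N' psi' C' k s j ns i))\<^sup>2)"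

definition ensqrt :: "ennreal \<Rightarrow> ennreal" where
  "ensqrt e = (if e = \<infinity> then \<infinity> else ennreal (sqrt (enn2real e)))"

text \<open>H^2 norm on C_+^q of a function given through its pointwise squared norm Fsq:
  sup_{x in (0,inf)^q} (2 pi)^(-q/2) (int_{R^q} ||F(x+iy)||^2 dy)^(1/2).\<close>
definition H2_norm :: "nat \<Rightarrow> ((nat \<Rightarrow> complex) \<Rightarrow> real) \<Rightarrow> ennreal" where
  "H2_norm q Fsq = (SUP x \<in> PiE {..<q} (\<lambda>_. {0<..}).
      ennreal ((2 * pi) powr (- real q / 2)) *
      ensqrt (\<integral>\<^sup>+ y. ennreal (Fsq (\<lambda>l. complex_of_real (x l) + \<i> * complex_of_real (y l)))
                 \<partial>PiM {..<q} (\<lambda>_. lborel)))"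

definition ins_at :: "nat \<Rightarrow> complex \<Rightarrow> (nat \<Rightarrow> complex) \<Rightarrow> nat \<Rightarrow> complex" where
  "ins_at i z w = (\<lambda>l. if l < i then w l else if l = i then z else w (l - 1))"

text \<open>Mixed norm H^infty_i H^2_{p-1} on C_+^p; i is 0-based here (paper: (i+1)-th variable).\<close>
definition mixed_norm :: "nat \<Rightarrow> nat \<Rightarrow> ((nat \<Rightarrow> complex) \<Rightarrow> real) \<Rightarrow> ennreal" where
  "mixed_norm i p Fsq = (SUP z \<in> {z. 0 < Re z}. H2_norm (p - 1) (\<lambda>w. Fsq (ins_at i z w)))"

end

theory Submission
  imports Defs "HOL-Probability.Probability"
begin

text \<open>If \<open>\<Delta>(H) = \<Sum>\<sigma>\<^sub>r a\<^sub>r \<otimes> b\<^sub>r\<close> is a singular value decomposition, its kernel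
  satisfies \<open>\<Delta>h(t, u + s, s') = \<Sum>\<sigma>\<^sub>r a\<^sub>r(t, u) b\<^sub>r(s', s)\<close>. Substituting \<open>u = 2 s\<close> in the middle variable,
  \<open>\<integral> \<Delta>h(t, u, s') e\<^bsup>-zu\<^esup> du = 2 \<integral> e\<^bsup>-2zs\<^esup> \<Delta>h(t, s + s, s') ds\<close> is a partial trace of the kernel; its \<open>L\<^sup>2\<close> norm
  in the outer variables is at most \<open>2 \<Sum>\<sigma>\<^sub>r \<parallel>a\<^sub>r\<parallel> \<parallel>b\<^sub>r\<parallel>\<close>, where only the level of \<open>a\<^sub>r\<close> and \<open>b\<^sub>r\<close> in
  question counts. Summing over the levels with Cauchy--Schwarz gives \<open>2 \<parallel>\<Delta>(H)\<parallel>\<^sub>T\<^sub>C\<close> for the even and for the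
  odd transfer functions separately. Plancherel in the outer variables then bounds the Hardy norms.

  No spectral theory of compact operators is needed: compressing \<open>\<Delta>(H)\<close> to normalised indicator functions of
  cubes with side \<open>1/(r+1)\<close> leaves a real matrix, whose singular value decomposition is elementary, and Fatou's
  lemma for \<open>r \<rightarrow> \<infinity>\<close> recovers the partial traces.\<close>

section \<open>Singular value decomposition of a finite real matrix\<close>

text \<open>The diagonal is a null set, so the partial trace makes no sense for a kernel that is
  merely square integrable: the continuity of the Volterra kernels has to enter. For a matrix of
  cell averages the diagonal is an honest finite sum, and refinement of the cells recovers the
  integral pointwise. Level \<open>2 k + off\<close> is split between output level \<open>k\<close>
  and input level \<open>k + off\<close>; for fixed \<open>off\<close> each level of either side
  then occurs at most once, so one pair of unit singular vectors pays for all \<open>k\<close>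
  together. The constant 4 is 2 (from u = 2 s) times 2 (the parities). The suprema over z sit inside
  the sum over \<open>k\<close> and need not be attained. Hence the weights are allowed to depend on
  \<open>k\<close>, subject only to modulus at most 1, and the estimate is proved for finitely many
  levels and for numbers strictly below the mixed norms. The supremum over x costs nothing, because
  the damping exp(-<x, t>) is at most 1.\<close>

definition orthonormal_on :: "'i set \<Rightarrow> nat \<Rightarrow> (nat \<Rightarrow> 'i \<Rightarrow> real) \<Rightarrow> bool" where
  "orthonormal_on I L a \<longleftrightarrow> (\<forall>r<L. \<forall>s<L. (\<Sum>i\<in>I. a r i * a s i) = (if r = s then 1 else 0))"

text \<open>Expands the nonnegative number ||P e_i - e_i||^2, where P e_i is the sum of the
  \<open>a r i * a r\<close>, the projection of the basis vector e_i onto the system; the result is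
  1 minus the left-hand side.\<close>

lemma orthonormal_on_Bessel_1:
  assumes "finite I" "orthonormal_on I L a" "i \<in> I"
  shows "(\<Sum>r<L. (a r i)\<^sup>2) \<le> 1"
proof -
  let ?s = "\<Sum>r<L. (a r i)\<^sup>2"
  have "(\<Sum>x\<in>I. ((\<Sum>r<L. a r i * a r x) - (if x = i then 1 else 0))\<^sup>2)
      = (\<Sum>x\<in>I. (\<Sum>r<L. a r i * a r x)\<^sup>2) - 2 * (\<Sum>x\<in>I. (\<Sum>r<L. a r i * a r x) * (if x = i then 1 else 0))
        + (\<Sum>x\<in>I. (if x = i then 1 else 0)\<^sup>2)"
    using sum_distrib_left[of 2 "\<lambda>x. (\<Sum>r<L. a r i * a r x) * (if x = i then 1 else 0)" I]
    by (simp only: power2_diff sum.distrib sum_subtractf mult.assoc)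
  also have "(\<Sum>x\<in>I. (\<Sum>r<L. a r i * a r x) * (if x = i then 1 else 0)) = ?s"
    using assms by (simp add: if_distrib[of "\<lambda>y. _ * y"] power2_eq_square cong: if_cong)
  also have "(\<Sum>x\<in>I. ((if x = i then 1 else 0)::real)\<^sup>2) = 1"
    using assms by (simp add: if_distrib[of "\<lambda>y. y\<^sup>2"] cong: if_cong)
  also have "(\<Sum>x\<in>I. (\<Sum>r<L. a r i * a r x)\<^sup>2)
      = (\<Sum>x\<in>I. \<Sum>r<L. \<Sum>s<L. a r i * a s i * (a r x * a s x))"
    by (simp add: power2_eq_square sum_product algebra_simps)
  also have "\<dots> = (\<Sum>r<L. \<Sum>s<L. a r i * a s i * (\<Sum>x\<in>I. a r x * a s x))"
    by (subst sum.swap, rule sum.cong[OF refl], subst sum.swap) (simp add: sum_distrib_left)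
  also have "\<dots> = (\<Sum>r<L. \<Sum>s<L. a r i * a s i * (if r = s then 1 else 0))"
    using assms(2) unfolding orthonormal_on_def by (intro sum.cong) auto
  also have "\<dots> = ?s"
    by (simp add: if_distrib[of "\<lambda>y. _ * y"] power2_eq_square cong: if_cong)
  finally have "0 \<le> ?s - 2 * ?s + 1"
    by (metis (no_types, lifting) sum_nonneg zero_le_power2)
  then show ?thesis by simp
qed

text \<open>Summing Bessel's inequality over \<open>I\<close> counts the vectors. This is what makes
  a system of singular vectors of maximal size exist.\<close>

lemma orthonormal_on_card:
  assumes "finite I" "orthonormal_on I L a"
  shows "L \<le> card I"
proof -
  have "real L = (\<Sum>r<L. \<Sum>i\<in>I. (a r i)\<^sup>2)"
    using assms(2) by (simp add: orthonormal_on_def power2_eq_square)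
  also have "\<dots> = (\<Sum>i\<in>I. \<Sum>r<L. (a r i)\<^sup>2)" by (rule sum.swap)
  also have "\<dots> \<le> (\<Sum>i\<in>I. 1)"
    using assms by (intro sum_mono orthonormal_on_Bessel_1) auto
  finally show ?thesis by simp
qed

text \<open>Vectors indexed by \<open>J\<close> are functions on the whole type that vanish off
  \<open>J\<close>. The sphere lies in a product of intervals [-1, 1], compact by Tychonoff, and its
  defining conditions are closed in the product topology.\<close>

lemma compact_finite_sphere:
  assumes "finite J"
  shows "compact {b::'j \<Rightarrow> real. (\<Sum>j\<in>J. (b j)\<^sup>2) = 1 \<and> (\<forall>j. j \<notin> J \<longrightarrow> b j = 0)}" (is "compact ?S")
proof -
  have "compactin (product_topology (\<lambda>_. euclidean) UNIV) (PiE UNIV (\<lambda>_::'j. {-1..1::real}))"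
    by (simp add: compactin_PiE)
  then have c: "compact (PiE UNIV (\<lambda>_::'j. {-1..1::real}))"
    by (simp add: euclidean_product_topology flip: compactin_euclidean_iff)
  have co: "continuous_on UNIV (\<lambda>b::'j \<Rightarrow> real. b j)" for j
    by (rule continuous_on_product_coordinates)
  have 1: "closed {b::'j \<Rightarrow> real. (\<Sum>j\<in>J. (b j)\<^sup>2) = 1}"
    by (intro closed_Collect_eq continuous_intros co)
  have 2: "closed (\<Inter>j\<in>-J. {b::'j \<Rightarrow> real. b j = 0})"
    by (intro closed_INT ballI closed_Collect_eq continuous_intros co)
  have sub: "?S \<subseteq> PiE UNIV (\<lambda>_. {-1..1})"
  proof
    fix b assume b: "b \<in> ?S"
    have "\<bar>b j\<bar> \<le> 1" for j
    proof (cases "j \<in> J")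
      case True
      then have "(b j)\<^sup>2 \<le> (\<Sum>j\<in>J. (b j)\<^sup>2)" using assms by (intro member_le_sum) auto
      then show ?thesis using b by (simp add: abs_square_le_1)
    qed (use b in auto)
    then show "b \<in> PiE UNIV (\<lambda>_. {-1..1})" by (auto simp: PiE_iff abs_le_iff minus_le_iff)
  qed
  have "?S = PiE UNIV (\<lambda>_. {-1..1}) \<inter> ({b. (\<Sum>j\<in>J. (b j)\<^sup>2) = 1} \<inter> (\<Inter>j\<in>-J. {b. b j = 0}))"
    using sub by blast
  then show ?thesis using compact_Int_closed[OF c closed_Int[OF 1 2]] by simp
qed

text \<open>A maximiser \<open>b\<close> of \<open>\<parallel>A b\<parallel>\<close> on the unit sphere makes the positive semidefinite form
  \<open>\<sigma>\<^sup>2 \<parallel>x\<parallel>\<^sup>2 - \<parallel>A x\<parallel>\<^sup>2\<close> vanish, so \<open>b\<close> is in its kernel.\<close>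
lemma singular_pair_exists:
  fixes A :: "'i \<Rightarrow> 'j \<Rightarrow> real"
  assumes I: "finite I" and J: "finite J" and nz: "\<exists>i\<in>I. \<exists>j\<in>J. A i j \<noteq> 0"
  obtains \<sigma> a b where "\<sigma> > 0" "(\<Sum>i\<in>I. (a i)\<^sup>2) = 1" "(\<Sum>j\<in>J. (b j)\<^sup>2) = 1"
    "\<And>i. i \<in> I \<Longrightarrow> (\<Sum>j\<in>J. A i j * b j) = \<sigma> * a i"
    "\<And>j. j \<in> J \<Longrightarrow> (\<Sum>i\<in>I. A i j * a i) = \<sigma> * b j"
proof -
  let ?S = "{b::'j \<Rightarrow> real. (\<Sum>j\<in>J. (b j)\<^sup>2) = 1 \<and> (\<forall>j. j \<notin> J \<longrightarrow> b j = 0)}"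
  define Ax where "Ax b i = (\<Sum>j\<in>J. A i j * b j)" for b i
  define f where "f b = (\<Sum>i\<in>I. (Ax b i)\<^sup>2)" for b
  obtain i0 j0 where ij: "i0 \<in> I" "j0 \<in> J" "A i0 j0 \<noteq> 0" using nz by auto
  define d :: "'j \<Rightarrow> real" where "d j = (if j = j0 then 1 else 0)" for j
  have d: "d \<in> ?S" using ij J by (auto simp: d_def if_distrib[of "\<lambda>y. y\<^sup>2"] cong: if_cong)
  have Axd: "Ax d i0 = A i0 j0"
    using ij J by (simp add: Ax_def d_def if_distrib[of "\<lambda>y. _ * y"] cong: if_cong)
  have "(Ax d i0)\<^sup>2 \<le> f d" unfolding f_def using ij I by (intro member_le_sum) auto
  then have fd: "f d > 0" using Axd ij by (smt (verit) zero_less_power2)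
  have "continuous_on ?S f" unfolding f_def Ax_def
    by (intro continuous_intros continuous_on_subset[OF continuous_on_product_coordinates]) auto
  then obtain b where b: "b \<in> ?S" and max: "\<And>x. x \<in> ?S \<Longrightarrow> f x \<le> f b"
    using continuous_attains_sup[OF compact_finite_sphere[OF J], of f] d by (metis (no_types, lifting) empty_iff)
  define \<sigma> where "\<sigma> = sqrt (f b)"
  have \<sigma>: "\<sigma> > 0" using max[OF d] fd by (simp add: \<sigma>_def)
  have \<sigma>2: "\<sigma>\<^sup>2 = f b" using \<sigma> by (simp add: \<sigma>_def)
  have bound: "f x \<le> \<sigma>\<^sup>2 * (\<Sum>j\<in>J. (x j)\<^sup>2)" for x
  proof (cases "(\<Sum>j\<in>J. (x j)\<^sup>2) = 0")
    case True
    then have "\<forall>j\<in>J. x j = 0" using J by (simp add: sum_nonneg_eq_0_iff)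
    then show ?thesis using True by (simp add: f_def Ax_def)
  next
    case False
    define c where "c = sqrt (\<Sum>j\<in>J. (x j)\<^sup>2)"
    have "0 \<le> (\<Sum>j\<in>J. (x j)\<^sup>2)" by (rule sum_nonneg) simp
    then have "0 < (\<Sum>j\<in>J. (x j)\<^sup>2)" using False by linarith
    then have c: "c > 0" "c\<^sup>2 = (\<Sum>j\<in>J. (x j)\<^sup>2)" by (simp_all add: c_def)
    define y where "y j = (if j \<in> J then x j / c else 0)" for j
    have "y \<in> ?S" using c by (auto simp: y_def power_divide simp flip: sum_divide_distrib)
    then have "f y \<le> \<sigma>\<^sup>2" using max \<sigma>2 by simp
    moreover have "Ax y i = Ax x i / c" for i
      by (simp add: Ax_def y_def sum_divide_distrib)
    then have "f y = f x / c\<^sup>2"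
      by (simp add: f_def power_divide flip: sum_divide_distrib)
    ultimately show ?thesis using c by (metis pos_divide_le_eq zero_less_power)
  qed
  define a where "a i = Ax b i / \<sigma>" for i
  have bnorm: "(\<Sum>j\<in>J. (b j)\<^sup>2) = 1" using b by simp
  have anorm: "(\<Sum>i\<in>I. (a i)\<^sup>2) = 1"
    using \<sigma> by (simp add: a_def power_divide \<sigma>2 flip: sum_divide_distrib f_def) (simp flip: \<sigma>2)
  have "(\<Sum>i\<in>I. A i j * a i) = \<sigma> * b j" if j: "j \<in> J" for j
  proof -
    let ?e = "\<lambda>j'. if j' = j then 1 else 0 :: real"
    define g where "g = (\<Sum>i\<in>I. Ax b i * A i j)"
    define h where "h = (\<Sum>i\<in>I. (A i j)\<^sup>2)"
    \<comment> \<open>The nonnegative form is evaluated at b + t e_j. The constant term vanishes by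
      the choice of \<open>b\<close>; \<open>g\<close> is the j-th entry of the transposed matrix
      applied to \<open>A b\<close>.\<close>
    have *: "0 \<le> 2 * t * (\<sigma>\<^sup>2 * b j - g) + t\<^sup>2 * (\<sigma>\<^sup>2 - h)" for t
    proof -
      let ?x = "\<lambda>j'. b j' + t * ?e j'"
      have "Ax ?x i = Ax b i + t * (\<Sum>j'\<in>J. A i j' * ?e j')" for i
        by (simp only: Ax_def distrib_left sum.distrib sum_distrib_left mult.left_commute)
      moreover have "(\<Sum>j'\<in>J. A i j' * ?e j') = A i j" for i
        using j J by (simp add: if_distrib[of "\<lambda>y. _ * y"] cong: if_cong)
      ultimately have "Ax ?x i = Ax b i + t * A i j" for i by simp
      then have "f ?x = f b + 2 * t * g + t\<^sup>2 * h"
        by (simp add: f_def power2_sum g_def h_def sum.distrib sum_distrib_left power_mult_distrib mult_ac)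
      moreover have "(\<Sum>j\<in>J. (?x j)\<^sup>2)
          = (\<Sum>j\<in>J. (b j)\<^sup>2) + t\<^sup>2 * (\<Sum>j\<in>J. (?e j)\<^sup>2) + 2 * t * (\<Sum>j\<in>J. b j * ?e j)"
        by (simp only: power2_sum sum.distrib power_mult_distrib sum_distrib_left mult_ac)
      moreover have "(\<Sum>j\<in>J. (?e j)\<^sup>2) = 1" "(\<Sum>j\<in>J. b j * ?e j) = b j"
        using j J by (simp_all add: if_distrib[of "\<lambda>y. _ * y"] if_distrib[of "\<lambda>y. y\<^sup>2"] cong: if_cong)
      ultimately show ?thesis using bound[of ?x] \<sigma>2 bnorm by (simp add: distrib_left right_diff_distrib left_diff_distrib mult_ac)
    qed
    have "\<sigma>\<^sup>2 * b j - g = 0"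
    proof (rule ccontr)
      define D where "D = \<sigma>\<^sup>2 * b j - g"
      define H where "H = \<bar>\<sigma>\<^sup>2 - h\<bar> + 1"
      assume "\<sigma>\<^sup>2 * b j - g \<noteq> 0"
      then have D: "D\<^sup>2 > 0" by (simp add: D_def)
      have H: "H > 0" "\<sigma>\<^sup>2 - h \<le> H" by (auto simp: H_def)
      \<comment> \<open>A polynomial in t that is nonnegative and vanishes at 0 has no linear term:
        since \<open>H\<close> majorises the quadratic coefficient, t = - D / H makes the value at
        most - D^2 / H.\<close>
      have "0 \<le> 2 * (- D / H) * D + (- D / H)\<^sup>2 * (\<sigma>\<^sup>2 - h)" using *[of "- D / H"] by (simp add: D_def)
      also have "\<dots> \<le> 2 * (- D / H) * D + (- D / H)\<^sup>2 * H"
        using H by (intro add_left_mono mult_left_mono) auto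
      also have "\<dots> = - (D\<^sup>2 / H)" using H by (simp add: power2_eq_square)
      finally show False using D H by (simp add: field_simps)
    qed
    moreover have "(\<Sum>i\<in>I. A i j * a i) = g / \<sigma>"
      by (simp add: a_def g_def sum_divide_distrib mult.commute)
    ultimately have "\<sigma> * (\<Sum>i\<in>I. A i j * a i) = \<sigma> * (\<sigma> * b j)"
      using \<sigma> by (simp add: power2_eq_square)
    then show ?thesis using \<sigma> by simp
  qed
  then show thesis
    using that[OF \<sigma> anorm bnorm] \<sigma> by (simp add: a_def Ax_def)
qed

text \<open>Used with \<open>v\<close> a row of the matrix and, with the roles of \<open>a\<close>
  and \<open>b\<close> exchanged, with \<open>v\<close> a column: what remains after subtracting the
  known singular triples sends the known singular vectors to 0.\<close>

lemma deflated_annihilates: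
  fixes v :: "'j \<Rightarrow> real" and L :: nat
  assumes "(\<Sum>j\<in>J. v j * b r j) = \<sigma> r * c r" "r < L"
    and "\<And>q. q < L \<Longrightarrow> (\<Sum>j\<in>J. b q j * b r j) = (if q = r then 1 else 0)"
  shows "(\<Sum>j\<in>J. (v j - (\<Sum>q<L. \<sigma> q * c q * b q j)) * b r j) = 0"
proof -
  have "(\<Sum>j\<in>J. (v j - (\<Sum>q<L. \<sigma> q * c q * b q j)) * b r j)
      = \<sigma> r * c r - (\<Sum>j\<in>J. \<Sum>q<L. \<sigma> q * c q * (b q j * b r j))"
    using assms(1) by (simp add: left_diff_distrib sum_subtractf sum_distrib_right mult.assoc)
  also have "(\<Sum>j\<in>J. \<Sum>q<L. \<sigma> q * c q * (b q j * b r j)) = (\<Sum>q<L. \<sigma> q * c q * (\<Sum>j\<in>J. b q j * b r j))"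
    by (subst sum.swap) (simp add: sum_distrib_left)
  also have "\<dots> = (\<Sum>q<L. if q = r then \<sigma> q * c q else 0)"
    using assms(3) by (intro sum.cong) auto
  also have "\<dots> = \<sigma> r * c r" using assms(2) by simp
  finally show ?thesis by simp
qed

text \<open>The range of the transpose is orthogonal to the kernel, as s <y, v> = <x, A v>. For a
  deflated matrix it makes a new singular vector orthogonal to the old ones.\<close>

lemma kernel_orthogonal_range:
  fixes A :: "'i \<Rightarrow> 'j \<Rightarrow> real"
  assumes "s > 0" "\<And>j. j \<in> J \<Longrightarrow> (\<Sum>i\<in>I. A i j * x i) = s * y j"
    and "\<And>i. i \<in> I \<Longrightarrow> (\<Sum>j\<in>J. A i j * v j) = 0"
  shows "(\<Sum>j\<in>J. y j * v j) = 0"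
proof -
  have "s * (\<Sum>j\<in>J. y j * v j) = (\<Sum>j\<in>J. (\<Sum>i\<in>I. A i j * x i) * v j)"
    by (simp add: assms(2) sum_distrib_left mult.assoc)
  also have "\<dots> = (\<Sum>i\<in>I. \<Sum>j\<in>J. A i j * x i * v j)"
    by (subst sum.swap) (simp add: sum_distrib_right)
  also have "\<dots> = (\<Sum>i\<in>I. x i * (\<Sum>j\<in>J. A i j * v j))"
    by (simp add: sum_distrib_left mult_ac)
  also have "\<dots> = 0" using assms(3) by simp
  finally show ?thesis using assms(1) by simp
qed

text \<open>Deflation from a maximal system of singular triples with positive singular values. If
  the remainder \<open>A'\<close> were nonzero, it would have a singular pair; this pair is
  orthogonal to the system, so the subtracted terms do not act on it, it is singular for
  \<open>A\<close> as well, and it enlarges the system.\<close>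

theorem finite_singular_value_decomposition:
  fixes A :: "'i \<Rightarrow> 'j \<Rightarrow> real"
  assumes I: "finite I" and J: "finite J"
  obtains L \<sigma> a b where "\<And>r. r < L \<Longrightarrow> \<sigma> r \<ge> 0" "orthonormal_on I L a" "orthonormal_on J L b"
    "\<And>i j. i \<in> I \<Longrightarrow> j \<in> J \<Longrightarrow> A i j = (\<Sum>r<L. \<sigma> r * a r i * b r j)"
proof -
  define P where "P L \<sigma> a b \<longleftrightarrow> (\<forall>r<L. \<sigma> r > 0) \<and> orthonormal_on I L a \<and> orthonormal_on J L b \<and>
     (\<forall>r<L. \<forall>i\<in>I. (\<Sum>j\<in>J. A i j * b r j) = \<sigma> r * a r i) \<and>
     (\<forall>r<L. \<forall>j\<in>J. (\<Sum>i\<in>I. A i j * a r i) = \<sigma> r * b r j)" for L \<sigma> a b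
  have bd: "\<forall>L. (\<exists>\<sigma> a b. P L \<sigma> a b) \<longrightarrow> L \<le> card I"
    using orthonormal_on_card[OF I] by (auto simp: P_def)
  have "P 0 (\<lambda>_. 0) (\<lambda>_ _. 0) (\<lambda>_ _. 0)" by (simp add: P_def orthonormal_on_def)
  then have ex0: "\<exists>\<sigma> a b. P 0 \<sigma> a b" by blast
  obtain L where L: "\<exists>\<sigma> a b. P L \<sigma> a b" and Lmax: "\<And>L'. \<exists>\<sigma> a b. P L' \<sigma> a b \<Longrightarrow> L' \<le> L"
    using Nat.ex_has_greatest_nat[of "\<lambda>L. \<exists>\<sigma> a b. P L \<sigma> a b", OF ex0 bd] by blast
  then obtain \<sigma> a b where "P L \<sigma> a b" by blast
  then have \<sigma>: "\<And>r. r < L \<Longrightarrow> \<sigma> r > 0"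
    and oa: "\<And>r s. r < L \<Longrightarrow> s < L \<Longrightarrow> (\<Sum>i\<in>I. a r i * a s i) = (if r = s then 1 else 0)"
    and ob: "\<And>r s. r < L \<Longrightarrow> s < L \<Longrightarrow> (\<Sum>i\<in>J. b r i * b s i) = (if r = s then 1 else 0)"
    and Ab: "\<And>r i. r < L \<Longrightarrow> i \<in> I \<Longrightarrow> (\<Sum>j\<in>J. A i j * b r j) = \<sigma> r * a r i"
    and Aa: "\<And>r j. r < L \<Longrightarrow> j \<in> J \<Longrightarrow> (\<Sum>i\<in>I. A i j * a r i) = \<sigma> r * b r j"
    by (auto simp: P_def orthonormal_on_def)
  define A' where "A' i j = A i j - (\<Sum>r<L. \<sigma> r * a r i * b r j)" for i j
  have "A' i j = 0" if ij: "i \<in> I" "j \<in> J" for i j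
  proof (rule ccontr)
    assume "A' i j \<noteq> 0"
    with ij obtain s x y where s: "s > 0" and x: "(\<Sum>i\<in>I. (x i)\<^sup>2) = 1" and y: "(\<Sum>j\<in>J. (y j)\<^sup>2) = 1"
      and A'y: "\<And>i. i \<in> I \<Longrightarrow> (\<Sum>j\<in>J. A' i j * y j) = s * x i"
      and A'x: "\<And>j. j \<in> J \<Longrightarrow> (\<Sum>i\<in>I. A' i j * x i) = s * y j"
      using singular_pair_exists[OF I J, of A'] by blast
    have A'b: "(\<Sum>j\<in>J. A' i j * b r j) = 0" if "i \<in> I" "r < L" for i r
      unfolding A'_def by (rule deflated_annihilates) (use Ab ob that in auto)
    have A'a: "(\<Sum>i\<in>I. A' i j * a r i) = 0" if "j \<in> J" "r < L" for j r
    proof -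
      have "(\<Sum>i\<in>I. (A i j - (\<Sum>q<L. \<sigma> q * b q j * a q i)) * a r i) = 0"
        by (rule deflated_annihilates) (use Aa oa that in auto)
      then show ?thesis by (simp only: A'_def mult.assoc mult.commute[of "b _ _" "a _ _"])
    qed
    have yb: "(\<Sum>j\<in>J. y j * b r j) = 0" if r: "r < L" for r
      by (rule kernel_orthogonal_range[where I = I and A = A' and x = x]) (use s A'x A'b r in auto)
    have xa: "(\<Sum>i\<in>I. x i * a r i) = 0" if r: "r < L" for r
      by (rule kernel_orthogonal_range[where I = J and A = "\<lambda>j i. A' i j" and x = y]) (use s A'y A'a r in auto)
    have Ay: "(\<Sum>j\<in>J. A i j * y j) = s * x i" if "i \<in> I" for i
    proof -
      have "(\<Sum>j\<in>J. A i j * y j) = (\<Sum>j\<in>J. A' i j * y j) + (\<Sum>j\<in>J. \<Sum>r<L. \<sigma> r * a r i * (y j * b r j))"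
        by (simp add: A'_def algebra_simps sum.distrib sum_distrib_left sum_distrib_right sum_subtractf)
      also have "(\<Sum>j\<in>J. \<Sum>r<L. \<sigma> r * a r i * (y j * b r j)) = (\<Sum>r<L. \<sigma> r * a r i * (\<Sum>j\<in>J. y j * b r j))"
        by (subst sum.swap) (simp add: sum_distrib_left)
      finally show ?thesis using that by (simp add: yb A'y)
    qed
    have Ax: "(\<Sum>i\<in>I. A i j * x i) = s * y j" if "j \<in> J" for j
    proof -
      have "(\<Sum>i\<in>I. A i j * x i) = (\<Sum>i\<in>I. A' i j * x i) + (\<Sum>i\<in>I. \<Sum>r<L. \<sigma> r * b r j * (x i * a r i))"
        by (simp add: A'_def algebra_simps sum.distrib sum_distrib_left sum_distrib_right sum_subtractf)
      also have "(\<Sum>i\<in>I. \<Sum>r<L. \<sigma> r * b r j * (x i * a r i)) = (\<Sum>r<L. \<sigma> r * b r j * (\<Sum>i\<in>I. x i * a r i))"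
        by (subst sum.swap) (simp add: sum_distrib_left)
      finally show ?thesis using that by (simp add: xa A'x)
    qed
    have "(\<Sum>i\<in>I. a r i * x i) = 0" "(\<Sum>j\<in>J. b r j * y j) = 0" if "r < L" for r
      using xa[OF that] yb[OF that] by (simp_all add: mult.commute)
    then have "P (Suc L) (\<sigma>(L := s)) (a(L := x)) (b(L := y))"
      unfolding P_def orthonormal_on_def
      using \<sigma> s x y oa ob Ab Aa Ax Ay xa yb by (auto simp: less_Suc_eq power2_eq_square)
    then have "Suc L \<le> L" by (intro Lmax) blast
    then show False by simp
  qed
  then have "\<And>i j. i \<in> I \<Longrightarrow> j \<in> J \<Longrightarrow> A i j = (\<Sum>r<L. \<sigma> r * a r i * b r j)"
    by (simp add: A'_def)
  moreover have "\<And>r. r < L \<Longrightarrow> \<sigma> r \<ge> 0" using \<sigma> by (simp add: less_imp_le)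
  ultimately show thesis using that[of L \<sigma> a b] oa ob by (simp add: orthonormal_on_def)
qed

section \<open>Twisted partial traces of a finite matrix\<close>

lemma L2_set_sum_triangle:
  assumes "finite A"
  shows "L2_set (\<lambda>x. \<Sum>i\<in>A. f i x) S \<le> (\<Sum>i\<in>A. L2_set (f i) S)"
  using assms
proof (induction A rule: finite_induct)
  case (insert i A)
  then show ?case using L2_set_triangle_ineq[of "f i" "\<lambda>x. \<Sum>i\<in>A. f i x" S] by simp
qed (simp add: L2_set_def)

lemma L2_set_prod:
  "L2_set (\<lambda>(x, y). f x * g y) (S \<times> S') = L2_set f S * L2_set g S'"
  by (simp add: L2_set_def power_mult_distrib case_prod_unfold sum_product sum.cartesian_product
      flip: real_sqrt_mult)

lemma sum_Sigma_prod:
  assumes "finite U" "\<And>k. k \<in> U \<Longrightarrow> finite (P k)" "finite S"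
  shows "(\<Sum>(k, x, p)\<in>(SIGMA k:U. P k \<times> S). f k x p) = (\<Sum>k\<in>U. \<Sum>p\<in>S. \<Sum>x\<in>P k. f k x p)"
proof -
  have "(\<Sum>(k, x, p)\<in>(SIGMA k:U. P k \<times> S). f k x p) = (\<Sum>k\<in>U. \<Sum>(x, p)\<in>P k \<times> S. f k x p)"
    by (subst sum.Sigma) (use assms in auto)
  also have "\<dots> = (\<Sum>k\<in>U. \<Sum>p\<in>S. \<Sum>x\<in>P k. f k x p)"
    by (intro sum.cong refl) (subst sum.swap, simp add: sum.cartesian_product)
  finally show ?thesis .
qed

text \<open>\<open>p\<close> is the middle coordinate, common to row and column; \<open>x\<close>
  and \<open>y\<close> are the outer ones. A rank-one term contributes at most
  \<open>\<sigma> r\<close> times a scalar product of block norms, because the \<open>x\<close> and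
  \<open>y\<close> dependence factorises. Row and column levels run together through
  \<open>k\<close>, so each block is used once over all levels. The weights vary with
  \<open>k\<close>, which leaves every level free to have its own z.\<close>

lemma twisted_partial_traces_le:
  fixes A :: "nat \<times> 'x \<times> nat \<Rightarrow> nat \<times> 'y \<times> nat \<Rightarrow> real" and w :: "nat \<Rightarrow> nat \<Rightarrow> complex"
  assumes fin: "\<And>k. finite (P k)" "\<And>k. finite (Q k)"
    and w: "\<And>k p. norm (w k p) \<le> 1"
    and \<sigma>: "\<And>r. r < L \<Longrightarrow> \<sigma> r \<ge> 0"
    and a: "orthonormal_on (SIGMA k:{..<K}. P k \<times> {..<R}) L a"
    and b: "orthonormal_on (SIGMA k:{..<K}. Q k \<times> {..<R}) L b"
    and A: "\<And>\<alpha> \<beta>. \<alpha> \<in> (SIGMA k:{..<K}. P k \<times> {..<R}) \<Longrightarrow> \<beta> \<in> (SIGMA k:{..<K}. Q k \<times> {..<R}) \<Longrightarrow>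
            A \<alpha> \<beta> = (\<Sum>r<L. \<sigma> r * a r \<alpha> * b r \<beta>)"
  shows "(\<Sum>k<K. L2_set (\<lambda>(x, y). norm (\<Sum>p<R. w k p * of_real (A (k, x, p) (k, y, p)))) (P k \<times> Q k))
         \<le> (\<Sum>r<L. \<sigma> r)"
proof -
  define na where "na r k p = L2_set (\<lambda>x. a r (k, x, p)) (P k)" for r k p
  define nb where "nb r k p = L2_set (\<lambda>y. b r (k, y, p)) (Q k)" for r k p
  have nneg: "na r k p \<ge> 0" "nb r k p \<ge> 0" for r k p by (auto simp: na_def nb_def)
  have "L2_set (\<lambda>(x, y). norm (\<Sum>p<R. w k p * of_real (A (k, x, p) (k, y, p)))) (P k \<times> Q k)
      \<le> (\<Sum>r<L. \<sigma> r * (\<Sum>p<R. na r k p * nb r k p))" if k: "k < K" for k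
  proof -
    have "L2_set (\<lambda>(x, y). norm (\<Sum>p<R. w k p * of_real (A (k, x, p) (k, y, p)))) (P k \<times> Q k)
      \<le> L2_set (\<lambda>z. \<Sum>r<L. (\<lambda>(x, y). \<Sum>p<R. \<sigma> r * (\<bar>a r (k, x, p)\<bar> * \<bar>b r (k, y, p)\<bar>)) z) (P k \<times> Q k)"
    proof (intro L2_set_mono, clarsimp)
      fix x y assume xy: "x \<in> P k" "y \<in> Q k"
      have "norm (\<Sum>p<R. w k p * of_real (A (k, x, p) (k, y, p))) \<le> (\<Sum>p<R. \<bar>A (k, x, p) (k, y, p)\<bar>)"
        by (rule order_trans[OF norm_sum sum_mono]) (simp add: norm_mult w mult_left_le_one_le)
      also have "\<dots> \<le> (\<Sum>p<R. \<Sum>r<L. \<sigma> r * (\<bar>a r (k, x, p)\<bar> * \<bar>b r (k, y, p)\<bar>))"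
      proof (rule sum_mono)
        fix p assume "p \<in> {..<R}"
        then show "\<bar>A (k, x, p) (k, y, p)\<bar> \<le> (\<Sum>r<L. \<sigma> r * (\<bar>a r (k, x, p)\<bar> * \<bar>b r (k, y, p)\<bar>))"
          using xy k \<sigma>
          by (subst A) (auto intro!: order_trans[OF sum_abs] sum_mono simp: abs_mult mult.assoc)
      qed
      finally show "norm (\<Sum>p<R. w k p * of_real (A (k, x, p) (k, y, p)))
        \<le> (\<Sum>r<L. \<Sum>p<R. \<sigma> r * (\<bar>a r (k, x, p)\<bar> * \<bar>b r (k, y, p)\<bar>))"
        by (subst sum.swap)
    qed auto
    also have "\<dots> \<le> (\<Sum>r<L. L2_set (\<lambda>(x, y). \<Sum>p<R. \<sigma> r * (\<bar>a r (k, x, p)\<bar> * \<bar>b r (k, y, p)\<bar>)) (P k \<times> Q k))"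
      by (rule L2_set_sum_triangle) auto
    also have "\<dots> \<le> (\<Sum>r<L. \<sigma> r * (\<Sum>p<R. na r k p * nb r k p))"
    proof (rule sum_mono)
      fix r assume r: "r \<in> {..<L}"
      have "L2_set (\<lambda>(x, y). \<Sum>p<R. \<sigma> r * (\<bar>a r (k, x, p)\<bar> * \<bar>b r (k, y, p)\<bar>)) (P k \<times> Q k)
         = L2_set (\<lambda>z. \<Sum>p<R. (\<lambda>(x, y). (\<sigma> r * \<bar>a r (k, x, p)\<bar>) * \<bar>b r (k, y, p)\<bar>) z) (P k \<times> Q k)"
        by (intro L2_set_cong) (auto simp: mult.assoc)
      also have "\<dots> \<le> (\<Sum>p<R. L2_set (\<lambda>(x, y). (\<sigma> r * \<bar>a r (k, x, p)\<bar>) * \<bar>b r (k, y, p)\<bar>) (P k \<times> Q k))"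
        by (rule L2_set_sum_triangle) auto
      also have "\<dots> = (\<Sum>p<R. \<sigma> r * (na r k p * nb r k p))"
        using \<sigma>[of r] r by (simp add: L2_set_prod na_def nb_def flip: L2_set_right_distrib)
          (simp add: L2_set_def mult.assoc)
      finally show "L2_set (\<lambda>(x, y). \<Sum>p<R. \<sigma> r * (\<bar>a r (k, x, p)\<bar> * \<bar>b r (k, y, p)\<bar>)) (P k \<times> Q k)
          \<le> \<sigma> r * (\<Sum>p<R. na r k p * nb r k p)" by (simp add: sum_distrib_left)
    qed
    finally show ?thesis .
  qed
  then have "(\<Sum>k<K. L2_set (\<lambda>(x, y). norm (\<Sum>p<R. w k p * of_real (A (k, x, p) (k, y, p)))) (P k \<times> Q k))
     \<le> (\<Sum>k<K. \<Sum>r<L. \<sigma> r * (\<Sum>p<R. na r k p * nb r k p))"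
    by (intro sum_mono) auto
  also have "\<dots> = (\<Sum>r<L. \<sigma> r * (\<Sum>k<K. \<Sum>p<R. na r k p * nb r k p))"
    by (subst sum.swap) (simp add: sum_distrib_left)
  also have "\<dots> \<le> (\<Sum>r<L. \<sigma> r * 1)"
  proof (intro sum_mono mult_left_mono)
    fix r assume r: "r \<in> {..<L}"
    have na: "(\<Sum>k<K. \<Sum>p<R. (na r k p)\<^sup>2) = 1"
    proof -
      have "(\<Sum>k<K. \<Sum>p<R. (na r k p)\<^sup>2) = (\<Sum>(k, x, p)\<in>(SIGMA k:{..<K}. P k \<times> {..<R}). (a r (k, x, p))\<^sup>2)"
        by (subst sum_Sigma_prod) (auto simp: fin na_def L2_set_def sum_nonneg)
      then show ?thesis using a r by (simp add: orthonormal_on_def power2_eq_square case_prod_unfold)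
    qed
    have nb: "(\<Sum>k<K. \<Sum>p<R. (nb r k p)\<^sup>2) = 1"
    proof -
      have "(\<Sum>k<K. \<Sum>p<R. (nb r k p)\<^sup>2) = (\<Sum>(k, x, p)\<in>(SIGMA k:{..<K}. Q k \<times> {..<R}). (b r (k, x, p))\<^sup>2)"
        by (subst sum_Sigma_prod) (auto simp: fin nb_def L2_set_def sum_nonneg)
      then show ?thesis using b r by (simp add: orthonormal_on_def power2_eq_square case_prod_unfold)
    qed
    \<comment> \<open>Cauchy--Schwarz over all pairs (k, p) at once. The block norms of one singular
      vector have square sum 1 over all levels, so the number of levels does not enter.\<close>
    have "(\<Sum>k<K. \<Sum>p<R. na r k p * nb r k p)
       = (\<Sum>z\<in>{..<K}\<times>{..<R}. \<bar>na r (fst z) (snd z)\<bar> * \<bar>nb r (fst z) (snd z)\<bar>)"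
      using nneg by (simp add: sum.cartesian_product case_prod_unfold)
    also have "\<dots> \<le> L2_set (\<lambda>z. na r (fst z) (snd z)) ({..<K}\<times>{..<R}) * L2_set (\<lambda>z. nb r (fst z) (snd z)) ({..<K}\<times>{..<R})"
      by (rule L2_set_mult_ineq)
    also have "\<dots> = 1"
      using na nb by (simp add: L2_set_def sum.cartesian_product case_prod_unfold)
    finally show "(\<Sum>k<K. \<Sum>p<R. na r k p * nb r k p) \<le> 1" .
  qed (use \<sigma> in auto)
  finally show ?thesis by simp
qed

section \<open>The positive orthant and its cells\<close>

lemma finite_idxs [simp, intro]: "finite (idxs n k)"
  unfolding idxs_def using finite_lists_length_eq[of "{..<n}" k] by (simp add: conj_commute)

lemma length_idxs: "ns \<in> idxs n k \<Longrightarrow> length ns = k"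
  by (simp add: idxs_def)

abbreviation half_line :: "real measure" where
  "half_line \<equiv> restrict_space lborel {0<..}"

definition orthant :: "nat \<Rightarrow> (nat \<Rightarrow> real) measure" where
  "orthant q = PiM {..<q} (\<lambda>_. half_line)"

lemma Tmeas_eq_orthant: "Tmeas k = orthant (Suc k)"
  by (simp add: Tmeas_def orthant_def lessThan_Suc_atMost)

lemma sigma_finite_half_line: "sigma_finite_measure half_line"
  by (intro sigma_finite_measure_restrict_space lborel.sigma_finite_measure_axioms) auto

interpretation half_line: product_sigma_finite "\<lambda>_::nat. half_line"
  by (simp add: product_sigma_finite_def sigma_finite_half_line)

lemma sigma_finite_orthant: "sigma_finite_measure (orthant q)"
  unfolding orthant_def by (rule half_line.sigma_finite) simp

lemma space_half_line [simp]: "space half_line = {0<..}"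
  by (simp add: space_restrict_space)

lemma sets_half_line_iff: "A \<in> sets half_line \<longleftrightarrow> A \<in> sets borel \<and> A \<subseteq> {0<..}"
  by (subst sets_restrict_space_iff) auto

lemma emeasure_half_line: "A \<in> sets half_line \<Longrightarrow> emeasure half_line A = emeasure lborel A"
  by (subst emeasure_restrict_space) (auto simp: sets_half_line_iff)

lemma borel_measurable_half_line [measurable (raw)]:
  "f \<in> borel_measurable borel \<Longrightarrow> f \<in> borel_measurable half_line"
  by (rule measurable_restrict_space1) simp

lemma space_orthant: "space (orthant q) = PiE {..<q} (\<lambda>_. {0<..})"
  by (simp add: orthant_def space_PiM)

lemma orthant_pos: "t \<in> space (orthant q) \<Longrightarrow> l < q \<Longrightarrow> 0 < t l"
  by (auto simp: space_orthant PiE_iff)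

lemma orthant_nonneg: "t \<in> space (orthant q) \<Longrightarrow> l < q \<Longrightarrow> 0 \<le> t l"
  using orthant_pos less_imp_le by blast

lemma measurable_orthant_component [measurable]:
  assumes "l < q"
  shows "(\<lambda>t. t l) \<in> measurable (orthant q) half_line"
  unfolding orthant_def using assms by (intro measurable_component_singleton) simp

lemma borel_measurable_orthant_component [measurable]:
  assumes "l < q"
  shows "(\<lambda>t. t l) \<in> borel_measurable (orthant q)"
proof -
  have "(\<lambda>x::real. x) \<in> borel_measurable half_line" by (rule borel_measurable_half_line) simp
  from measurable_compose[OF measurable_orthant_component[OF assms] this] show ?thesis .
qed

lemma integrable_half_line_exp:
  assumes "0 < a"
  shows "integrable half_line (\<lambda>u. exp (- a * u))"
proof (rule integrableI_nonneg)
  have "(\<integral>\<^sup>+u. ennreal (exp (- a * u)) \<partial>half_line) = (\<integral>\<^sup>+u. ennreal (exp (- a * u)) * indicator {0<..} u \<partial>lborel)"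
    by (subst nn_integral_restrict_space) auto
  also have "\<dots> \<le> (\<integral>\<^sup>+u. ennreal (exp (- a * u)) * indicator {0..} u \<partial>lborel)"
    by (intro nn_integral_mono) (auto split: split_indicator)
  also have "\<dots> = ennreal (0 - (- exp (- a * 0) / a))"
  proof (rule nn_integral_FTC_atLeast)
    have "((\<lambda>x. - exp (- a * x) / a) \<longlongrightarrow> - 0 / a) at_top"
      using assms by (intro tendsto_intros filterlim_compose[OF exp_at_bot]
          filterlim_tendsto_neg_mult_at_bot[OF tendsto_const]) (auto intro: filterlim_ident)
    then show "((\<lambda>x. - exp (- a * x) / a) \<longlongrightarrow> 0) at_top" by simp
  qed (use assms in \<open>auto intro!: derivative_eq_intros\<close>)
  finally show "(\<integral>\<^sup>+u. ennreal (exp (- a * u)) \<partial>half_line) < \<infinity>"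
    by (simp add: order_le_less_trans)
qed auto

lemma integrable_orthant_exp:
  assumes "0 < a"
  shows "integrable (orthant q) (\<lambda>t. exp (- a * (\<Sum>l<q. t l)))"
proof -
  have "integrable (orthant q) (\<lambda>t. \<Prod>l<q. exp (- a * t l))"
    unfolding orthant_def
    by (rule half_line.product_integrable_prod) (use integrable_half_line_exp[OF assms] in auto)
  then show ?thesis by (simp add: exp_sum[symmetric] sum_distrib_left)
qed

definition insert_coord :: "nat \<Rightarrow> 'a \<Rightarrow> (nat \<Rightarrow> 'a) \<Rightarrow> nat \<Rightarrow> 'a" where
  "insert_coord k u \<tau> l = (if l < k then \<tau> l else if l = k then u else \<tau> (l - 1))"

lemma ins_at_eq_insert_coord: "ins_at k z w = insert_coord k z w"
  by (auto simp: ins_at_def insert_coord_def)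

lemma prod_remove_coord:
  assumes "k \<le> q"
  shows "(\<Prod>l<Suc q. f l) = f k * (\<Prod>l<q. f (if l < k then l else Suc l) :: 'a::comm_monoid_mult)"
proof -
  have "bij_betw (\<lambda>l. if l < k then l else Suc l) {..<q} ({..<Suc q} - {k})"
    by (rule bij_betw_byWitness[where f' = "\<lambda>l. if l < k then l else l - 1"]) (use assms in auto)
  then have "(\<Prod>l\<in>{..<Suc q} - {k}. f l) = (\<Prod>l<q. f (if l < k then l else Suc l))"
    by (simp add: prod.reindex_bij_betw[symmetric])
  then show ?thesis using assms by (subst prod.remove[of _ k]) auto
qed

text \<open>Prepares Fubini with an arbitrary coordinate \<open>k\<close> singled out. A product
  measure is determined by its values on boxes, and a box pulls back to its k-th side times the box
  of the remaining sides. \<open>restrict\<close> appears because points of a product space are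
  extensional.\<close>

lemma orthant_Suc_eq_distr:
  assumes k: "k \<le> q"
  defines "F \<equiv> \<lambda>(u, \<tau>). restrict (insert_coord k u \<tau>) {..<Suc q}"
  shows measurable_insert_coord: "F \<in> measurable (half_line \<Otimes>\<^sub>M orthant q) (orthant (Suc q))"
    and "orthant (Suc q) = distr (half_line \<Otimes>\<^sub>M orthant q) (orthant (Suc q)) F"
proof -
  show m: "F \<in> measurable (half_line \<Otimes>\<^sub>M orthant q) (orthant (Suc q))"
    unfolding F_def orthant_def[of "Suc q"] case_prod_unfold
  proof (rule measurable_restrict)
    fix l assume "l \<in> {..<Suc q}"
    then show "(\<lambda>x. insert_coord k (fst x) (snd x) l) \<in> measurable (half_line \<Otimes>\<^sub>M orthant q) half_line"
      using k by (cases "l < k"; cases "l = k")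
        (auto simp: insert_coord_def intro!: measurable_compose[OF measurable_snd] measurable_orthant_component)
  qed
  have "distr (half_line \<Otimes>\<^sub>M orthant q) (orthant (Suc q)) F = PiM {..<Suc q} (\<lambda>_. half_line)"
  proof (rule half_line.PiM_eqI)
    fix A assume A: "\<And>i. i \<in> {..<Suc q} \<Longrightarrow> A i \<in> sets half_line"
    define s where "s l = (if l < k then l else Suc l)" for l
    have As: "A (s l) \<in> sets half_line" if "l < q" for l using that A by (simp add: s_def)
    have sub: "A i \<subseteq> {0<..}" if "i < Suc q" for i using A[of i] that by (simp add: sets_half_line_iff)
    have "emeasure (distr (half_line \<Otimes>\<^sub>M orthant q) (orthant (Suc q)) F) (Pi\<^sub>E {..<Suc q} A)
       = emeasure (half_line \<Otimes>\<^sub>M orthant q) (F -` Pi\<^sub>E {..<Suc q} A \<inter> space (half_line \<Otimes>\<^sub>M orthant q))"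
      using A by (intro emeasure_distr m) (auto simp: orthant_def intro!: sets_PiM_I_finite)
    also have "F -` Pi\<^sub>E {..<Suc q} A \<inter> space (half_line \<Otimes>\<^sub>M orthant q) = A k \<times> Pi\<^sub>E {..<q} (\<lambda>l. A (s l))"
    proof (intro equalityI subrelI)
      fix u \<tau> assume "(u, \<tau>) \<in> F -` Pi\<^sub>E {..<Suc q} A \<inter> space (half_line \<Otimes>\<^sub>M orthant q)"
      then have h: "\<And>l. l < Suc q \<Longrightarrow> insert_coord k u \<tau> l \<in> A l" and ext: "\<tau> \<in> extensional {..<q}"
        by (auto simp: F_def space_pair_measure space_orthant PiE_def Pi_iff)
      have "\<tau> l \<in> A (s l)" if "l < q" for l
        using h[of "s l"] that by (auto simp: s_def insert_coord_def split: if_splits)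
      then show "(u, \<tau>) \<in> A k \<times> Pi\<^sub>E {..<q} (\<lambda>l. A (s l))"
        using ext h[of k] k by (auto simp: PiE_def insert_coord_def)
    next
      fix u \<tau> assume "(u, \<tau>) \<in> A k \<times> Pi\<^sub>E {..<q} (\<lambda>l. A (s l))"
      then have u: "u \<in> A k" and \<tau>: "\<tau> \<in> Pi\<^sub>E {..<q} (\<lambda>l. A (s l))" by auto
      have 1: "\<tau> l \<in> A (s l)" if "l < q" for l using \<tau> that by auto
      have "insert_coord k u \<tau> l \<in> A l" if "l < Suc q" for l
        using 1[of l] 1[of "l - 1"] u that k by (cases l) (auto simp: insert_coord_def s_def)
      moreover have "\<tau> l > 0" if "l < q" for l
        using 1[OF that] As[OF that] by (auto simp: sets_half_line_iff)
      ultimately show "(u, \<tau>) \<in> F -` Pi\<^sub>E {..<Suc q} A \<inter> space (half_line \<Otimes>\<^sub>M orthant q)"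
        using u sub[of k] k \<tau> by (auto simp: F_def space_pair_measure space_orthant PiE_def)
    qed
    also have "emeasure (half_line \<Otimes>\<^sub>M orthant q) (A k \<times> Pi\<^sub>E {..<q} (\<lambda>l. A (s l)))
       = emeasure half_line (A k) * emeasure (orthant q) (Pi\<^sub>E {..<q} (\<lambda>l. A (s l)))"
      using A k As
      by (intro sigma_finite_measure.emeasure_pair_measure_Times[OF sigma_finite_orthant])
        (auto simp: orthant_def intro!: sets_PiM_I_finite)
    also have "emeasure (orthant q) (Pi\<^sub>E {..<q} (\<lambda>l. A (s l))) = (\<Prod>l<q. emeasure half_line (A (s l)))"
      unfolding orthant_def using As by (intro half_line.emeasure_PiM) auto
    also have "emeasure half_line (A k) * \<dots> = (\<Prod>l<Suc q. emeasure half_line (A l))"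
      unfolding prod_remove_coord[OF k] s_def ..
    finally show "emeasure (distr (half_line \<Otimes>\<^sub>M orthant q) (orthant (Suc q)) F) (Pi\<^sub>E {..<Suc q} A)
      = (\<Prod>i\<in>{..<Suc q}. emeasure half_line (A i))" .
  qed (auto simp: orthant_def)
  then show "orthant (Suc q) = distr (half_line \<Otimes>\<^sub>M orthant q) (orthant (Suc q)) F"
    by (simp add: orthant_def)
qed

section \<open>Partition of the orthant into cubes\<close>

definition cell_index :: "nat \<Rightarrow> real \<Rightarrow> nat" where
  "cell_index r u = nat \<lfloor>u * real (Suc r)\<rfloor>"

definition cell :: "nat \<Rightarrow> nat \<Rightarrow> nat list \<Rightarrow> (nat \<Rightarrow> real) set" where
  "cell r q C = {t \<in> space (orthant q). \<forall>l<q. cell_index r (t l) = C ! l}"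

lemma cell_index_bounds:
  assumes "0 < u"
  shows "real (cell_index r u) / real (Suc r) \<le> u" "u < (real (cell_index r u) + 1) / real (Suc r)"
proof -
  have "0 \<le> u * real (Suc r)" using assms by simp
  then have "real (cell_index r u) = of_int \<lfloor>u * real (Suc r)\<rfloor>" by (simp add: cell_index_def)
  then have "real (cell_index r u) \<le> u * real (Suc r)" "u * real (Suc r) < real (cell_index r u) + 1"
    by linarith+
  then show "real (cell_index r u) / real (Suc r) \<le> u" "u < (real (cell_index r u) + 1) / real (Suc r)"
    by (simp_all add: pos_divide_le_eq pos_less_divide_eq)
qed

lemma cell_index_eq_iff:
  assumes "0 < u"
  shows "cell_index r u = c \<longleftrightarrow> real c / real (Suc r) \<le> u \<and> u < (real c + 1) / real (Suc r)"
proof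
  assume *: "real c / real (Suc r) \<le> u \<and> u < (real c + 1) / real (Suc r)"
  have "real c / real (Suc r) < (real (cell_index r u) + 1) / real (Suc r)"
    "real (cell_index r u) / real (Suc r) < (real c + 1) / real (Suc r)"
    using * cell_index_bounds[OF assms, of r] by linarith+
  then have "real c < real (cell_index r u) + 1" "real (cell_index r u) < real c + 1"
    by (simp_all add: divide_less_cancel)
  then show "cell_index r u = c" by linarith
qed (use cell_index_bounds[OF assms] in auto)

lemma cell_interval:
  shows sets_cell_interval: "{u. 0 < u \<and> cell_index r u = c} \<in> sets half_line"
    and emeasure_cell_interval: "emeasure half_line {u. 0 < u \<and> cell_index r u = c} = ennreal (1 / real (Suc r))"
proof -
  let ?a = "real c / real (Suc r)" and ?b = "(real c + 1) / real (Suc r)"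
  \<comment> \<open>The half line excludes 0, so the first interval is open on the left.\<close>
  have eq: "{u. 0 < u \<and> cell_index r u = c} = (if c = 0 then {?a<..<?b} else {?a..<?b})"
  proof (cases "c = 0")
    case True
    then show ?thesis using cell_index_eq_iff[of _ r 0] by auto
  next
    case False
    then have "0 < ?a" by simp
    then have "{u. 0 < u \<and> cell_index r u = c} = {?a..<?b}"
      using cell_index_eq_iff[of _ r c] less_le_trans[of 0 ?a] by (fastforce simp del: of_nat_Suc)
    with False show ?thesis by simp
  qed
  show "{u. 0 < u \<and> cell_index r u = c} \<in> sets half_line"
    unfolding sets_half_line_iff by (simp add: eq) (use eq in \<open>auto split: if_splits\<close>)
  then have "emeasure half_line {u. 0 < u \<and> cell_index r u = c} = ennreal (?b - ?a)"
    by (simp add: emeasure_half_line) (simp add: eq divide_right_mono)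
  also have "?b - ?a = 1 / real (Suc r)" by (simp add: add_divide_distrib)
  finally show "emeasure half_line {u. 0 < u \<and> cell_index r u = c} = ennreal (1 / real (Suc r))" .
qed

lemma cell_eq_PiE: "cell r q C = Pi\<^sub>E {..<q} (\<lambda>l. {u. 0 < u \<and> cell_index r u = C ! l})"
  by (auto simp: cell_def space_orthant PiE_def Pi_def)

lemma sets_cell [measurable]: "cell r q C \<in> sets (orthant q)"
  unfolding cell_eq_PiE orthant_def by (intro sets_PiM_I_finite sets_cell_interval) auto

lemma emeasure_cell: "emeasure (orthant q) (cell r q C) = ennreal (1 / real (Suc r) ^ q)"
  unfolding cell_eq_PiE orthant_def
  by (subst half_line.emeasure_PiM)
    (auto simp: sets_cell_interval emeasure_cell_interval ennreal_power power_one_over simp del: of_nat_Suc)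

lemma measure_cell: "measure (orthant q) (cell r q C) = 1 / real (Suc r) ^ q"
  by (simp add: measure_def emeasure_cell)

lemma cell_disjoint:
  assumes "length C = q" "length D = q" "t \<in> cell r q C" "t \<in> cell r q D"
  shows "C = D"
  using assms by (auto simp: cell_def intro: nth_equalityI)

lemma in_cell_iff:
  assumes "t \<in> space (orthant q)" "length C = q"
  shows "t \<in> cell r q C \<longleftrightarrow> map (\<lambda>l. cell_index r (t l)) [0..<q] = C"
  using assms by (auto simp: cell_def list_eq_iff_nth_eq)

lemma cell_index_close:
  assumes "0 < a" "0 < b" "cell_index r a = cell_index r b"
  shows "\<bar>a - b\<bar> \<le> 1 / real (Suc r)"
  using cell_index_bounds[OF assms(1), of r] cell_index_bounds[OF assms(2), of r] assms(3)
  by (simp add: add_divide_distrib abs_le_iff)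

text \<open>Reads a finite sum over middle cells as an integral over the half line, so that the
  limit of such sums can be taken by dominated convergence.\<close>

lemma integral_half_line_step:
  fixes f :: "nat \<Rightarrow> 'a::{banach, second_countable_topology}"
  shows "integrable half_line (\<lambda>u. if cell_index r u < R then f (cell_index r u) else 0)"
    and "(\<integral>u. (if cell_index r u < R then f (cell_index r u) else 0) \<partial>half_line) = (\<Sum>p<R. f p /\<^sub>R real (Suc r))"
proof -
  let ?J = "\<lambda>p. {u. 0 < u \<and> cell_index r u = p}"
  have eq: "(if cell_index r u < R then f (cell_index r u) else 0) = (\<Sum>p<R. indicator (?J p) u *\<^sub>R f p)"
    if "u \<in> space half_line" for u
  proof -
    have "(\<Sum>p<R. indicator (?J p) u *\<^sub>R f p) = (\<Sum>p<R. if p = cell_index r u then f p else 0)"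
      using that by (intro sum.cong) (auto simp: indicator_def)
    then show ?thesis by simp
  qed
  have hb: "has_bochner_integral half_line (\<lambda>u. indicator (?J p) u *\<^sub>R f p) (f p /\<^sub>R real (Suc r))" for p
  proof -
    have "has_bochner_integral half_line (indicator (?J p)) (measure half_line (?J p))"
      by (rule has_bochner_integral_real_indicator) (simp_all add: sets_cell_interval emeasure_cell_interval)
    from has_bochner_integral_scaleR_left[OF this, of "f p"]
    show ?thesis by (simp add: measure_def emeasure_cell_interval divide_inverse_commute del: of_nat_Suc)
  qed
  then have hs: "has_bochner_integral half_line (\<lambda>u. \<Sum>p<R. indicator (?J p) u *\<^sub>R f p) (\<Sum>p<R. f p /\<^sub>R real (Suc r))"
    by (intro has_bochner_integral_sum)
  have "has_bochner_integral half_line (\<lambda>u. if cell_index r u < R then f (cell_index r u) else 0) (\<Sum>p<R. f p /\<^sub>R real (Suc r))"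
    using hs by (subst has_bochner_integral_cong[OF refl eq refl])
  then show "integrable half_line (\<lambda>u. if cell_index r u < R then f (cell_index r u) else 0)"
    and "(\<integral>u. (if cell_index r u < R then f (cell_index r u) else 0) \<partial>half_line) = (\<Sum>p<R. f p /\<^sub>R real (Suc r))"
    by (auto simp: has_bochner_integral_iff)
qed

text \<open>The cube has volume \<open>1 / real (Suc r) ^ q\<close>, so the scaled integral is the
  mean of \<open>f\<close> over it. Applied once in the input times and once in the output times, it
  controls a matrix entry.\<close>

lemma integral_cell_close:
  fixes f :: "_ \<Rightarrow> real"
  assumes f: "f \<in> borel_measurable (orthant q)"
    and close: "\<And>t. t \<in> cell r q C \<Longrightarrow> \<bar>f t - c\<bar> \<le> \<epsilon>"
  shows "integrable (orthant q) (\<lambda>t. indicator (cell r q C) t * f t)"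
    and "\<bar>real (Suc r) ^ q * (\<integral>t. indicator (cell r q C) t * f t \<partial>orthant q) - c\<bar> \<le> \<epsilon>"
proof -
  let ?I = "indicator (cell r q C) :: _ \<Rightarrow> real" and ?N = "real (Suc r) ^ q"
  have N: "?N > 0" by simp
  have ind: "integrable (orthant q) ?I" by (simp add: emeasure_cell)
  have int: "integrable (orthant q) (\<lambda>t. ?I t * (f t - c))"
  proof (rule Bochner_Integration.integrable_bound)
    show "integrable (orthant q) (\<lambda>t. \<epsilon> * ?I t)" using ind by simp
    show "AE t in orthant q. norm (?I t * (f t - c)) \<le> norm (\<epsilon> * ?I t)"
      using close by (intro AE_I2) (auto split: split_indicator intro: order_trans[OF _ abs_ge_self])
  qed (use f in measurable)
  have "integrable (orthant q) (\<lambda>t. ?I t * (f t - c) + c * ?I t)"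
    by (intro Bochner_Integration.integrable_add int integrable_mult_right ind)
  then show *: "integrable (orthant q) (\<lambda>t. ?I t * f t)" by (simp add: algebra_simps)
  have "(\<integral>t. ?I t * f t \<partial>orthant q) = (\<integral>t. ?I t * (f t - c) + c * ?I t \<partial>orthant q)"
    by (simp add: algebra_simps)
  also have "\<dots> = (\<integral>t. ?I t * (f t - c) \<partial>orthant q) + c / ?N"
    using int ind by (simp add: measure_cell)
  finally have eq: "?N * (\<integral>t. ?I t * f t \<partial>orthant q) - c = ?N * (\<integral>t. ?I t * (f t - c) \<partial>orthant q)"
    by (simp add: field_simps)
  have "\<bar>\<integral>t. ?I t * (f t - c) \<partial>orthant q\<bar> \<le> (\<integral>t. \<epsilon> * ?I t \<partial>orthant q)"
    using close ind int
    by (intro order_trans[OF integral_abs_bound] integral_mono integrable_abs) (auto split: split_indicator)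
  also have "\<dots> = \<epsilon> / ?N" by (simp add: measure_cell)
  finally show "\<bar>?N * (\<integral>t. ?I t * f t \<partial>orthant q) - c\<bar> \<le> \<epsilon>"
    unfolding eq using N by (simp add: abs_mult field_simps)
qed

section \<open>A Plancherel inequality on the positive orthant\<close>

interpretation lborel_prod: product_sigma_finite "\<lambda>_::nat. lborel :: real measure"
  by (simp add: product_sigma_finite_def lborel.sigma_finite_measure_axioms)

lemma integrable_pair_mult:
  fixes f :: "'a \<Rightarrow> 'c::{real_normed_field, banach, second_countable_topology}"
  assumes N: "sigma_finite_measure N" and f: "integrable M f" and g: "integrable N g"
  shows "integrable (M \<Otimes>\<^sub>M N) (\<lambda>p. f (fst p) * g (snd p))"
proof (rule integrableI_bounded)
  interpret N: sigma_finite_measure N by fact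
  have [measurable]: "f \<in> borel_measurable M" "g \<in> borel_measurable N" using f g by auto
  show "(\<lambda>p. f (fst p) * g (snd p)) \<in> borel_measurable (M \<Otimes>\<^sub>M N)" by measurable
  have "(\<integral>\<^sup>+p. ennreal (norm (f (fst p) * g (snd p))) \<partial>(M \<Otimes>\<^sub>M N))
      = (\<integral>\<^sup>+x. \<integral>\<^sup>+y. ennreal (norm (f x)) * ennreal (norm (g y)) \<partial>N \<partial>M)"
    by (subst N.nn_integral_fst[symmetric]) (auto simp: norm_mult ennreal_mult)
  also have "\<dots> = (\<integral>\<^sup>+x. ennreal (norm (f x)) \<partial>M) * (\<integral>\<^sup>+y. ennreal (norm (g y)) \<partial>N)"
    by (simp add: nn_integral_cmult nn_integral_multc)
  also have "\<dots> < \<infinity>"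
    using f g by (simp add: integrable_iff_bounded ennreal_mult_less_top)
  finally show "(\<integral>\<^sup>+p. ennreal (norm (f (fst p) * g (snd p))) \<partial>(M \<Otimes>\<^sub>M N)) < \<infinity>" .
qed

lemma norm_integral_le_nn_integral:
  fixes f :: "'a \<Rightarrow> 'b::{banach, second_countable_topology}"
  shows "ennreal (norm (integral\<^sup>L M f)) \<le> (\<integral>\<^sup>+x. ennreal (norm (f x)) \<partial>M)"
proof (cases "integrable M f")
  case True
  then show ?thesis by (rule integral_norm_bound_ennreal)
qed (simp add: not_integrable_integral_eq)

text \<open>Rescales the characteristic function of the standard normal distribution. The right-hand
  side is written as a normal density in \<open>\<xi>\<close> so that its total mass 2 pi, the same
  for every \<open>\<eta>\<close>, is visible; this is the constant in Schur's test.\<close>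

lemma gaussian_fourier:
  assumes \<eta>: "0 < \<eta>"
  shows "integrable lborel (\<lambda>y. complex_of_real (exp (- (\<eta> * y)\<^sup>2 / 2)) * iexp (- (y * \<xi>)))" (is ?int)
    and "(\<integral>y. complex_of_real (exp (- (\<eta> * y)\<^sup>2 / 2)) * iexp (- (y * \<xi>)) \<partial>lborel)
      = complex_of_real (2 * pi * normal_density 0 \<eta> \<xi>)" (is ?eq)
proof -
  have norm: "exp (- (\<eta> * y)\<^sup>2 / 2) = sqrt (2 * pi) / \<eta> * normal_density 0 (1 / \<eta>) y" for y
    using \<eta> by (simp add: normal_density_def power_divide real_sqrt_divide real_sqrt_mult field_simps)
  have "integrable lborel (\<lambda>y. exp (- (\<eta> * y)\<^sup>2 / 2))"
    unfolding norm using \<eta> by (intro integrable_mult_right integrable_normal_density) simp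
  then show ?int
    by (rule Bochner_Integration.integrable_bound) (auto simp: norm_mult)
  have "complex_of_real (exp (- (\<xi> / \<eta>)\<^sup>2 / 2)) = char std_normal_distribution (- \<xi> / \<eta>)"
    by (simp add: char_std_normal_distribution)
  also have "\<dots> = (\<integral>x. std_normal_density x *\<^sub>R iexp (- \<xi> / \<eta> * x) \<partial>lborel)"
    unfolding char_def by (subst integral_density) auto
  also have "\<dots> = \<eta> *\<^sub>R (\<integral>y. std_normal_density (\<eta> * y) *\<^sub>R iexp (- \<xi> / \<eta> * (\<eta> * y)) \<partial>lborel)"
    using \<eta> by (subst lborel_integral_real_affine[where c = \<eta> and t = 0]) auto
  also have "\<dots> = (\<eta> / sqrt (2 * pi)) *\<^sub>R (\<integral>y. complex_of_real (exp (- (\<eta> * y)\<^sup>2 / 2)) * iexp (- (y * \<xi>)) \<partial>lborel)"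
    using \<eta> by (simp add: std_normal_density_def scaleR_conv_of_real mult_ac)
  finally have "(\<integral>y. complex_of_real (exp (- (\<eta> * y)\<^sup>2 / 2)) * iexp (- (y * \<xi>)) \<partial>lborel)
     = (sqrt (2 * pi) / \<eta>) *\<^sub>R complex_of_real (exp (- (\<xi> / \<eta>)\<^sup>2 / 2))"
    using \<eta> by (simp add: field_simps)
  also have "\<dots> = complex_of_real (2 * pi * normal_density 0 \<eta> \<xi>)"
  proof -
    have "sqrt (2 * pi) / \<eta> = 2 * pi * (1 / sqrt (2 * pi * \<eta>\<^sup>2))"
      using \<eta> real_sqrt_mult_self[of "2 * pi"] by (simp add: real_sqrt_mult field_simps)
    then show ?thesis by (simp add: normal_density_def scaleR_conv_of_real power_divide)
  qed
  finally show ?eq .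
qed

text \<open>Regularising by a Gaussian and applying Fubini turns \<open>\<integral> |F f|\<^sup>2\<close> into a convolution form
  whose kernel is \<open>(2 \<pi>)\<^sup>q\<close> times a product of normal densities; Schur's test bounds it uniformly.\<close>
lemma plancherel_le:
  fixes f :: "(nat \<Rightarrow> real) \<Rightarrow> complex"
  assumes f: "integrable (orthant q) f"
  shows "(\<integral>\<^sup>+y. ennreal ((cmod (\<integral>t. f t * iexp (- (\<Sum>l<q. y l * t l)) \<partial>orthant q))\<^sup>2) \<partial>PiM {..<q} (\<lambda>_. lborel))
    \<le> ennreal ((2 * pi) ^ q) * (\<integral>\<^sup>+t. ennreal ((cmod (f t))\<^sup>2) \<partial>orthant q)"
proof -
  define Y where "Y = PiM {..<q} (\<lambda>_. lborel :: real measure)"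
  define D where "D = orthant q"
  define P where "P = D \<Otimes>\<^sub>M D"
  define fh where "fh y = (\<integral>t. f t * iexp (- (\<Sum>l<q. y l * t l)) \<partial>D)" for y
  define g where "g \<eta> y = (\<Prod>l<q. exp (- (\<eta> * y l)\<^sup>2 / 2))" for \<eta> :: real and y :: "nat \<Rightarrow> real"
  define K where "K \<eta> p = (\<Prod>l<q. 2 * pi * normal_density 0 \<eta> (fst p l - snd p l))"
    for \<eta> :: real and p :: "(nat \<Rightarrow> real) \<times> (nat \<Rightarrow> real)"
  interpret Y: sigma_finite_measure Y unfolding Y_def by (rule lborel_prod.sigma_finite) simp
  interpret D: sigma_finite_measure D unfolding D_def by (rule sigma_finite_orthant)
  interpret DD: pair_sigma_finite D D ..
  interpret P: sigma_finite_measure P unfolding P_def by unfold_locales (rule DD.sigma_finite_countable)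
  interpret YP: pair_sigma_finite Y P ..
  have Yc [measurable]: "(\<lambda>y. y l) \<in> borel_measurable Y" if "l < q" for l
    using that measurable_component_singleton[of l "{..<q}" "\<lambda>_. lborel :: real measure"] by (simp add: Y_def)
  have Dc [measurable]: "(\<lambda>y. y l) \<in> borel_measurable D" if "l < q" for l
    using borel_measurable_orthant_component[OF that] by (simp add: D_def)
  have fD: "integrable D f" using f by (simp add: D_def)
  then have [measurable]: "f \<in> borel_measurable D" by auto
  have gint: "integrable Y (g \<eta>)" if \<eta>: "0 < \<eta>" for \<eta>
    unfolding g_def Y_def
  proof (rule lborel_prod.product_integrable_prod)
    show "integrable lborel (\<lambda>x. exp (- (\<eta> * x)\<^sup>2 / 2))"
      using gaussian_fourier(1)[OF \<eta>, of 0] by (rule Bochner_Integration.integrable_bound) (auto simp: norm_mult)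
  qed simp
  have gm [measurable]: "g \<eta> \<in> borel_measurable Y" for \<eta>
    unfolding g_def by measurable
  have fhm [measurable]: "fh \<in> borel_measurable Y"
    unfolding fh_def by (rule D.borel_measurable_lebesgue_integral) measurable
  let ?F = "\<lambda>p. f (fst p) * cnj (f (snd p))"
  let ?e = "\<lambda>y p. iexp (- (\<Sum>l<q. y l * (fst p l - snd p l)))"
  have Fint: "integrable P ?F"
    unfolding P_def
    by (rule integrable_pair_mult[OF D.sigma_finite_measure_axioms fD]) (use fD in simp)
  have main: "(\<integral>\<^sup>+y. ennreal ((cmod (fh y))\<^sup>2 * g \<eta> y) \<partial>Y) \<le> ennreal ((2 * pi) ^ q) * (\<integral>\<^sup>+t. ennreal ((cmod (f t))\<^sup>2) \<partial>D)"
    if \<eta>: "0 < \<eta>" for \<eta>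
  proof -
    \<comment> \<open>The squared modulus is a double integral over pairs p = (t, s) whose phase
      depends on t - s alone. The Gaussian in y makes the triple integral absolutely convergent,
      which a bare exchange of integrals would not be.\<close>
    have sq: "complex_of_real ((cmod (fh y))\<^sup>2) = (\<integral>p. ?F p * ?e y p \<partial>P)" for y
    proof -
      let ?h = "\<lambda>t. f t * iexp (- (\<Sum>l<q. y l * t l))"
      have "complex_of_real ((cmod (fh y))\<^sup>2) = fh y * cnj (fh y)"
        by (rule complex_norm_square)
      also have "\<dots> = (\<integral>t. ?h t * cnj (fh y) \<partial>D)" unfolding fh_def by (rule integral_mult_left_zero[symmetric])
      also have "\<dots> = (\<integral>t. (\<integral>s. ?h t * cnj (?h s) \<partial>D) \<partial>D)"
        by (simp add: fh_def flip: Bochner_Integration.integral_cnj)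
      also have "\<dots> = (\<integral>t. (\<integral>s. ?F (t, s) * ?e y (t, s) \<partial>D) \<partial>D)"
        by (intro Bochner_Integration.integral_cong refl)
           (simp add: exp_cnj exp_add[symmetric] algebra_simps sum_subtractf)
      also have "\<dots> = (\<integral>p. ?F p * ?e y p \<partial>P)"
        unfolding P_def
      proof (rule DD.integral_fst')
        show "integrable (D \<Otimes>\<^sub>M D) (\<lambda>p. ?F p * ?e y p)"
          using Fint unfolding P_def
        proof (rule Bochner_Integration.integrable_bound)
          have "?F \<in> borel_measurable (D \<Otimes>\<^sub>M D)" using Fint by (auto simp: P_def)
          then show "(\<lambda>p. ?F p * ?e y p) \<in> borel_measurable (D \<Otimes>\<^sub>M D)" by measurable
        qed (simp add: norm_mult)
      qed
      finally show ?thesis .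
    qed
    have Kint: "(\<integral>y. g \<eta> y * ?e y p \<partial>Y) = complex_of_real (K \<eta> p)" for p
    proof -
      have e: "?e y p = (\<Prod>l<q. iexp (- (y l * (fst p l - snd p l))))" for y
        by (simp add: sum_distrib_left flip: exp_sum sum_negf)
      have "(\<integral>y. g \<eta> y * ?e y p \<partial>Y)
          = (\<integral>y. (\<Prod>l<q. complex_of_real (exp (- (\<eta> * y l)\<^sup>2 / 2)) * iexp (- (y l * (fst p l - snd p l)))) \<partial>Y)"
        by (simp only: e g_def prod.distrib of_real_prod)
      also have "\<dots> = complex_of_real (K \<eta> p)"
        unfolding Y_def K_def of_real_prod
        by (subst lborel_prod.product_integral_prod) (auto simp only: gaussian_fourier[OF \<eta>] finite_lessThan)
      finally show ?thesis .
    qed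
    have Fm [measurable]: "?F \<in> borel_measurable P" using Fint by auto
    have em [measurable]: "(\<lambda>x. ?e (fst x) (snd x)) \<in> borel_measurable (Y \<Otimes>\<^sub>M P)"
      unfolding P_def by measurable
    have Hint: "integrable (Y \<Otimes>\<^sub>M P) (\<lambda>(y, p). ?F p * ?e y p * complex_of_real (g \<eta> y))"
    proof -
      have "integrable (Y \<Otimes>\<^sub>M P) (\<lambda>x. complex_of_real (g \<eta> (fst x)) * ?F (snd x))"
        by (rule integrable_pair_mult[OF P.sigma_finite_measure_axioms _ Fint]) (use gint[OF \<eta>] in simp)
      then show ?thesis
      proof (rule Bochner_Integration.integrable_bound)
        show "(\<lambda>(y, p). ?F p * ?e y p * complex_of_real (g \<eta> y)) \<in> borel_measurable (Y \<Otimes>\<^sub>M P)"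
          unfolding case_prod_unfold using em measurable_compose[OF measurable_snd Fm]
            measurable_compose[OF measurable_fst gm] by simp
      qed (auto simp: norm_mult)
    qed
    let ?J = "\<integral>y. (cmod (fh y))\<^sup>2 * g \<eta> y \<partial>Y"
    have gnn: "0 \<le> g \<eta> y" for y by (simp add: g_def prod_nonneg)
    have Hi: "integrable Y (\<lambda>y. complex_of_real ((cmod (fh y))\<^sup>2 * g \<eta> y))"
      using YP.integrable_fst[OF Hint] by (simp only: sq[symmetric] integral_mult_left_zero of_real_mult)
    have "complex_of_real ?J = (\<integral>y. (\<integral>p. ?F p * ?e y p * complex_of_real (g \<eta> y) \<partial>P) \<partial>Y)"
      by (simp only: sq[symmetric] integral_mult_left_zero integral_complex_of_real[symmetric] of_real_mult)
    also have "\<dots> = (\<integral>p. (\<integral>y. ?F p * ?e y p * complex_of_real (g \<eta> y) \<partial>Y) \<partial>P)"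
      using YP.Fubini_integral[OF Hint] by (rule sym)
    also have "\<dots> = (\<integral>p. ?F p * complex_of_real (K \<eta> p) \<partial>P)"
      by (simp only: Kint[symmetric] integral_mult_right_zero[symmetric] mult_ac)
    finally have J: "complex_of_real ?J = (\<integral>p. ?F p * complex_of_real (K \<eta> p) \<partial>P)" .
    have Km [measurable]: "K \<eta> \<in> borel_measurable (D \<Otimes>\<^sub>M D)"
      unfolding K_def by measurable
    have Knn: "0 \<le> K \<eta> p" for p by (simp add: K_def prod_nonneg)
    have Kswap: "K \<eta> (s, t) = K \<eta> (t, s)" for s t
      by (auto simp: K_def normal_density_def power2_commute)
    \<comment> \<open>Each factor is 2 pi times a probability density in \<open>s l\<close>, and
      restricting it to the half line only loses mass.\<close>
    have Kbound: "(\<integral>\<^sup>+s. ennreal (K \<eta> (t, s)) \<partial>D) \<le> ennreal ((2 * pi) ^ q)" for t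
    proof -
      have "(\<integral>\<^sup>+s. ennreal (K \<eta> (t, s)) \<partial>D) = (\<integral>\<^sup>+s. (\<Prod>l<q. ennreal (2 * pi * normal_density (t l) \<eta> (s l))) \<partial>D)"
        by (simp add: K_def prod_ennreal normal_density_def power2_commute)
      also have "\<dots> = (\<Prod>l<q. \<integral>\<^sup>+u. ennreal (2 * pi * normal_density (t l) \<eta> u) \<partial>half_line)"
        unfolding D_def orthant_def by (rule half_line.product_nn_integral_prod) auto
      also have "\<dots> \<le> (\<Prod>l<q. ennreal (2 * pi))"
      proof -
        have "(\<integral>\<^sup>+u. ennreal (2 * pi * normal_density (t l) \<eta> u) \<partial>half_line) \<le> ennreal (2 * pi)" for l
        proof -
          have "(\<integral>\<^sup>+u. ennreal (2 * pi * normal_density (t l) \<eta> u) \<partial>half_line)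
             \<le> (\<integral>\<^sup>+u. ennreal (2 * pi * normal_density (t l) \<eta> u) \<partial>lborel)"
            by (subst nn_integral_restrict_space) (auto intro!: nn_integral_mono split: split_indicator)
          also have "\<dots> = ennreal (2 * pi)"
            using \<eta> by (subst nn_integral_eq_integral) auto
          finally show ?thesis .
        qed
        then show ?thesis by (induction q) (auto simp del: prod_constant intro!: mult_mono)
      qed
      finally show ?thesis by (simp add: ennreal_power)
    qed
    \<comment> \<open>The halves come from 2 |f(t)| |f(s)| <= |f(t)|^2 + |f(s)|^2. By symmetry of
      \<open>K\<close> both squares lead to the same iterated integral \<open>?I\<close>.\<close>
    let ?a = "\<lambda>t. ennreal ((cmod (f t))\<^sup>2 / 2)" and ?c = "ennreal ((2 * pi) ^ q)"
    let ?I = "\<integral>\<^sup>+t. \<integral>\<^sup>+s. ?a t * ennreal (K \<eta> (t, s)) \<partial>D \<partial>D"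
    have half: "?I
       \<le> ?c * (\<integral>\<^sup>+t. ?a t \<partial>D)"
    proof -
      have "?I
         = (\<integral>\<^sup>+t. ?a t * (\<integral>\<^sup>+s. ennreal (K \<eta> (t, s)) \<partial>D) \<partial>D)"
        by (intro nn_integral_cong nn_integral_cmult) measurable
      also have "\<dots> \<le> (\<integral>\<^sup>+t. ?a t * ?c \<partial>D)"
        by (intro nn_integral_mono mult_left_mono Kbound) simp
      also have "\<dots> = ?c * (\<integral>\<^sup>+t. ?a t \<partial>D)"
        by (subst nn_integral_multc) (auto simp: mult.commute)
      finally show ?thesis .
    qed
    have "(\<integral>\<^sup>+y. ennreal ((cmod (fh y))\<^sup>2 * g \<eta> y) \<partial>Y) = ennreal ?J"
    proof (rule nn_integral_eq_integral)
      show "integrable Y (\<lambda>y. (cmod (fh y))\<^sup>2 * g \<eta> y)"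
        by (rule Bochner_Integration.integrable_bound[OF Hi]) (measurable, simp only: norm_of_real real_norm_def order_refl, simp)
    qed (simp add: gnn)
    also have "\<dots> \<le> ennreal (cmod (complex_of_real ?J))" by (simp add: ennreal_leI)
    also have "\<dots> = ennreal (cmod (\<integral>p. ?F p * complex_of_real (K \<eta> p) \<partial>P))" by (simp only: J)
    also have "\<dots> \<le> (\<integral>\<^sup>+p. ennreal (cmod (?F p * complex_of_real (K \<eta> p))) \<partial>P)"
      by (rule norm_integral_le_nn_integral)
    also have "\<dots> \<le> (\<integral>\<^sup>+p. ?a (fst p) * ennreal (K \<eta> p)
        + ?a (snd p) * ennreal (K \<eta> p) \<partial>P)"
    proof (rule nn_integral_mono)
      fix p
      have "cmod (f (fst p)) * cmod (f (snd p)) \<le> (cmod (f (fst p)))\<^sup>2 / 2 + (cmod (f (snd p)))\<^sup>2 / 2"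
        using sum_squares_bound[of "cmod (f (fst p))" "cmod (f (snd p))"] by simp
      then have "cmod (f (fst p)) * cmod (f (snd p)) * K \<eta> p
          \<le> ((cmod (f (fst p)))\<^sup>2 / 2 + (cmod (f (snd p)))\<^sup>2 / 2) * K \<eta> p"
        by (rule mult_right_mono) (rule Knn)
      then show "ennreal (cmod (?F p * complex_of_real (K \<eta> p))) \<le> ?a (fst p) * ennreal (K \<eta> p)
        + ?a (snd p) * ennreal (K \<eta> p)"
        using Knn[of p] by (simp add: norm_mult distrib_right flip: ennreal_mult ennreal_plus)
    qed
    also have "\<dots> = (\<integral>\<^sup>+p. ?a (fst p) * ennreal (K \<eta> p) \<partial>P)
        + (\<integral>\<^sup>+p. ?a (snd p) * ennreal (K \<eta> p) \<partial>P)"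
      unfolding P_def by (rule nn_integral_add) measurable
    also have "(\<integral>\<^sup>+p. ?a (fst p) * ennreal (K \<eta> p) \<partial>P)
       = ?I"
      unfolding P_def by (subst D.nn_integral_fst[symmetric]) auto
    also have "(\<integral>\<^sup>+p. ?a (snd p) * ennreal (K \<eta> p) \<partial>P)
       = ?I"
      unfolding P_def by (subst DD.nn_integral_snd[symmetric]) (auto simp: Kswap)
    also have "?I
       + ?I
       \<le> ?c * (\<integral>\<^sup>+t. ?a t \<partial>D)
        + ?c * (\<integral>\<^sup>+t. ?a t \<partial>D)"
      by (intro add_mono half)
    also have "\<dots> = ?c * (\<integral>\<^sup>+t. ?a t + ?a t \<partial>D)"
      by (subst nn_integral_add) (auto simp: distrib_left)
    also have "\<dots> = ?c * (\<integral>\<^sup>+t. ennreal ((cmod (f t))\<^sup>2) \<partial>D)"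
      by (simp flip: ennreal_plus)
    finally show ?thesis .
  qed
  \<comment> \<open>As the parameter tends to 0 the Gaussian tends to 1 pointwise, and Fatou's lemma
    removes the regularisation because the bound does not involve it.\<close>
  define e where "e n = 1 / real (Suc n)" for n
  have e: "e n > 0" for n by (simp add: e_def)
  have lim: "(\<lambda>n. ennreal ((cmod (fh y))\<^sup>2 * g (e n) y)) \<longlonglongrightarrow> ennreal ((cmod (fh y))\<^sup>2)" for y
  proof -
    have "e \<longlonglongrightarrow> 0" unfolding e_def by (rule LIMSEQ_inverse_real_of_nat[unfolded inverse_eq_divide])
    then have "(\<lambda>n. (cmod (fh y))\<^sup>2 * g (e n) y) \<longlonglongrightarrow> (cmod (fh y))\<^sup>2 * (\<Prod>l<q. exp (- (0 * y l)\<^sup>2 / 2))"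
      unfolding g_def by (intro tendsto_intros) auto
    then show ?thesis by (intro tendsto_ennrealI) simp
  qed
  have "(\<integral>\<^sup>+y. ennreal ((cmod (fh y))\<^sup>2) \<partial>Y) = (\<integral>\<^sup>+y. liminf (\<lambda>n. ennreal ((cmod (fh y))\<^sup>2 * g (e n) y)) \<partial>Y)"
    using lim_imp_Liminf[OF _ lim] by simp
  also have "\<dots> \<le> liminf (\<lambda>n. \<integral>\<^sup>+y. ennreal ((cmod (fh y))\<^sup>2 * g (e n) y) \<partial>Y)"
    by (rule nn_integral_liminf) simp
  also have "\<dots> \<le> ennreal ((2 * pi) ^ q) * (\<integral>\<^sup>+t. ennreal ((cmod (f t))\<^sup>2) \<partial>D)"
    by (rule Liminf_le) (simp, intro always_eventually allI main e)
  finally show ?thesis by (simp add: Y_def D_def fh_def)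
qed

section \<open>Volterra kernels of a stable bilinear system\<close>

definition volterra :: "(real \<Rightarrow> 'a \<Rightarrow> 'a) \<Rightarrow> (nat \<Rightarrow> 'a \<Rightarrow> 'a) \<Rightarrow> (nat \<Rightarrow> 'a) \<Rightarrow> (nat \<Rightarrow> 'a \<Rightarrow> real) \<Rightarrow>
    nat \<Rightarrow> nat list \<Rightarrow> nat \<Rightarrow> (nat \<Rightarrow> real) \<Rightarrow> real" where
  "volterra T N psi C j ns i t = C j (oprod T N ns t 0 (psi i))"

text \<open>The times of the kernel \<open>h\<^bsub>k,l\<^esub>(t, s) = h\<^bsub>k+l,0\<^esub>(t\<^sub>0, \<dots>, t\<^bsub>k-1\<^esub>, t\<^sub>k + s\<^sub>l, s\<^bsub>l-1\<^esub>, \<dots>, s\<^sub>0)\<close> of the Hankel operator.\<close>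
definition hankel_times :: "nat \<Rightarrow> nat \<Rightarrow> (nat \<Rightarrow> real) \<Rightarrow> (nat \<Rightarrow> real) \<Rightarrow> nat \<Rightarrow> real" where
  "hankel_times k L t s l = (if l < k then t l else if l = k then t k + s L else s (k + L - l))"

text \<open>The conditions range over all sequences whose first \<open>q\<close> entries are
  positive, not only over extensional ones, so that \<open>h\<close> may be evaluated directly at
  \<open>hankel_times\<close> and \<open>insert_coord\<close>. Continuity is measured in the first
  \<open>q\<close> entries only. Measurability is stated on the product space and transferred by
  \<open>measurable_decaying_kernel\<close>.\<close>

definition decaying_kernel :: "nat \<Rightarrow> ((nat \<Rightarrow> real) \<Rightarrow> real) \<Rightarrow> bool" where
  "decaying_kernel q h \<longleftrightarrow>
     (\<exists>D \<nu>. 0 < \<nu> \<and> (\<forall>t. (\<forall>l<q. 0 < t l) \<longrightarrow> \<bar>h t\<bar> \<le> D * exp (- \<nu> * (\<Sum>l<q. t l)))) \<and>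
     (\<forall>t \<epsilon>. (\<forall>l<q. 0 < t l) \<longrightarrow> 0 < \<epsilon> \<longrightarrow>
        (\<exists>\<delta>>0. \<forall>t'. (\<forall>l<q. 0 < t' l \<and> \<bar>t' l - t l\<bar> < \<delta>) \<longrightarrow> \<bar>h t' - h t\<bar> < \<epsilon>)) \<and>
     h \<in> borel_measurable (orthant q)"

lemma decaying_kernelE:
  assumes "decaying_kernel q h"
  obtains D \<nu> where "0 \<le> D" "0 < \<nu>"
    "\<And>t. (\<And>l. l < q \<Longrightarrow> 0 < t l) \<Longrightarrow> \<bar>h t\<bar> \<le> D * exp (- \<nu> * (\<Sum>l<q. t l))"
proof -
  obtain D \<nu> where *: "0 < \<nu>" "\<And>t. (\<And>l. l < q \<Longrightarrow> 0 < t l) \<Longrightarrow> \<bar>h t\<bar> \<le> D * exp (- \<nu> * (\<Sum>l<q. t l))"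
    using assms by (auto simp: decaying_kernel_def)
  have "0 \<le> D * exp (- \<nu> * (\<Sum>l<q. (1::real)))" using *(2)[of "\<lambda>_. 1"] by simp
  then have "0 \<le> D" by (simp add: zero_le_mult_iff)
  with that * show thesis by blast
qed

lemma decaying_kernel_continuous:
  assumes "decaying_kernel q h" "\<And>l. l < q \<Longrightarrow> 0 < t l" "0 < \<epsilon>"
  obtains \<delta> where "0 < \<delta>"
    "\<And>t'. (\<And>l. l < q \<Longrightarrow> 0 < t' l) \<Longrightarrow> (\<And>l. l < q \<Longrightarrow> \<bar>t' l - t l\<bar> < \<delta>) \<Longrightarrow> \<bar>h t' - h t\<bar> < \<epsilon>"
  using assms unfolding decaying_kernel_def by metis

text \<open>Continuity at \<open>t\<close> with distance 0 in the first \<open>q\<close> entries: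
  the remaining entries cannot influence the value.\<close>

lemma decaying_kernel_cong:
  assumes "decaying_kernel q h" "\<And>l. l < q \<Longrightarrow> 0 < t l" "\<And>l. l < q \<Longrightarrow> t' l = t l"
  shows "h t' = h t"
proof (rule ccontr)
  assume "h t' \<noteq> h t"
  then have "0 < \<bar>h t' - h t\<bar>" by simp
  with assms obtain \<delta> where "0 < \<delta>"
    "\<And>t''. (\<And>l. l < q \<Longrightarrow> 0 < t'' l) \<Longrightarrow> (\<And>l. l < q \<Longrightarrow> \<bar>t'' l - t l\<bar> < \<delta>) \<Longrightarrow> \<bar>h t'' - h t\<bar> < \<bar>h t' - h t\<bar>"
    using decaying_kernel_continuous by blast
  from this(2)[of t'] show False using \<open>0 < \<delta>\<close> assms(2,3) by simp
qed

lemma measurable_decaying_kernel: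
  assumes h: "decaying_kernel q h"
    and m: "\<And>l. l < q \<Longrightarrow> (\<lambda>w. \<tau> w l) \<in> borel_measurable S"
    and p: "\<And>w l. w \<in> space S \<Longrightarrow> l < q \<Longrightarrow> 0 < \<tau> w l"
  shows "(\<lambda>w. h (\<tau> w)) \<in> borel_measurable S"
proof -
  have "(\<lambda>w. restrict (\<tau> w) {..<q}) \<in> measurable S (orthant q)"
    unfolding orthant_def
    by (rule measurable_restrict) (use m p in \<open>auto intro!: measurable_restrict_space2\<close>)
  then have "(\<lambda>w. h (restrict (\<tau> w) {..<q})) \<in> borel_measurable S"
    by (rule measurable_compose) (use h in \<open>simp add: decaying_kernel_def\<close>)
  then show ?thesis
    by (rule measurable_cong[THEN iffD1, rotated]) (rule decaying_kernel_cong[OF h], use p in auto)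
qed

lemma decaying_kernel_diff:
  assumes "decaying_kernel q g" "decaying_kernel q h"
  shows "decaying_kernel q (\<lambda>t. g t - h t)"
  unfolding decaying_kernel_def
proof (intro conjI allI impI)
  obtain D \<nu> where g: "0 \<le> D" "0 < \<nu>"
    "\<And>t. (\<And>l. l < q \<Longrightarrow> 0 < t l) \<Longrightarrow> \<bar>g t\<bar> \<le> D * exp (- \<nu> * (\<Sum>l<q. t l))"
    using decaying_kernelE[OF assms(1)] by blast
  obtain D' \<nu>' where h: "0 \<le> D'" "0 < \<nu>'"
    "\<And>t. (\<And>l. l < q \<Longrightarrow> 0 < t l) \<Longrightarrow> \<bar>h t\<bar> \<le> D' * exp (- \<nu>' * (\<Sum>l<q. t l))"
    using decaying_kernelE[OF assms(2)] by blast
  show "\<exists>D \<nu>. 0 < \<nu> \<and> (\<forall>t. (\<forall>l<q. 0 < t l) \<longrightarrow> \<bar>g t - h t\<bar> \<le> D * exp (- \<nu> * (\<Sum>l<q. t l)))"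
  proof (rule exI[of _ "D + D'"], rule exI[of _ "min \<nu> \<nu>'"], intro conjI allI impI)
    fix t :: "nat \<Rightarrow> real" assume t: "\<forall>l<q. 0 < t l"
    then have s: "0 \<le> (\<Sum>l<q. t l)" by (intro sum_nonneg) (simp add: less_imp_le)
    have "\<bar>g t - h t\<bar> \<le> D * exp (- \<nu> * (\<Sum>l<q. t l)) + D' * exp (- \<nu>' * (\<Sum>l<q. t l))"
      using g(3)[of t] h(3)[of t] t by (intro order_trans[OF abs_triangle_ineq4] add_mono) auto
    \<comment> \<open>The two kernels decay with their own rates; the smaller rate serves both, as
      the sum of the times is nonnegative.\<close>
    also have "\<dots> \<le> D * exp (- min \<nu> \<nu>' * (\<Sum>l<q. t l)) + D' * exp (- min \<nu> \<nu>' * (\<Sum>l<q. t l))"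
    proof -
      have "min \<nu> \<nu>' * (\<Sum>l<q. t l) \<le> \<nu> * (\<Sum>l<q. t l)" "min \<nu> \<nu>' * (\<Sum>l<q. t l) \<le> \<nu>' * (\<Sum>l<q. t l)"
        using s by (auto intro: mult_right_mono)
      then show ?thesis using g h by (intro add_mono mult_left_mono) auto
    qed
    finally show "\<bar>g t - h t\<bar> \<le> (D + D') * exp (- min \<nu> \<nu>' * (\<Sum>l<q. t l))"
      by (simp add: distrib_right)
  qed (use g h in simp)
  fix t :: "nat \<Rightarrow> real" and \<epsilon> :: real assume t: "\<forall>l<q. 0 < t l" and \<epsilon>: "0 < \<epsilon>"
  obtain \<delta> where 1: "0 < \<delta>"
    "\<And>t'. (\<And>l. l < q \<Longrightarrow> 0 < t' l) \<Longrightarrow> (\<And>l. l < q \<Longrightarrow> \<bar>t' l - t l\<bar> < \<delta>) \<Longrightarrow> \<bar>g t' - g t\<bar> < \<epsilon> / 2"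
    using decaying_kernel_continuous[OF assms(1), of t "\<epsilon> / 2"] t \<epsilon> by auto
  obtain \<delta>' where 2: "0 < \<delta>'"
    "\<And>t'. (\<And>l. l < q \<Longrightarrow> 0 < t' l) \<Longrightarrow> (\<And>l. l < q \<Longrightarrow> \<bar>t' l - t l\<bar> < \<delta>') \<Longrightarrow> \<bar>h t' - h t\<bar> < \<epsilon> / 2"
    using decaying_kernel_continuous[OF assms(2), of t "\<epsilon> / 2"] t \<epsilon> by auto
  show "\<exists>\<delta>>0. \<forall>t'. (\<forall>l<q. 0 < t' l \<and> \<bar>t' l - t l\<bar> < \<delta>) \<longrightarrow> \<bar>g t' - h t' - (g t - h t)\<bar> < \<epsilon>"
  proof (intro exI[of _ "min \<delta> \<delta>'"] conjI allI impI)
    fix t' assume "\<forall>l<q. 0 < t' l \<and> \<bar>t' l - t l\<bar> < min \<delta> \<delta>'"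
    then have "\<bar>g t' - g t\<bar> < \<epsilon> / 2" "\<bar>h t' - h t\<bar> < \<epsilon> / 2" using 1(2)[of t'] 2(2)[of t'] by auto
    then show "\<bar>g t' - h t' - (g t - h t)\<bar> < \<epsilon>" by linarith
  qed (use 1 2 in simp)
qed (use assms in \<open>auto simp: decaying_kernel_def intro: borel_measurable_diff\<close>)

text \<open>The families \<open>T\<close> and \<open>T'\<close> are compared only at the times that
  occur. This allows the semigroup to be exchanged for its even extension.\<close>

lemma oprod_cong:
  assumes "\<And>l. l \<le> length ns \<Longrightarrow> t (i + l) = t' (i' + l)"
    and "\<And>l. l \<le> length ns \<Longrightarrow> T (t' (i' + l)) = T' (t' (i' + l))"
  shows "oprod T N ns t i x = oprod T' N ns t' i' x"
  using assms
proof (induction ns arbitrary: i i')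
  case (Cons a ns)
  have "oprod T N ns t (Suc i) x = oprod T' N ns t' (Suc i') x"
  proof (rule Cons.IH)
    fix l assume "l \<le> length ns"
    then show "t (Suc i + l) = t' (Suc i' + l)" "T (t' (Suc i' + l)) = T' (t' (Suc i' + l))"
      using Cons.prems(1)[of "Suc l"] Cons.prems(2)[of "Suc l"] by simp_all
  qed
  then show ?case using Cons.prems(1)[of 0] Cons.prems(2)[of 0] by simp
qed (use assms in simp)

section \<open>Decay and continuity of products of the semigroup with the operators
  \<open>N i\<close>\<close>

locale stable_system =
  fixes n m :: nat
    and T :: "real \<Rightarrow> 'a::{real_inner,banach,second_countable_topology} \<Rightarrow> 'a"
    and N :: "nat \<Rightarrow> 'a \<Rightarrow> 'a" and psi :: "nat \<Rightarrow> 'a" and C :: "nat \<Rightarrow> 'a \<Rightarrow> real" and M \<nu> :: real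
  assumes stable: "stable_bilinear_system n m T N psi C M \<nu>"
begin

lemma bounded_linear_T: "0 \<le> t \<Longrightarrow> bounded_linear (T t)"
  and T_add: "0 \<le> s \<Longrightarrow> 0 \<le> t \<Longrightarrow> T (s + t) x = T s (T t x)"
  and continuous_T: "continuous_on {0..} (\<lambda>t. T t x)"
  and M_pos: "0 < M" and \<nu>_pos: "0 < \<nu>"
  and onorm_T: "0 \<le> t \<Longrightarrow> onorm (T t) \<le> M * exp (- \<nu> * t)"
  and bounded_linear_N: "i < n \<Longrightarrow> bounded_linear (N i)"
  and bounded_linear_C: "j < m \<Longrightarrow> bounded_linear (C j)"
  using stable by (auto simp: stable_bilinear_system_def)

lemma norm_T:
  assumes "0 \<le> t"
  shows "norm (T t x) \<le> M * exp (- \<nu> * t) * norm x"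
  using onorm[OF bounded_linear_T[OF assms], of x] onorm_T[OF assms]
  by (meson mult_right_mono norm_ge_zero order_trans)

text \<open>\<open>T\<close> is constrained for nonnegative times only. The even extension
  \<open>T \<bar>t\<bar>\<close> is uniformly bounded and strongly continuous on the whole line, so
  limits and measurability can be treated without sign conditions.\<close>

lemma norm_T_abs: "norm (T \<bar>t\<bar> x) \<le> M * norm x"
proof -
  have "norm (T \<bar>t\<bar> x) \<le> M * exp (- \<nu> * \<bar>t\<bar>) * norm x" by (rule norm_T) simp
  also have "\<dots> \<le> M * 1 * norm x"
    using M_pos \<nu>_pos by (intro mult_right_mono mult_left_mono) auto
  finally show ?thesis by simp
qed

text \<open>Joint continuity from strong continuity and the uniform bound: split T(f) g into T(f) (g
  - x) and T(f) x.\<close>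

lemma tendsto_T_abs:
  assumes f: "(f \<longlongrightarrow> a) F" and g: "(g \<longlongrightarrow> x) F"
  shows "((\<lambda>w. T \<bar>f w\<bar> (g w)) \<longlongrightarrow> T \<bar>a\<bar> x) F"
proof -
  have "((\<lambda>w. T \<bar>f w\<bar> (g w - x)) \<longlongrightarrow> 0) F"
  proof (rule Lim_null_comparison)
    show "\<forall>\<^sub>F w in F. norm (T \<bar>f w\<bar> (g w - x)) \<le> M * norm (g w - x)"
      by (simp add: norm_T_abs)
    have "((\<lambda>w. M * norm (g w - x)) \<longlongrightarrow> M * norm (x - x)) F"
      by (intro tendsto_intros g)
    then show "((\<lambda>w. M * norm (g w - x)) \<longlongrightarrow> 0) F" by simp
  qed
  moreover have "((\<lambda>w. T \<bar>f w\<bar> x) \<longlongrightarrow> T \<bar>a\<bar> x) F"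
  proof -
    have "continuous_on UNIV (\<lambda>s. T \<bar>s\<bar> x)"
      by (rule continuous_on_compose2[OF continuous_T]) (auto intro: continuous_intros)
    then have "isCont (\<lambda>s. T \<bar>s\<bar> x) a" by (simp add: continuous_on_eq_continuous_at)
    then show ?thesis using f by (rule isCont_tendsto_compose)
  qed
  ultimately have "((\<lambda>w. T \<bar>f w\<bar> (g w - x) + T \<bar>f w\<bar> x) \<longlongrightarrow> 0 + T \<bar>a\<bar> x) F"
    by (rule tendsto_add)
  moreover have "T \<bar>f w\<bar> (g w - x) + T \<bar>f w\<bar> x = T \<bar>f w\<bar> (g w)" for w
    using bounded_linear_T[of "\<bar>f w\<bar>"] by (simp add: linear_diff bounded_linear.linear)
  ultimately show ?thesis by simp
qed

lemma continuous_T_abs: "continuous_on UNIV (\<lambda>p. T \<bar>fst p\<bar> (snd p))"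
  unfolding continuous_on_def by (intro ballI tendsto_T_abs tendsto_fst tendsto_snd tendsto_ident_at)

lemma bounded_linear_oprod:
  assumes "set ns \<subseteq> {..<n}" "\<And>l. i \<le> l \<Longrightarrow> l \<le> i + length ns \<Longrightarrow> 0 \<le> t l"
  shows "bounded_linear (oprod T N ns t i)"
  using assms
proof (induction ns arbitrary: i)
  case Nil
  then show ?case using bounded_linear_T[of "t i"] by (simp add: fun_eq_iff[symmetric])
next
  case (Cons a ns)
  have "bounded_linear (oprod T N ns t (Suc i))" using Cons by simp
  from bounded_linear_compose[OF bounded_linear_T[of "t i"] bounded_linear_compose[OF bounded_linear_N[of a] this]]
  show ?case using Cons.prems by simp
qed

text \<open>Every semigroup factor contributes exp(-nu t), and the norms of the \<open>N i\<close>
  go into \<open>D\<close>. The constant is chosen before the times, the starting position and the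
  vector.\<close>

lemma norm_oprod:
  assumes "set ns \<subseteq> {..<n}"
  shows "\<exists>D\<ge>0. \<forall>t i x. (\<forall>l. i \<le> l \<longrightarrow> l \<le> i + length ns \<longrightarrow> 0 \<le> t l) \<longrightarrow>
    norm (oprod T N ns t i x) \<le> D * exp (- \<nu> * (\<Sum>l=i..i + length ns. t l)) * norm x"
  using assms
proof (induction ns)
  case Nil
  then show ?case using norm_T M_pos by (intro exI[of _ M]) auto
next
  case (Cons a ns)
  then obtain D where D: "D \<ge> 0" and bd: "\<And>t i x. (\<forall>l. i \<le> l \<longrightarrow> l \<le> i + length ns \<longrightarrow> 0 \<le> t l) \<Longrightarrow>
    norm (oprod T N ns t i x) \<le> D * exp (- \<nu> * (\<Sum>l=i..i + length ns. t l)) * norm x" by auto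
  obtain E where E: "E \<ge> 0" "\<And>x. norm (N a x) \<le> norm x * E"
    using bounded_linear_N[of a] Cons.prems bounded_linear.nonneg_bounded by fastforce
  show ?case
  proof (intro exI[of _ "M * E * D"] conjI allI impI)
    fix t :: "nat \<Rightarrow> real" and i x assume t: "\<forall>l. i \<le> l \<longrightarrow> l \<le> i + length (a # ns) \<longrightarrow> 0 \<le> t l"
    let ?e = "exp (- \<nu> * (\<Sum>l=Suc i..Suc i + length ns. t l))"
    have "norm (oprod T N (a # ns) t i x) \<le> M * exp (- \<nu> * t i) * norm (N a (oprod T N ns t (Suc i) x))"
      using norm_T[of "t i" "N a (oprod T N ns t (Suc i) x)"] t by simp
    also have "\<dots> \<le> M * exp (- \<nu> * t i) * ((D * ?e * norm x) * E)"
      using t M_pos E by (intro mult_left_mono order_trans[OF E(2)] mult_right_mono bd) auto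
    also have "\<dots> = M * E * D * (exp (- \<nu> * t i) * ?e) * norm x" by simp
    also have "exp (- \<nu> * t i) * ?e = exp (- \<nu> * (\<Sum>l=i..i + length (a # ns). t l))"
      by (subst sum.atLeast_Suc_atMost[of i]) (simp_all add: exp_add[symmetric] algebra_simps)
    finally show "norm (oprod T N (a # ns) t i x)
        \<le> M * E * D * exp (- \<nu> * (\<Sum>l=i..i + length (a # ns). t l)) * norm x" .
  qed (use M_pos E D in auto)
qed

lemma tendsto_oprod_abs:
  assumes "set ns \<subseteq> {..<n}" "\<And>l. i \<le> l \<Longrightarrow> l \<le> i + length ns \<Longrightarrow> ((\<lambda>w. \<tau> w l) \<longlongrightarrow> t l) F"
  shows "((\<lambda>w. oprod (\<lambda>s. T \<bar>s\<bar>) N ns (\<tau> w) i x) \<longlongrightarrow> oprod (\<lambda>s. T \<bar>s\<bar>) N ns t i x) F"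
  using assms
proof (induction ns arbitrary: i)
  case (Cons a ns)
  have "((\<lambda>w. oprod (\<lambda>s. T \<bar>s\<bar>) N ns (\<tau> w) (Suc i) x) \<longlongrightarrow> oprod (\<lambda>s. T \<bar>s\<bar>) N ns t (Suc i) x) F"
    using Cons by simp
  then show ?case
    using Cons.prems bounded_linear.tendsto[OF bounded_linear_N[of a]] by (auto intro!: tendsto_T_abs)
qed (auto intro: tendsto_T_abs)

lemma measurable_oprod_abs:
  assumes "set ns \<subseteq> {..<n}" "\<And>l. i \<le> l \<Longrightarrow> l \<le> i + length ns \<Longrightarrow> (\<lambda>w. \<tau> w l) \<in> borel_measurable S"
  shows "(\<lambda>w. oprod (\<lambda>s. T \<bar>s\<bar>) N ns (\<tau> w) i x) \<in> borel_measurable S"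
  using assms
proof (induction ns arbitrary: i)
  case Nil
  then show ?case by (auto intro!: borel_measurable_continuous_Pair[OF _ _ continuous_T_abs])
next
  case (Cons a ns)
  have "(\<lambda>w. oprod (\<lambda>s. T \<bar>s\<bar>) N ns (\<tau> w) (Suc i) x) \<in> borel_measurable S"
    using Cons by simp
  then have "(\<lambda>w. N a (oprod (\<lambda>s. T \<bar>s\<bar>) N ns (\<tau> w) (Suc i) x)) \<in> borel_measurable S"
    by (rule measurable_compose)
      (use bounded_linear_N[of a] Cons.prems in \<open>auto intro: borel_measurable_continuous_onI linear_continuous_on\<close>)
  then show ?case
    using Cons.prems by (auto intro!: borel_measurable_continuous_Pair[OF _ _ continuous_T_abs])
qed

lemma oprod_abs:
  assumes "\<And>l. i \<le> l \<Longrightarrow> l \<le> i + length ns \<Longrightarrow> 0 \<le> t l"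
  shows "oprod (\<lambda>s. T \<bar>s\<bar>) N ns t i x = oprod T N ns t i x"
  by (rule oprod_cong) (use assms in auto)

text \<open>The last semigroup factor of the left product meets the first one of the right product,
  and T(t) T(s) = T(t + s) merges the two times into one. This is the origin of the Hankel
  structure.\<close>

lemma oprod_append:
  assumes "\<And>l. l \<le> length ns \<Longrightarrow> 0 \<le> t (i + l)" "0 \<le> s 0"
  shows "oprod T N ns t i (oprod T N vs s 0 x) = oprod T N (ns @ vs)
    (\<lambda>l. if l < i + length ns then t l else if l = i + length ns then t l + s 0 else s (l - (i + length ns))) i x"
  using assms
proof (induction ns arbitrary: i)
  case Nil
  show ?case
  proof (cases vs)
    case (Cons v vs')
    have "oprod T N vs' s (Suc 0) x = oprod T N vs' (\<lambda>l. if l < i then t l else if l = i then t l + s 0 else s (l - i)) (Suc i) x"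
      by (rule oprod_cong) auto
    then show ?thesis using Cons Nil T_add[of "t i" "s 0"] by (simp cong del: if_weak_cong)
  qed (use Nil T_add[of "t i" "s 0"] in simp)
next
  case (Cons a ns)
  let ?\<tau> = "\<lambda>l. if l < i + length (a # ns) then t l else if l = i + length (a # ns) then t l + s 0 else s (l - (i + length (a # ns)))"
  have "oprod T N ns t (Suc i) (oprod T N vs s 0 x) = oprod T N (ns @ vs) ?\<tau> (Suc i) x"
  proof -
    have "0 \<le> t (Suc i + l)" if "l \<le> length ns" for l
      using Cons.prems(1)[of "Suc l"] that by simp
    from Cons.IH[OF this Cons.prems(2)] show ?thesis by (simp cong del: if_weak_cong)
  qed
  then show ?case by simp
qed

text \<open>The composition of O_k(t) with P_L(s)^* is the product underlying the Volterra kernel of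
  level k + L. \<open>Pstar\<close> runs through its times and indices backwards, hence
  \<open>rev ms\<close>.\<close>

lemma oprod_Pstar:
  assumes "length ns = k" "length ms = L" "\<And>l. l \<le> k \<Longrightarrow> 0 \<le> t l" "\<And>l. l \<le> L \<Longrightarrow> 0 \<le> s l"
  shows "oprod T N ns t 0 (Pstar T N ms s x) = oprod T N (ns @ rev ms) (hankel_times k L t s) 0 x"
  unfolding Pstar_def
  by (subst oprod_append) (use assms in \<open>auto intro!: oprod_cong simp: hankel_times_def add.commute\<close>)

lemma decaying_volterra:
  assumes j: "j < m" and ns: "ns \<in> idxs n q"
  shows "decaying_kernel (Suc q) (volterra T N psi C j ns i)"
  unfolding decaying_kernel_def
proof (intro conjI allI impI)
  let ?h = "volterra T N psi C j ns i"
  have ns': "set ns \<subseteq> {..<n}" and len: "length ns = q" using ns by (auto simp: idxs_def)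
  note Cj = bounded_linear_C[OF j]
  have abs: "?h t = C j (oprod (\<lambda>s. T \<bar>s\<bar>) N ns t 0 (psi i))"
    if "\<forall>l<Suc q. 0 < t l" for t
    unfolding volterra_def by (subst oprod_abs) (use that len in \<open>auto intro: less_imp_le\<close>)
  obtain D where D: "D \<ge> 0" and bd: "\<And>t i x. (\<forall>l. i \<le> l \<longrightarrow> l \<le> i + length ns \<longrightarrow> 0 \<le> t l) \<Longrightarrow>
    norm (oprod T N ns t i x) \<le> D * exp (- \<nu> * (\<Sum>l=i..i + length ns. t l)) * norm x"
    using norm_oprod[OF ns'] by blast
  obtain E where E: "E \<ge> 0" "\<And>x. norm (C j x) \<le> norm x * E"
    using bounded_linear.nonneg_bounded[OF Cj] by blast
  show "\<exists>D \<nu>. 0 < \<nu> \<and> (\<forall>t. (\<forall>l<Suc q. 0 < t l) \<longrightarrow>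
      \<bar>?h t\<bar> \<le> D * exp (- \<nu> * (\<Sum>l<Suc q. t l)))"
  proof (rule exI[of _ "D * norm (psi i) * E"], rule exI[of _ \<nu>], intro conjI allI impI \<nu>_pos)
    fix t :: "nat \<Rightarrow> real" assume t: "\<forall>l<Suc q. 0 < t l"
    have "\<bar>?h t\<bar> \<le> norm (oprod T N ns t 0 (psi i)) * E"
      using E(2) by (simp add: volterra_def)
    also have "\<dots> \<le> D * exp (- \<nu> * (\<Sum>l=0..0 + length ns. t l)) * norm (psi i) * E"
      using t len E(1) by (intro mult_right_mono bd) (auto intro: less_imp_le)
    finally show "\<bar>?h t\<bar> \<le> D * norm (psi i) * E * exp (- \<nu> * (\<Sum>l<Suc q. t l))"
      by (simp add: len mult_ac atLeast0AtMost lessThan_Suc_atMost)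
  qed
  show "\<exists>\<delta>>0. \<forall>t'. (\<forall>l<Suc q. 0 < t' l \<and> \<bar>t' l - t l\<bar> < \<delta>) \<longrightarrow>
      \<bar>?h t' - ?h t\<bar> < \<epsilon>"
    if t: "\<forall>l<Suc q. 0 < t l" and \<epsilon>: "0 < \<epsilon>" for t \<epsilon>
  proof (rule ccontr)
    \<comment> \<open>Failure at every distance 1/(r+1) yields a sequence converging to
      \<open>t\<close> in the relevant coordinates, against the sequential continuity supplied by
      \<open>tendsto_oprod_abs\<close>.\<close>
    assume "\<not> ?thesis"
    then have "\<forall>r::nat. \<exists>t'. (\<forall>l<Suc q. 0 < t' l \<and> \<bar>t' l - t l\<bar> < 1 / real (Suc r)) \<and>
        \<not> \<bar>?h t' - ?h t\<bar> < \<epsilon>"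
      by (metis of_nat_0_less_iff zero_less_Suc zero_less_divide_1_iff)
    then obtain \<tau> where \<tau>: "\<And>r l. l < Suc q \<Longrightarrow> 0 < \<tau> r l" "\<And>r l. l < Suc q \<Longrightarrow> \<bar>\<tau> r l - t l\<bar> < 1 / real (Suc r)"
      and far: "\<And>r. \<not> \<bar>?h (\<tau> r) - ?h t\<bar> < \<epsilon>"
      by metis
    have "(\<lambda>r. \<tau> r l) \<longlonglongrightarrow> t l" if "l < Suc q" for l
    proof -
      have "(\<lambda>r. \<tau> r l - t l) \<longlonglongrightarrow> 0"
        by (rule Lim_null_comparison[OF _ LIMSEQ_inverse_real_of_nat])
          (use \<tau>(2)[OF that] in \<open>auto intro!: always_eventually less_imp_le simp: inverse_eq_divide\<close>)
      then show ?thesis by (simp add: LIM_zero_iff)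
    qed
    then have "(\<lambda>r. ?h (\<tau> r)) \<longlonglongrightarrow> ?h t"
      using t \<tau>(1) len ns'
      by (simp add: abs) (intro bounded_linear.tendsto[OF Cj] tendsto_oprod_abs, auto)
    then show False using far \<epsilon> by (auto dest!: LIMSEQ_D[of _ _ \<epsilon>])
  qed
  show "?h \<in> borel_measurable (orthant (Suc q))"
  proof -
    have "(\<lambda>t. oprod (\<lambda>s. T \<bar>s\<bar>) N ns t 0 (psi i)) \<in> borel_measurable (orthant (Suc q))"
      by (rule measurable_oprod_abs[OF ns']) (use len in auto)
    then have "(\<lambda>t. C j (oprod (\<lambda>s. T \<bar>s\<bar>) N ns t 0 (psi i))) \<in> borel_measurable (orthant (Suc q))"
      by (rule measurable_compose) (rule borel_measurable_continuous_onI[OF linear_continuous_on[OF Cj]])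
    then show ?thesis
      by (rule measurable_cong[THEN iffD1, rotated]) (subst abs, auto intro: orthant_pos)
  qed
qed

end

section \<open>The Hankel operator on indicator functions of cells\<close>

text \<open>The square root is the inverse norm of the indicator of a cube, since level
  \<open>k\<close> has \<open>Suc k\<close> time variables. For fixed \<open>r\<close> the functions
  with indices in \<open>cell_indices\<close> are orthonormal.\<close>

definition cell_fun :: "nat \<Rightarrow> nat \<times> nat list \<times> nat \<times> nat list \<Rightarrow> fock" where
  "cell_fun r = (\<lambda>(k, D, i, ns) k' t i' ns'.
     if k' = k \<and> i' = i \<and> ns' = ns then sqrt (real (Suc r) ^ Suc k) * indicator (cell r (Suc k) D) t else 0)"

definition cell_indices :: "nat \<Rightarrow> nat \<Rightarrow> (nat \<times> nat list \<times> nat \<times> nat list) set" where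
  "cell_indices d n = {(k, D, i, ns). length D = Suc k \<and> i < d \<and> ns \<in> idxs n k}"

definition cell_comb :: "nat \<Rightarrow> 'j set \<Rightarrow> ('j \<Rightarrow> nat \<times> nat list \<times> nat \<times> nat list) \<Rightarrow> ('j \<Rightarrow> real) \<Rightarrow> fock" where
  "cell_comb r J \<iota> b = (\<lambda>k t i ns. \<Sum>\<beta>\<in>J. b \<beta> * cell_fun r (\<iota> \<beta>) k t i ns)"

text \<open>Pairing with a normalised indicator. The value space is the real line when
  \<open>G\<close> is a Fock element, and the state space when \<open>G\<close> collects the vectors
  that the reachability map integrates.\<close>

definition cell_pairing ::
  "nat \<Rightarrow> (nat \<Rightarrow> (nat \<Rightarrow> real) \<Rightarrow> nat \<Rightarrow> nat list \<Rightarrow> 'v::{banach, second_countable_topology}) \<Rightarrow>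
    nat \<times> nat list \<times> nat \<times> nat list \<Rightarrow> 'v" where
  "cell_pairing r G = (\<lambda>(k, D, i, ns).
     sqrt (real (Suc r) ^ Suc k) *\<^sub>R (\<integral>t. indicator (cell r (Suc k) D) t *\<^sub>R G k t i ns \<partial>orthant (Suc k)))"

definition cell_integrable ::
  "nat \<Rightarrow> (nat \<Rightarrow> (nat \<Rightarrow> real) \<Rightarrow> nat \<Rightarrow> nat list \<Rightarrow> 'v::{banach, second_countable_topology}) \<Rightarrow>
    nat \<times> nat list \<times> nat \<times> nat list \<Rightarrow> bool" where
  "cell_integrable r G = (\<lambda>(k, D, i, ns).
     integrable (orthant (Suc k)) (\<lambda>t. indicator (cell r (Suc k) D) t *\<^sub>R G k t i ns))"

lemma sum_delta_double:
  fixes f :: "'a \<Rightarrow> 'b \<Rightarrow> 'c::comm_monoid_add"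
  assumes "finite A" "finite B" "a \<in> A" "b \<in> B"
  shows "(\<Sum>x\<in>A. \<Sum>y\<in>B. if x = a \<and> y = b then f x y else 0) = f a b"
proof -
  have "(\<Sum>x\<in>A. \<Sum>y\<in>B. if x = a \<and> y = b then f x y else 0) = (\<Sum>x\<in>A. if x = a then f a b else 0)"
    using assms by (intro sum.cong refl) (auto simp: sum.delta)
  then show ?thesis using assms by simp
qed

text \<open>One computation for both the Fock inner product and the reachability map. The series
  over the levels reduces to a finite sum because a combination meets finitely many levels.\<close>

lemma sums_cell_comb:
  assumes J: "finite J" and \<iota>: "\<iota> ` J \<subseteq> cell_indices d n"
    and int: "\<And>\<beta>. \<beta> \<in> J \<Longrightarrow> cell_integrable r G (\<iota> \<beta>)"
  shows "(\<lambda>k. \<integral>t. (\<Sum>i<d. \<Sum>ns\<in>idxs n k. cell_comb r J \<iota> b k t i ns *\<^sub>R G k t i ns) \<partial>Tmeas k)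
    sums (\<Sum>\<beta>\<in>J. b \<beta> *\<^sub>R cell_pairing r G (\<iota> \<beta>))"
proof -
  define H where "H k t = (\<lambda>(k', D, i, ns). if k = k' then
     sqrt (real (Suc r) ^ Suc k') *\<^sub>R (indicator (cell r (Suc k') D) t *\<^sub>R G k' t i ns) else 0)" for k t
  have 1: "(\<Sum>i<d. \<Sum>ns\<in>idxs n k. cell_fun r \<beta> k t i ns *\<^sub>R G k t i ns) = H k t \<beta>"
    if \<beta>: "\<beta> \<in> cell_indices d n" for \<beta> k t
  proof -
    obtain k' D i ns where [simp]: "\<beta> = (k', D, i, ns)" by (cases \<beta>) auto
    have b: "i < d" "ns \<in> idxs n k'" using \<beta> by (auto simp: cell_indices_def)
    show ?thesis
    proof (cases "k = k'")
      case True
      have "(\<Sum>i'<d. \<Sum>ns'\<in>idxs n k. cell_fun r \<beta> k t i' ns' *\<^sub>R G k t i' ns')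
         = (\<Sum>i'<d. \<Sum>ns'\<in>idxs n k. if i' = i \<and> ns' = ns then
           sqrt (real (Suc r) ^ Suc k') *\<^sub>R (indicator (cell r (Suc k') D) t *\<^sub>R G k' t i' ns') else 0)"
        using True by (intro sum.cong refl) (auto simp: cell_fun_def)
      then show ?thesis using True b by (subst (asm) sum_delta_double) (auto simp: H_def)
    qed (simp add: cell_fun_def H_def)
  qed
  have "(\<integral>t. (\<Sum>i<d. \<Sum>ns\<in>idxs n k. cell_comb r J \<iota> b k t i ns *\<^sub>R G k t i ns) \<partial>Tmeas k)
     = (\<Sum>\<beta>\<in>J. if k = fst (\<iota> \<beta>) then b \<beta> *\<^sub>R cell_pairing r G (\<iota> \<beta>) else 0)" for k
  proof -
    have eq: "(\<Sum>i<d. \<Sum>ns\<in>idxs n k. cell_comb r J \<iota> b k t i ns *\<^sub>R G k t i ns) = (\<Sum>\<beta>\<in>J. b \<beta> *\<^sub>R H k t (\<iota> \<beta>))" for t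
    proof -
      have "(\<Sum>i<d. \<Sum>ns\<in>idxs n k. cell_comb r J \<iota> b k t i ns *\<^sub>R G k t i ns)
         = (\<Sum>i<d. \<Sum>ns\<in>idxs n k. \<Sum>\<beta>\<in>J. b \<beta> *\<^sub>R (cell_fun r (\<iota> \<beta>) k t i ns *\<^sub>R G k t i ns))"
        by (simp add: cell_comb_def scaleR_sum_left)
      also have "\<dots> = (\<Sum>\<beta>\<in>J. \<Sum>i<d. \<Sum>ns\<in>idxs n k. b \<beta> *\<^sub>R (cell_fun r (\<iota> \<beta>) k t i ns *\<^sub>R G k t i ns))"
        by (subst sum.swap[of _ _ J], subst sum.swap[of _ J]) (rule refl)
      also have "\<dots> = (\<Sum>\<beta>\<in>J. b \<beta> *\<^sub>R H k t (\<iota> \<beta>))"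
        using \<iota> by (intro sum.cong refl) (simp add: 1[symmetric] image_subset_iff scaleR_sum_right)
      finally show ?thesis .
    qed
    have Hi: "has_bochner_integral (Tmeas k) (\<lambda>t. H k t (\<iota> \<beta>)) (if k = fst (\<iota> \<beta>) then cell_pairing r G (\<iota> \<beta>) else 0)"
      if "\<beta> \<in> J" for \<beta>
    proof -
      obtain k' D i ns where eq: "\<iota> \<beta> = (k', D, i, ns)" by (cases "\<iota> \<beta>") auto
      show ?thesis
      proof (cases "k = k'")
        case True
        have "has_bochner_integral (orthant (Suc k')) (\<lambda>t. indicator (cell r (Suc k') D) t *\<^sub>R G k' t i ns)
          (\<integral>t. indicator (cell r (Suc k') D) t *\<^sub>R G k' t i ns \<partial>orthant (Suc k'))"
          using int[OF that] by (simp add: eq cell_integrable_def has_bochner_integral_iff)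
        from has_bochner_integral_scaleR_right[OF this, of "sqrt (real (Suc r) ^ Suc k')"]
        show ?thesis using True by (simp only: eq H_def Tmeas_eq_orthant cell_pairing_def prod.case fst_conv if_True simp_thms)
      qed (simp add: eq H_def has_bochner_integral_zero)
    qed
    have "has_bochner_integral (Tmeas k) (\<lambda>t. \<Sum>\<beta>\<in>J. b \<beta> *\<^sub>R H k t (\<iota> \<beta>))
       (\<Sum>\<beta>\<in>J. b \<beta> *\<^sub>R (if k = fst (\<iota> \<beta>) then cell_pairing r G (\<iota> \<beta>) else 0))"
      by (intro has_bochner_integral_sum has_bochner_integral_scaleR_right Hi)
    then show ?thesis
      by (simp add: eq has_bochner_integral_iff if_distrib[of "(*\<^sub>R) _"] cong: if_cong)
  qed
  moreover have "(\<lambda>k. \<Sum>\<beta>\<in>J. if k = fst (\<iota> \<beta>) then b \<beta> *\<^sub>R cell_pairing r G (\<iota> \<beta>) else 0)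
     sums (\<Sum>\<beta>\<in>J. b \<beta> *\<^sub>R cell_pairing r G (\<iota> \<beta>))"
    by (intro sums_sum) (rule sums_single)
  ultimately show ?thesis by simp
qed

lemma fock_inner_cell_comb:
  assumes "finite J" "\<iota> ` J \<subseteq> cell_indices d n" "\<And>\<beta>. \<beta> \<in> J \<Longrightarrow> cell_integrable r F (\<iota> \<beta>)"
  shows "fock_inner d n F (cell_comb r J \<iota> b) = (\<Sum>\<beta>\<in>J. b \<beta> * cell_pairing r F (\<iota> \<beta>))"
  using sums_unique[OF sums_cell_comb[OF assms, where b = b]]
  by (simp add: fock_inner_def mult.commute)

lemma cell_fun_measurable: "(\<lambda>t. cell_fun r \<beta> k t i ns) \<in> borel_measurable (Tmeas k)"
proof -
  obtain k' D i' ns' where [simp]: "\<beta> = (k', D, i', ns')" by (cases \<beta>) auto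
  show ?thesis
  proof (cases "k = k' \<and> i = i' \<and> ns = ns'")
    case True
    then show ?thesis by (simp add: cell_fun_def Tmeas_eq_orthant)
  next
    case False
    then have "(\<lambda>t. cell_fun r \<beta> k t i ns) = (\<lambda>_. 0)" by (auto simp: cell_fun_def)
    then show ?thesis by simp
  qed
qed

lemma cell_comb_measurable: "(\<lambda>t. cell_comb r J \<iota> b k t i ns) \<in> borel_measurable (Tmeas k)"
  unfolding cell_comb_def by (intro borel_measurable_sum borel_measurable_times cell_fun_measurable borel_measurable_const)

lemma cell_comb_abs_le:
  "\<bar>cell_comb r J \<iota> b k t i ns\<bar> \<le> (\<Sum>\<beta>\<in>J. \<bar>b \<beta>\<bar> * sqrt (real (Suc r) ^ Suc k))"
proof -
  have "\<bar>cell_fun r \<beta> k t i ns\<bar> \<le> sqrt (real (Suc r) ^ Suc k)" for \<beta>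
    by (cases \<beta>) (auto simp: cell_fun_def split: split_indicator)
  then show ?thesis unfolding cell_comb_def
    by (intro order_trans[OF sum_abs] sum_mono) (simp only: abs_mult mult_left_mono abs_ge_zero)
qed

lemma cell_integrable_bounded:
  assumes "(\<lambda>t. G k t i ns) \<in> borel_measurable (orthant (Suc k))"
    and "\<And>t. t \<in> space (orthant (Suc k)) \<Longrightarrow> norm (G k t i ns) \<le> B"
  shows "cell_integrable r G (k, D, i, ns)"
  unfolding cell_integrable_def prod.case
proof (rule Bochner_Integration.integrable_bound)
  show "integrable (orthant (Suc k)) (\<lambda>t. B * indicator (cell r (Suc k) D) t)"
    by (simp add: emeasure_cell)
  show "AE t in orthant (Suc k). norm (indicator (cell r (Suc k) D) t *\<^sub>R G k t i ns) \<le> norm (B * indicator (cell r (Suc k) D) t)"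
    using assms(2) by (intro AE_I2) (auto split: split_indicator intro: order_trans[OF _ abs_ge_self])
qed (use assms(1) in measurable)

lemma cell_integrable_cell_comb: "cell_integrable r (cell_comb r J \<iota> b) \<beta>"
proof (cases \<beta>)
  case (fields k D i ns)
  show ?thesis unfolding fields
    by (rule cell_integrable_bounded[OF cell_comb_measurable[unfolded Tmeas_eq_orthant]])
      (use cell_comb_abs_le in auto)
qed

text \<open>Coefficient extraction: distinct indices at the same level and component have disjoint
  cubes, and the two normalising roots cancel the volume.\<close>

lemma cell_pairing_cell_comb:
  assumes J: "finite J" and \<iota>: "\<iota> ` J \<subseteq> cell_indices d n" "inj_on \<iota> J" and \<beta>: "\<beta> \<in> J"
  shows "cell_pairing r (cell_comb r J \<iota> b) (\<iota> \<beta>) = b \<beta>"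
proof -
  obtain k D i ns where eq: "\<iota> \<beta> = (k, D, i, ns)" by (cases "\<iota> \<beta>") auto
  have len: "length D = Suc k" using \<iota> \<beta> eq by (auto simp: cell_indices_def)
  let ?c = "sqrt (real (Suc r) ^ Suc k)" and ?I = "indicator (cell r (Suc k) D) :: _ \<Rightarrow> real"
  have "?I t * cell_comb r J \<iota> b k t i ns = b \<beta> * ?c * ?I t" for t
  proof -
    have "?I t * (b \<gamma> * cell_fun r (\<iota> \<gamma>) k t i ns) = (if \<gamma> = \<beta> then b \<beta> * ?c * ?I t else 0)" if \<gamma>: "\<gamma> \<in> J" for \<gamma>
    proof -
      obtain k' D' i' ns' where eq': "\<iota> \<gamma> = (k', D', i', ns')" by (cases "\<iota> \<gamma>") auto
      have len': "length D' = Suc k'" using \<iota> \<gamma> eq' by (auto simp: cell_indices_def)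
      show ?thesis
      proof (cases "\<gamma> = \<beta>")
        case True
        then show ?thesis using eq by (simp add: cell_fun_def split: split_indicator)
      next
        case False
        then have "\<iota> \<gamma> \<noteq> \<iota> \<beta>" using \<iota>(2) \<gamma> \<beta> by (auto dest: inj_onD)
        then show ?thesis using False cell_disjoint[OF len, of D' t r] len'
          by (auto simp: eq eq' cell_fun_def split: split_indicator)
      qed
    qed
    then show ?thesis using J \<beta> by (simp add: cell_comb_def sum_distrib_left)
  qed
  note int = this
  have "cell_pairing r (cell_comb r J \<iota> b) (\<iota> \<beta>) = ?c * (\<integral>t. b \<beta> * ?c * ?I t \<partial>orthant (Suc k))"
    unfolding cell_pairing_def eq prod.case real_scaleR_def int ..
  also have "\<dots> = ?c * (b \<beta> * ?c * (1 / real (Suc r) ^ Suc k))"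
    by (simp add: measure_cell del: power_Suc of_nat_Suc)
  also have "\<dots> = b \<beta>"
  proof -
    have "?c * ?c = real (Suc r) ^ Suc k" "real (Suc r) ^ Suc k \<noteq> 0"
      by (rule real_sqrt_mult_self[THEN trans]) simp_all
    moreover have "c * (x * c * (1 / S)) = x" if "c * c = S" "S \<noteq> 0" for c x S :: real
      using that by (auto simp: field_simps)
    ultimately show ?thesis by blast
  qed
  finally show ?thesis .
qed

lemma fock_inner_cell_combs:
  assumes "finite J" "\<iota> ` J \<subseteq> cell_indices d n" "inj_on \<iota> J"
  shows "fock_inner d n (cell_comb r J \<iota> a) (cell_comb r J \<iota> b) = (\<Sum>\<beta>\<in>J. a \<beta> * b \<beta>)"
  using assms by (simp add: fock_inner_cell_comb cell_integrable_cell_comb cell_pairing_cell_comb mult.commute)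

lemma cell_comb_in_fock_space:
  assumes J: "finite J" and \<iota>: "\<iota> ` J \<subseteq> cell_indices d n"
  shows "cell_comb r J \<iota> b \<in> fock_space d n"
  unfolding fock_space_def
proof (intro CollectI conjI allI cell_comb_measurable)
  let ?e = "cell_comb r J \<iota> b"
  let ?f = "\<lambda>k t. \<Sum>i<d. \<Sum>ns\<in>idxs n k. (?e k t i ns)\<^sup>2"
  let ?F = "\<lambda>k. \<integral>\<^sup>+t. ennreal (?f k t) \<partial>Tmeas k"
  have fin: "?F k < \<infinity>" for k
  proof -
    have "integrable (Tmeas k) (\<lambda>t. (?e k t i ns)\<^sup>2)" for i ns
    proof -
      have "integrable (Tmeas k) (\<lambda>t. cell_fun r \<beta> k t i ns * ?e k t i ns)" for \<beta>
      proof -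
        obtain k' D i' ns' where \<beta>: "\<beta> = (k', D, i', ns')" by (cases \<beta>) auto
        show ?thesis
        proof (cases "k = k' \<and> i = i' \<and> ns = ns'")
          case True
          then show ?thesis using cell_integrable_cell_comb[of r J \<iota> b \<beta>]
            by (simp add: \<beta> cell_integrable_def cell_fun_def Tmeas_eq_orthant mult.assoc)
        next
          case False
          then have "(\<lambda>t. cell_fun r \<beta> k t i ns * ?e k t i ns) = (\<lambda>_. 0)" by (auto simp: \<beta> cell_fun_def)
          then show ?thesis by simp
        qed
      qed
      then have "integrable (Tmeas k) (\<lambda>t. \<Sum>\<beta>\<in>J. b \<beta> * (cell_fun r (\<iota> \<beta>) k t i ns * ?e k t i ns))"
        by (intro Bochner_Integration.integrable_sum integrable_mult_right)
      moreover have "(\<Sum>\<beta>\<in>J. b \<beta> * (cell_fun r (\<iota> \<beta>) k t i ns * ?e k t i ns)) = (?e k t i ns)\<^sup>2" for t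
        by (simp add: cell_comb_def power2_eq_square sum_distrib_right mult.assoc)
      ultimately show ?thesis by simp
    qed
    then have "integrable (Tmeas k) (?f k)"
      by (intro Bochner_Integration.integrable_sum)
    then show ?thesis by (subst nn_integral_eq_integral) (auto intro!: sum_nonneg)
  qed
  have "?F k = 0" if "k \<notin> fst ` \<iota> ` J" for k
  proof -
    have "?e k t i ns = 0" for t i ns
      unfolding cell_comb_def using that
      by (intro sum.neutral ballI) (force simp: cell_fun_def split: prod.splits)
    then show ?thesis by simp
  qed
  then have "(\<Sum>k. ?F k) = (\<Sum>k\<in>fst ` \<iota> ` J. ?F k)" using J by (intro suminf_finite) auto
  also have "\<dots> < \<infinity>" using J fin by simp
  finally show "(\<Sum>k. ?F k) < \<infinity>" .
qed

lemma fock_orthonormal_cell_comb: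
  assumes "finite J" "\<iota> ` J \<subseteq> cell_indices d n" "inj_on \<iota> J" "orthonormal_on J L b"
  shows "fock_orthonormal d n L (\<lambda>l. cell_comb r J \<iota> (b l))"
  using assms cell_comb_in_fock_space[OF assms(1,2)]
  by (auto simp: fock_orthonormal_def fock_inner_cell_combs orthonormal_on_def)

text \<open>Abstracts from the systems. Differences of Volterra kernel families are again of this
  kind, so the estimates are carried out for one family \<open>\<Delta>\<close>.\<close>

locale kernel_family =
  fixes n m :: nat and \<Delta> :: "nat \<Rightarrow> nat list \<Rightarrow> nat \<Rightarrow> (nat \<Rightarrow> real) \<Rightarrow> real"
  assumes decaying: "j < m \<Longrightarrow> i < n \<Longrightarrow> ns \<in> idxs n q \<Longrightarrow> decaying_kernel (Suc q) (\<Delta> j ns i)"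

text \<open>The image of a normalised cell function under the integral operator with Hankel kernel
  built from \<open>\<Delta>\<close>; pairing it with a second cell function gives the matrix
  coefficient \<open>hankel_entry\<close>.\<close>

definition hankel_row :: "nat \<Rightarrow> (nat \<Rightarrow> nat list \<Rightarrow> nat \<Rightarrow> (nat \<Rightarrow> real) \<Rightarrow> real) \<Rightarrow>
    nat \<times> nat list \<times> nat \<times> nat list \<Rightarrow> fock" where
  "hankel_row r \<Delta> = (\<lambda>(L, D, i, ms) k t j ns. sqrt (real (Suc r) ^ Suc L) *
     (\<integral>s. indicator (cell r (Suc L) D) s * \<Delta> j (ns @ rev ms) i (hankel_times k L t s) \<partial>orthant (Suc L)))"

definition hankel_entry :: "nat \<Rightarrow> (nat \<Rightarrow> nat list \<Rightarrow> nat \<Rightarrow> (nat \<Rightarrow> real) \<Rightarrow> real) \<Rightarrow>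
    nat \<times> nat list \<times> nat \<times> nat list \<Rightarrow> nat \<times> nat list \<times> nat \<times> nat list \<Rightarrow> real" where
  "hankel_entry r \<Delta> \<alpha> \<beta> = cell_pairing r (hankel_row r \<Delta> \<beta>) \<alpha>"

lemma hankel_times_pos:
  assumes "t \<in> space (orthant (Suc k))" "s \<in> space (orthant (Suc L))" "l < Suc (k + L)"
  shows "0 < hankel_times k L t s l"
  using orthant_pos[OF assms(1), of l] orthant_pos[OF assms(1), of k] orthant_pos[OF assms(2), of L]
    orthant_pos[OF assms(2), of "k + L - l"] assms(3)
  by (auto simp: hankel_times_def)

lemma append_rev_idxs: "ns \<in> idxs n k \<Longrightarrow> ms \<in> idxs n L \<Longrightarrow> ns @ rev ms \<in> idxs n (k + L)"
  by (auto simp: idxs_def)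

context kernel_family
begin

lemma kernel_bounded:
  assumes "j < m" "i < n" "ns \<in> idxs n q"
  obtains D where "0 \<le> D" "\<And>t. (\<And>l. l < Suc q \<Longrightarrow> 0 < t l) \<Longrightarrow> \<bar>\<Delta> j ns i t\<bar> \<le> D"
proof -
  obtain D \<nu> where D: "0 \<le> D" "0 < \<nu>"
    "\<And>t. (\<And>l. l < Suc q \<Longrightarrow> 0 < t l) \<Longrightarrow> \<bar>\<Delta> j ns i t\<bar> \<le> D * exp (- \<nu> * (\<Sum>l<Suc q. t l))"
    using decaying_kernelE[OF decaying[OF assms]] by blast
  have "\<bar>\<Delta> j ns i t\<bar> \<le> D" if t: "\<And>l. l < Suc q \<Longrightarrow> 0 < t l" for t
  proof -
    have "0 \<le> (\<Sum>l<Suc q. t l)" by (intro sum_nonneg) (use t in \<open>simp add: less_imp_le\<close>)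
    then have "exp (- \<nu> * (\<Sum>l<Suc q. t l)) \<le> 1" using D(2) by simp
    then have "D * exp (- \<nu> * (\<Sum>l<Suc q. t l)) \<le> D * 1" using D(1) by (rule mult_left_mono)
    moreover have "\<bar>\<Delta> j ns i t\<bar> \<le> D * exp (- \<nu> * (\<Sum>l<Suc q. t l))" using t by (rule D(3))
    ultimately show ?thesis by simp
  qed
  with D(1) that show thesis by blast
qed

lemma measurable_hankel_kernel:
  assumes "j < m" "i < n" "ns \<in> idxs n k" "ms \<in> idxs n L"
  shows "(\<lambda>w. \<Delta> j (ns @ rev ms) i (hankel_times k L (fst w) (snd w)))
    \<in> borel_measurable (orthant (Suc k) \<Otimes>\<^sub>M orthant (Suc L))"
proof (rule measurable_decaying_kernel[OF decaying[OF assms(1,2) append_rev_idxs[OF assms(3,4)]]])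
  let ?S = "orthant (Suc k) \<Otimes>\<^sub>M orthant (Suc L)"
  show "0 < hankel_times k L (fst w) (snd w) l" if "w \<in> space ?S" "l < Suc (k + L)" for w l
    using that by (intro hankel_times_pos) (auto simp: space_pair_measure)
  fix l assume l: "l < Suc (k + L)"
  have fst_m: "(\<lambda>w. fst w l) \<in> borel_measurable ?S" if "l < Suc k" for l
    by (rule measurable_compose[OF measurable_fst borel_measurable_orthant_component[OF that]])
  have snd_m: "(\<lambda>w. snd w l) \<in> borel_measurable ?S" if "l < Suc L" for l
    by (rule measurable_compose[OF measurable_snd borel_measurable_orthant_component[OF that]])
  show "(\<lambda>w. hankel_times k L (fst w) (snd w) l) \<in> borel_measurable ?S"
  proof -
    consider "l < k" | "l = k" | "k < l" by linarith
    then show ?thesis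
    proof cases
      case 3
      then have "k + L - l < Suc L" by linarith
      from snd_m[OF this] show ?thesis using 3 by (simp add: hankel_times_def)
    next
      case 2
      then show ?thesis using borel_measurable_add[OF fst_m[of k] snd_m[of L]]
        by (simp add: hankel_times_def)
    next
      case 1
      then show ?thesis using fst_m[of l] by (simp add: hankel_times_def)
    qed
  qed
qed

lemma measurable_hankel_kernel_snd:
  assumes "j < m" "i < n" "ns \<in> idxs n k" "ms \<in> idxs n L" "t \<in> space (orthant (Suc k))"
  shows "(\<lambda>s. \<Delta> j (ns @ rev ms) i (hankel_times k L t s)) \<in> borel_measurable (orthant (Suc L))"
  using measurable_compose[OF measurable_Pair1'[OF assms(5)] measurable_hankel_kernel[OF assms(1-4)]] by simp

lemma integrable_hankel_kernel:
  assumes "j < m" "i < n" "ns \<in> idxs n k" "ms \<in> idxs n L" "t \<in> space (orthant (Suc k))"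
  shows "integrable (orthant (Suc L))
    (\<lambda>s. indicator (cell r (Suc L) D) s * \<Delta> j (ns @ rev ms) i (hankel_times k L t s))"
proof -
  obtain B where B: "0 \<le> B" "\<And>t. (\<And>l. l < Suc (k + L) \<Longrightarrow> 0 < t l) \<Longrightarrow> \<bar>\<Delta> j (ns @ rev ms) i t\<bar> \<le> B"
    using kernel_bounded[OF assms(1,2) append_rev_idxs[OF assms(3,4)]] by blast
  show ?thesis
    by (rule integral_cell_close(1)[OF measurable_hankel_kernel_snd[OF assms], of r D 0 B])
      (use B hankel_times_pos[OF assms(5)] in \<open>auto simp: cell_def\<close>)
qed

lemma measurable_hankel_row:
  assumes "\<beta> \<in> cell_indices n n" "j < m" "ns \<in> idxs n k"
  shows "(\<lambda>t. hankel_row r \<Delta> \<beta> k t j ns) \<in> borel_measurable (orthant (Suc k))"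
proof -
  obtain L E i ms where \<beta>: "\<beta> = (L, E, i, ms)" "i < n" "ms \<in> idxs n L"
    using assms(1) by (auto simp: cell_indices_def)
  interpret sigma_finite_measure "orthant (Suc L)" by (rule sigma_finite_orthant)
  let ?h = "\<lambda>t s. indicator (cell r (Suc L) E) s * \<Delta> j (ns @ rev ms) i (hankel_times k L t s)"
  have "(\<lambda>w. ?h (fst w) (snd w)) \<in> borel_measurable (orthant (Suc k) \<Otimes>\<^sub>M orthant (Suc L))"
    using measurable_hankel_kernel[OF assms(2) \<beta>(2) assms(3) \<beta>(3)]
      measurable_compose[OF measurable_snd borel_measurable_indicator[OF sets_cell]]
    by (intro borel_measurable_times) auto
  then have "(\<lambda>t. \<integral>s. ?h t s \<partial>orthant (Suc L)) \<in> borel_measurable (orthant (Suc k))"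
    by (intro borel_measurable_lebesgue_integral) (simp add: case_prod_unfold)
  then show ?thesis by (simp add: hankel_row_def \<beta>)
qed

lemma cell_integrable_hankel_row:
  assumes "\<beta> \<in> cell_indices n n" "j < m" "ns \<in> idxs n k"
  shows "cell_integrable r (hankel_row r \<Delta> \<beta>) (k, D, j, ns)"
proof -
  obtain L E i ms where \<beta>: "\<beta> = (L, E, i, ms)" "i < n" "ms \<in> idxs n L"
    using assms(1) by (auto simp: cell_indices_def)
  note a = assms(2) \<beta>(2) assms(3) \<beta>(3)
  obtain B where B: "0 \<le> B" "\<And>t. (\<And>l. l < Suc (k + L) \<Longrightarrow> 0 < t l) \<Longrightarrow> \<bar>\<Delta> j (ns @ rev ms) i t\<bar> \<le> B"
    using kernel_bounded[OF assms(2) \<beta>(2) append_rev_idxs[OF a(3,4)]] by blast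
  let ?h = "\<lambda>t s. indicator (cell r (Suc L) E) s * \<Delta> j (ns @ rev ms) i (hankel_times k L t s)"
  show ?thesis
  proof (rule cell_integrable_bounded, rule measurable_hankel_row[OF assms])
    fix t assume t: "t \<in> space (orthant (Suc k))"
    have "\<bar>real (Suc r) ^ Suc L * (\<integral>s. ?h t s \<partial>orthant (Suc L)) - 0\<bar> \<le> B"
      by (rule integral_cell_close(2)[OF measurable_hankel_kernel_snd[OF a t]])
        (use B hankel_times_pos[OF t] in \<open>auto simp: cell_def\<close>)
    then have "\<bar>\<integral>s. ?h t s \<partial>orthant (Suc L)\<bar> \<le> B / real (Suc r) ^ Suc L"
      by (simp add: abs_mult pos_le_divide_eq mult.commute del: power_Suc of_nat_Suc)
    then have "sqrt (real (Suc r) ^ Suc L) * \<bar>\<integral>s. ?h t s \<partial>orthant (Suc L)\<bar>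
        \<le> sqrt (real (Suc r) ^ Suc L) * (B / real (Suc r) ^ Suc L)"
      by (rule mult_left_mono) simp
    then show "norm (hankel_row r \<Delta> \<beta> k t j ns) \<le> sqrt (real (Suc r) ^ Suc L) * (B / real (Suc r) ^ Suc L)"
      by (simp add: hankel_row_def \<beta> abs_mult del: power_Suc of_nat_Suc)
  qed
qed

end

context stable_system
begin

lemma kernel_family_volterra: "kernel_family n m (volterra T N psi C)"
  by (simp add: kernel_family_def decaying_volterra)

lemma cell_integrable_Pstar:
  assumes "ms \<in> idxs n L"
  shows "cell_integrable r (\<lambda>k s i ns. Pstar T N ns s (psi i)) (L, D, i, ms)"
proof -
  have ms: "set (rev ms) \<subseteq> {..<n}" "length ms = L" using assms by (auto simp: idxs_def)
  obtain B where B: "B \<ge> 0" "\<And>t i x. (\<forall>l. i \<le> l \<longrightarrow> l \<le> i + length (rev ms) \<longrightarrow> 0 \<le> t l) \<Longrightarrow>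
    norm (oprod T N (rev ms) t i x) \<le> B * exp (- \<nu> * (\<Sum>l=i..i + length (rev ms). t l)) * norm x"
    using norm_oprod[OF ms(1)] by blast
  have P: "Pstar T N ms s (psi i) = oprod (\<lambda>u. T \<bar>u\<bar>) N (rev ms) (\<lambda>l. s (L - l)) 0 (psi i)"
    if "s \<in> space (orthant (Suc L))" for s
    unfolding Pstar_def ms by (rule oprod_abs[symmetric]) (use orthant_nonneg[OF that] ms in auto)
  show ?thesis
  proof (rule cell_integrable_bounded)
    have "(\<lambda>s. oprod (\<lambda>u. T \<bar>u\<bar>) N (rev ms) (\<lambda>l. s (L - l)) 0 (psi i)) \<in> borel_measurable (orthant (Suc L))"
      by (rule measurable_oprod_abs[OF ms(1)]) auto
    then show "(\<lambda>s. Pstar T N ms s (psi i)) \<in> borel_measurable (orthant (Suc L))"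
      by (rule measurable_cong[THEN iffD1, rotated]) (simp add: P)
    fix s assume s: "s \<in> space (orthant (Suc L))"
    have p: "0 \<le> s (L - l)" for l using orthant_nonneg[OF s, of "L - l"] by simp
    have "norm (Pstar T N ms s (psi i)) \<le> B * exp (- \<nu> * (\<Sum>l=0..0 + length (rev ms). s (L - l))) * norm (psi i)"
      unfolding Pstar_def ms(2) using p by (intro B(2)) auto
    also have "\<dots> \<le> B * 1 * norm (psi i)"
      using B(1) \<nu>_pos p by (intro mult_right_mono mult_left_mono) (auto intro!: mult_nonneg_nonneg sum_nonneg)
    finally show "norm (Pstar T N ms s (psi i)) \<le> B * norm (psi i)" by simp
  qed
qed

lemma reach_map_cell_comb:
  assumes "finite J" "\<iota> ` J \<subseteq> cell_indices n n"
  shows "reach_map n T N psi (cell_comb r J \<iota> b)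
    = (\<Sum>\<beta>\<in>J. b \<beta> *\<^sub>R cell_pairing r (\<lambda>k s i ns. Pstar T N ns s (psi i)) (\<iota> \<beta>))"
  unfolding reach_map_def
  by (rule sums_unique[symmetric], rule sums_cell_comb[OF assms])
    (use assms(2) in \<open>fastforce simp: cell_indices_def intro: cell_integrable_Pstar\<close>)

text \<open>For fixed \<open>t\<close> the output is a bounded functional of the state, so it passes
  under the vector-valued integral, where \<open>oprod_Pstar\<close> merges the two
  products.\<close>

lemma output_cell_pairing:
  assumes j: "j < m" and ns: "ns \<in> idxs n k" and \<beta>: "\<beta> \<in> cell_indices n n" and t: "t \<in> space (orthant (Suc k))"
  shows "C j (oprod T N ns t 0 (cell_pairing r (\<lambda>k s i ns. Pstar T N ns s (psi i)) \<beta>))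
    = hankel_row r (volterra T N psi C) \<beta> k t j ns"
proof -
  obtain L D i ms where [simp]: "\<beta> = (L, D, i, ms)" and ms: "ms \<in> idxs n L"
    using \<beta> by (auto simp: cell_indices_def)
  have bl: "bounded_linear (\<lambda>x. C j (oprod T N ns t 0 x))"
    using ns t by (intro bounded_linear_compose[OF bounded_linear_C[OF j]] bounded_linear_oprod)
      (auto simp: idxs_def intro: orthant_nonneg)
  have lin: "linear (\<lambda>x. C j (oprod T N ns t 0 x))" by (rule bounded_linear.linear[OF bl])
  have "C j (oprod T N ns t 0 (cell_pairing r (\<lambda>k s i ns. Pstar T N ns s (psi i)) \<beta>))
    = sqrt (real (Suc r) ^ Suc L) * C j (oprod T N ns t 0
        (\<integral>s. indicator (cell r (Suc L) D) s *\<^sub>R Pstar T N ms s (psi i) \<partial>orthant (Suc L)))"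
    using linear_scale[OF lin] by (simp add: cell_pairing_def del: power_Suc of_nat_Suc)
  also have "C j (oprod T N ns t 0
        (\<integral>s. indicator (cell r (Suc L) D) s *\<^sub>R Pstar T N ms s (psi i) \<partial>orthant (Suc L)))
     = (\<integral>s. C j (oprod T N ns t 0 (indicator (cell r (Suc L) D) s *\<^sub>R Pstar T N ms s (psi i))) \<partial>orthant (Suc L))"
    using cell_integrable_Pstar[OF ms, of r D i]
    by (intro integral_bounded_linear[OF bl, symmetric]) (simp add: cell_integrable_def)
  also have "\<dots> = (\<integral>s. indicator (cell r (Suc L) D) s * volterra T N psi C j (ns @ rev ms) i (hankel_times k L t s) \<partial>orthant (Suc L))"
  proof (rule Bochner_Integration.integral_cong[OF refl])
    fix s assume s: "s \<in> space (orthant (Suc L))"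
    have "oprod T N ns t 0 (Pstar T N ms s (psi i)) = oprod T N (ns @ rev ms) (hankel_times k L t s) 0 (psi i)"
      using ns ms s t by (intro oprod_Pstar) (auto simp: idxs_def intro: orthant_nonneg)
    then show "C j (oprod T N ns t 0 (indicator (cell r (Suc L) D) s *\<^sub>R Pstar T N ms s (psi i)))
      = indicator (cell r (Suc L) D) s * volterra T N psi C j (ns @ rev ms) i (hankel_times k L t s)"
      using linear_scale[OF lin] by (simp add: volterra_def)
  qed
  finally show ?thesis by (simp add: hankel_row_def)
qed

text \<open>Ties the operator to its kernel. The reachability map sends a finite combination to a
  finite sum in the state space, and the output at a fixed time is linear, so the identity holds at
  every \<open>t\<close> of the orthant and not merely almost everywhere.\<close>

lemma hankel_cell_comb:
  assumes J: "finite J" "\<iota> ` J \<subseteq> cell_indices n n"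
    and j: "j < m" and ns: "ns \<in> idxs n k" and t: "t \<in> space (orthant (Suc k))"
  shows "hankel n T N psi C (cell_comb r J \<iota> b) k t j ns
    = (\<Sum>\<beta>\<in>J. b \<beta> * hankel_row r (volterra T N psi C) (\<iota> \<beta>) k t j ns)"
proof -
  have lin: "linear (\<lambda>x. C j (oprod T N ns t 0 x))"
    using ns t by (intro bounded_linear.linear bounded_linear_compose[OF bounded_linear_C[OF j]] bounded_linear_oprod)
      (auto simp: idxs_def intro: orthant_nonneg)
  have "hankel n T N psi C (cell_comb r J \<iota> b) k t j ns
    = (\<Sum>\<beta>\<in>J. b \<beta> * C j (oprod T N ns t 0 (cell_pairing r (\<lambda>k s i ns. Pstar T N ns s (psi i)) (\<iota> \<beta>))))"
    by (simp add: hankel_def obs_map_def reach_map_cell_comb[OF J] linear_sum[OF lin] linear_scale[OF lin])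
  also have "\<dots> = (\<Sum>\<beta>\<in>J. b \<beta> * hankel_row r (volterra T N psi C) (\<iota> \<beta>) k t j ns)"
    using J by (intro sum.cong refl arg_cong2[where f = "(*)"] output_cell_pairing[OF j ns _ t]) auto
  finally show ?thesis .
qed

end

lemma hankel_row_diff:
  assumes "kernel_family n m V" "kernel_family n m V'"
    and "\<beta> \<in> cell_indices n n" "j < m" "ns \<in> idxs n k" "t \<in> space (orthant (Suc k))"
  shows "hankel_row r (\<lambda>j ns i t. V j ns i t - V' j ns i t) \<beta> k t j ns
    = hankel_row r V \<beta> k t j ns - hankel_row r V' \<beta> k t j ns"
proof -
  obtain L D i ms where [simp]: "\<beta> = (L, D, i, ms)" and ms: "ms \<in> idxs n L" "i < n"
    using assms(3) by (auto simp: cell_indices_def)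
  show ?thesis
    using kernel_family.integrable_hankel_kernel[OF assms(1,4) ms(2) assms(5) ms(1) assms(6), of r D]
      kernel_family.integrable_hankel_kernel[OF assms(2,4) ms(2) assms(5) ms(1) assms(6), of r D]
    by (simp add: hankel_row_def right_diff_distrib)
qed

lemma kernel_family_diff:
  assumes "kernel_family n m V" "kernel_family n m V'"
  shows "kernel_family n m (\<lambda>j ns i t. V j ns i t - V' j ns i t)"
  using assms by (simp add: kernel_family_def decaying_kernel_diff)

text \<open>The cell index \<open>p\<close> of the last time is kept apart from the outer data: that
  time enters the merged time t_k + s_L, and the partial trace is taken over equal \<open>p\<close>
  on both sides.\<close>

definition output_index :: "nat \<times> (nat list \<times> nat \<times> nat list) \<times> nat \<Rightarrow> nat \<times> nat list \<times> nat \<times> nat list" where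
  "output_index = (\<lambda>(k, (c, j, ns), p). (k, c @ [p], j, ns))"

text \<open>The transfer function of level \<open>2 k + off\<close> is a partial trace between output level \<open>k\<close> and input level \<open>k + off\<close>.\<close>
definition input_index :: "nat \<Rightarrow> nat \<times> (nat list \<times> nat \<times> nat list) \<times> nat \<Rightarrow> nat \<times> nat list \<times> nat \<times> nat list" where
  "input_index off = (\<lambda>(k, (d, i, ms), p). (k + off, d @ [p], i, ms))"

definition outer_indices :: "nat \<Rightarrow> nat \<Rightarrow> nat \<Rightarrow> nat \<Rightarrow> (nat list \<times> nat \<times> nat list) set" where
  "outer_indices d n R k = idxs R k \<times> {..<d} \<times> idxs n k"

lemma finite_outer_indices [simp]: "finite (outer_indices d n R k)"
  by (simp add: outer_indices_def)

context kernel_family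
begin

text \<open>The singular vectors of the compressed matrix, taken as coefficients of cell functions,
  are orthonormal systems in the two Fock spaces, hence competitors in the supremum defining the
  trace norm. Their pairings through \<open>K\<close> are exactly the singular values, whose sum
  dominates the twisted partial traces.\<close>

lemma partial_traces_le_trace_norm:
  fixes K :: "fock \<Rightarrow> fock"
  assumes K: "\<And>(J :: (nat \<times> (nat list \<times> nat \<times> nat list) \<times> nat) set) \<iota> b k t j ns.
      finite J \<Longrightarrow> \<iota> ` J \<subseteq> cell_indices n n \<Longrightarrow> j < m \<Longrightarrow> ns \<in> idxs n k \<Longrightarrow> t \<in> space (orthant (Suc k)) \<Longrightarrow>
      K (cell_comb r J \<iota> b) k t j ns = (\<Sum>\<beta>\<in>J. b \<beta> * hankel_row r \<Delta> (\<iota> \<beta>) k t j ns)"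
    and w: "\<And>k p. norm (w k p :: complex) \<le> 1"
  shows "ennreal (\<Sum>k<k0. L2_set (\<lambda>(x, y). norm (\<Sum>p<R. w k p *
       of_real (hankel_entry r \<Delta> (output_index (k, x, p)) (input_index off (k, y, p)))))
       (outer_indices m n R k \<times> outer_indices n n R (k + off)))
    \<le> trace_norm_fock n m n K"
proof -
  define I where "I = (SIGMA k:{..<k0}. outer_indices m n R k \<times> {..<R})"
  define J where "J = (SIGMA k:{..<k0}. outer_indices n n R (k + off) \<times> {..<R})"
  define A where "A \<alpha> \<beta> = hankel_entry r \<Delta> (output_index \<alpha>) (input_index off \<beta>)" for \<alpha> \<beta>
  have I: "finite I" "output_index ` I \<subseteq> cell_indices m n" "inj_on output_index I"
    by (auto simp: I_def output_index_def cell_indices_def outer_indices_def length_idxs inj_on_def)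
  have J: "finite J" "input_index off ` J \<subseteq> cell_indices n n" "inj_on (input_index off) J"
    by (auto simp: J_def input_index_def cell_indices_def outer_indices_def length_idxs inj_on_def)
  obtain L \<sigma> a b where \<sigma>: "\<And>r. r < L \<Longrightarrow> \<sigma> r \<ge> 0" and a: "orthonormal_on I L a" and b: "orthonormal_on J L b"
    and A: "\<And>\<alpha> \<beta>. \<alpha> \<in> I \<Longrightarrow> \<beta> \<in> J \<Longrightarrow> A \<alpha> \<beta> = (\<Sum>l<L. \<sigma> l * a l \<alpha> * b l \<beta>)"
    by (rule finite_singular_value_decomposition[OF I(1) J(1), of A]) (rule that)
  let ?e = "\<lambda>l. cell_comb r J (input_index off) (b l)" and ?g = "\<lambda>l. cell_comb r I output_index (a l)"
  have Kp: "cell_integrable r (K (?e l)) (output_index \<alpha>) \<and>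
      cell_pairing r (K (?e l)) (output_index \<alpha>) = (\<Sum>\<beta>\<in>J. b l \<beta> * A \<alpha> \<beta>)" if \<alpha>: "\<alpha> \<in> I" for l \<alpha>
  proof -
    obtain k D j ns where eq: "output_index \<alpha> = (k, D, j, ns)" by (cases "output_index \<alpha>") auto
    have jn: "j < m" "ns \<in> idxs n k" using I(2) \<alpha> eq by (auto simp: cell_indices_def)
    let ?I = "indicator (cell r (Suc k) D) :: _ \<Rightarrow> real"
    let ?f = "\<lambda>\<beta> t. ?I t * hankel_row r \<Delta> (input_index off \<beta>) k t j ns"
    have f: "integrable (orthant (Suc k)) (?f \<beta>)" if "\<beta> \<in> J" for \<beta>
      using cell_integrable_hankel_row[OF _ jn, of "input_index off \<beta>" r D] J(2) that
      by (auto simp: cell_integrable_def)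
    have "has_bochner_integral (orthant (Suc k)) (\<lambda>t. \<Sum>\<beta>\<in>J. b l \<beta> * ?f \<beta> t)
        (\<Sum>\<beta>\<in>J. b l \<beta> * (\<integral>t. ?f \<beta> t \<partial>orthant (Suc k)))"
      using f by (intro has_bochner_integral_sum has_bochner_integral_mult_right) (simp add: has_bochner_integral_iff)
    moreover have "?I t * K (?e l) k t j ns = (\<Sum>\<beta>\<in>J. b l \<beta> * ?f \<beta> t)" if "t \<in> space (orthant (Suc k))" for t
      using K[OF J(1,2) jn that] by (simp add: sum_distrib_left mult_ac)
    ultimately have "has_bochner_integral (orthant (Suc k)) (\<lambda>t. ?I t * K (?e l) k t j ns)
        (\<Sum>\<beta>\<in>J. b l \<beta> * (\<integral>t. ?f \<beta> t \<partial>orthant (Suc k)))"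
      by (subst has_bochner_integral_cong[OF refl _ refl]) auto
    then show ?thesis
      by (simp add: cell_integrable_def cell_pairing_def eq has_bochner_integral_iff A_def hankel_entry_def
          sum_distrib_left mult_ac)
  qed
  have "fock_inner m n (K (?e l)) (?g l) = \<sigma> l" if l: "l < L" for l
  proof -
    have "fock_inner m n (K (?e l)) (?g l) = (\<Sum>\<alpha>\<in>I. a l \<alpha> * (\<Sum>\<beta>\<in>J. b l \<beta> * A \<alpha> \<beta>))"
      using Kp by (subst fock_inner_cell_comb[OF I(1,2)]) auto
    also have "\<dots> = (\<Sum>\<alpha>\<in>I. a l \<alpha> * (\<Sum>\<beta>\<in>J. \<Sum>q<L. \<sigma> q * a q \<alpha> * (b q \<beta> * b l \<beta>)))"
      using A by (intro sum.cong refl arg_cong2[where f = "(*)"]) (simp add: sum_distrib_left mult_ac)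
    also have "\<dots> = (\<Sum>\<alpha>\<in>I. a l \<alpha> * (\<Sum>q<L. \<sigma> q * a q \<alpha> * (\<Sum>\<beta>\<in>J. b q \<beta> * b l \<beta>)))"
      by (subst sum.swap) (simp add: sum_distrib_left)
    also have "\<dots> = (\<Sum>\<alpha>\<in>I. a l \<alpha> * (\<Sum>q<L. if q = l then \<sigma> q * a q \<alpha> else 0))"
      using b l by (intro sum.cong refl arg_cong2[where f = "(*)"]) (auto simp: orthonormal_on_def)
    also have "\<dots> = \<sigma> l * (\<Sum>\<alpha>\<in>I. a l \<alpha> * a l \<alpha>)"
      using l by (simp add: sum_distrib_left mult_ac)
    also have "\<dots> = \<sigma> l" using a l by (simp add: orthonormal_on_def)
    finally show ?thesis .
  qed
  then have tr: "(\<Sum>l<L. \<bar>fock_inner m n (K (?e l)) (?g l)\<bar>) = (\<Sum>l<L. \<sigma> l)"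
    using \<sigma> by (intro sum.cong) auto
  have "(\<Sum>k<k0. L2_set (\<lambda>(x, y). norm (\<Sum>p<R. w k p *
       of_real (hankel_entry r \<Delta> (output_index (k, x, p)) (input_index off (k, y, p)))))
       (outer_indices m n R k \<times> outer_indices n n R (k + off))) \<le> (\<Sum>l<L. \<sigma> l)"
    using twisted_partial_traces_le[where A = A and P = "outer_indices m n R" and Q = "\<lambda>k. outer_indices n n R (k + off)"
        and K = k0 and R = R and w = w and \<sigma> = \<sigma> and a = a and b = b and L = L] w \<sigma> a b A
    by (auto simp: A_def I_def J_def)
  also have "ennreal (\<Sum>l<L. \<sigma> l) \<le> trace_norm_fock n m n K"
    unfolding trace_norm_fock_def tr[symmetric]
    using fock_orthonormal_cell_comb[OF J b] fock_orthonormal_cell_comb[OF I a]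
    by (intro SUP_upper2[where i = "(L, ?e, ?g)"]) auto
  finally show ?thesis by (simp add: ennreal_leI)
qed

end

section \<open>The partial Laplace transform of a kernel\<close>

text \<open>Source of the factor 2 lost for each parity: the merged time is u + u, while the
  transform integrates over the merged time itself.\<close>

lemma integral_half_line_scale:
  fixes f :: "real \<Rightarrow> 'a::{banach, second_countable_topology}"
  shows "(\<integral>u. f (2 * u) \<partial>half_line) = (1 / 2) *\<^sub>R (\<integral>u. f u \<partial>half_line)"
proof -
  have "(\<integral>u. f u \<partial>half_line) = (\<integral>u. indicator {0<..} u *\<^sub>R f u \<partial>lborel)"
    by (subst integral_restrict_space) auto
  also have "\<dots> = 2 *\<^sub>R (\<integral>u. indicator {0<..} (2 * u) *\<^sub>R f (2 * u) \<partial>lborel)"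
    by (subst lborel_integral_real_affine[where c = 2 and t = 0]) auto
  also have "(\<integral>u. indicator {0<..} (2 * u) *\<^sub>R f (2 * u) \<partial>lborel) = (\<integral>u. indicator {0<..} u *\<^sub>R f (2 * u) \<partial>lborel)"
    by (intro Bochner_Integration.integral_cong) (auto split: split_indicator)
  also have "\<dots> = (\<integral>u. f (2 * u) \<partial>half_line)"
    by (subst integral_restrict_space) auto
  finally show ?thesis by simp
qed

definition partial_laplace :: "nat \<Rightarrow> complex \<Rightarrow> ((nat \<Rightarrow> real) \<Rightarrow> real) \<Rightarrow> (nat \<Rightarrow> real) \<Rightarrow> complex" where
  "partial_laplace k z h \<tau> = (\<integral>u. of_real (h (insert_coord k u \<tau>)) * exp (- (z * of_real u)) \<partial>half_line)"

lemma insert_coord_pos: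
  assumes "\<And>l. l < q \<Longrightarrow> 0 < \<tau> l" "0 < u" "l < Suc q" "k \<le> q"
  shows "0 < insert_coord k u \<tau> l"
  using assms(1)[of l] assms(1)[of "l - 1"] assms(2-4) by (cases l) (auto simp: insert_coord_def)

lemma exp_sum_insert_coord:
  fixes z :: complex
  assumes "k \<le> q"
  shows "exp (- (\<Sum>l<Suc q. insert_coord k z w l * of_real (insert_coord k u \<tau> l)))
     = exp (- (z * of_real u)) * exp (- (\<Sum>l<q. w l * of_real (\<tau> l)))"
proof -
  have "exp (- (\<Sum>l<Suc q. insert_coord k z w l * of_real (insert_coord k u \<tau> l)))
     = (\<Prod>l<Suc q. exp (- (insert_coord k z w l * of_real (insert_coord k u \<tau> l))))"
    by (simp add: exp_sum flip: sum_negf del: sum.lessThan_Suc prod.lessThan_Suc)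
  also have "\<dots> = exp (- (z * of_real u)) * (\<Prod>l<q. exp (- (w l * of_real (\<tau> l))))"
    unfolding prod_remove_coord[OF assms]
    by (intro arg_cong2[where f = "(*)"] prod.cong) (auto simp: insert_coord_def)
  also have "(\<Prod>l<q. exp (- (w l * of_real (\<tau> l)))) = exp (- (\<Sum>l<q. w l * of_real (\<tau> l)))"
    by (simp add: exp_sum flip: sum_negf)
  finally show ?thesis .
qed

text \<open>Obtained from the product rule \<open>prod_remove_coord\<close> through the injectivity
  of the real exponential.\<close>

lemma sum_insert_coord:
  fixes \<tau> :: "nat \<Rightarrow> real"
  assumes "k \<le> q"
  shows "(\<Sum>l<Suc q. insert_coord k u \<tau> l) = u + (\<Sum>l<q. \<tau> l)"
proof -
  have "exp (\<Sum>l<Suc q. insert_coord k u \<tau> l) = (\<Prod>l<Suc q. exp (insert_coord k u \<tau> l))"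
    by (simp only: exp_sum finite_lessThan)
  also have "\<dots> = exp u * (\<Prod>l<q. exp (\<tau> l))"
    unfolding prod_remove_coord[OF assms]
    by (intro arg_cong2[where f = "(*)"] prod.cong) (auto simp: insert_coord_def)
  also have "\<dots> = exp (u + (\<Sum>l<q. \<tau> l))"
    by (simp only: exp_add exp_sum finite_lessThan)
  finally show ?thesis by simp
qed

text \<open>The integrand is dominated by a product of decaying exponentials in u and in the outer
  times, the remaining factors having modulus at most 1. Boundary values Re = 0 are included because
  \<open>w = 0\<close> yields integrability of \<open>partial_laplace\<close> itself.\<close>

lemma integrable_partial_laplace_integrand:
  assumes h: "decaying_kernel (Suc q) h" and k: "k \<le> q" and z: "0 \<le> Re z" and w: "\<And>l. l < q \<Longrightarrow> 0 \<le> Re (w l)"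
  shows "integrable (half_line \<Otimes>\<^sub>M orthant q) (\<lambda>(u, \<tau>). of_real (h (insert_coord k u \<tau>)) *
      exp (- (z * of_real u)) * exp (- (\<Sum>l<q. w l * of_real (\<tau> l))))"
proof -
  let ?S = "half_line \<Otimes>\<^sub>M orthant q"
  let ?G = "\<lambda>(u, \<tau>). of_real (h (insert_coord k u \<tau>)) *
      exp (- (z * of_real u)) * exp (- (\<Sum>l<q. w l * of_real (\<tau> l)))"
  obtain D \<nu> where D: "0 \<le> D" "0 < \<nu>"
    "\<And>t. (\<And>l. l < Suc q \<Longrightarrow> 0 < t l) \<Longrightarrow> \<bar>h t\<bar> \<le> D * exp (- \<nu> * (\<Sum>l<Suc q. t l))"
    using decaying_kernelE[OF h] by blast
  have "(\<lambda>x::real. x) \<in> borel_measurable half_line" by (rule borel_measurable_half_line) simp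
  from measurable_compose[OF measurable_fst this]
  have fst_m [measurable]: "(\<lambda>x. fst x) \<in> borel_measurable ?S" .
  have snd_m [measurable]: "(\<lambda>x. snd x l) \<in> borel_measurable ?S" if "l < q" for l
    by (rule measurable_compose[OF measurable_snd borel_measurable_orthant_component[OF that]])
  have hm [measurable]: "(\<lambda>x. h (insert_coord k (fst x) (snd x))) \<in> borel_measurable ?S"
  proof (rule measurable_decaying_kernel[OF h])
    fix l assume l: "l < Suc q"
    consider "l < k" | "l = k" | "k < l" by linarith
    then show "(\<lambda>x. insert_coord k (fst x) (snd x) l) \<in> borel_measurable ?S"
    proof cases
      case 1
      then show ?thesis using snd_m[of l] k by (simp add: insert_coord_def)
    next
      case 2
      then show ?thesis using fst_m by (simp add: insert_coord_def)
    next
      case 3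
      then show ?thesis using snd_m[of "l - 1"] l by (simp add: insert_coord_def)
    qed
    show "0 < insert_coord k (fst x) (snd x) l" if "x \<in> space ?S" for x
      using that l k by (intro insert_coord_pos[of q]) (auto simp: space_pair_measure intro: orthant_pos)
  qed
  have int: "integrable ?S (\<lambda>x. (D * exp (- \<nu> * fst x)) * exp (- \<nu> * (\<Sum>l<q. snd x l)))"
    by (rule integrable_pair_mult[OF sigma_finite_orthant integrable_mult_right[OF integrable_half_line_exp[OF D(2)]]
          integrable_orthant_exp[OF D(2)]])
  show ?thesis
  proof (rule Bochner_Integration.integrable_bound[OF int])
    show "AE x in ?S. norm (?G x) \<le> norm ((D * exp (- \<nu> * fst x)) * exp (- \<nu> * (\<Sum>l<q. snd x l)))"
    proof (rule AE_I2)
      fix x assume x: "x \<in> space ?S"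
      obtain u \<tau> where [simp]: "x = (u, \<tau>)" by (cases x)
      have u: "0 < u" and \<tau>: "\<tau> \<in> space (orthant q)" using x by (auto simp: space_pair_measure)
      have p: "0 < insert_coord k u \<tau> l" if "l < Suc q" for l
        using that k u by (intro insert_coord_pos[of q]) (auto intro: orthant_pos[OF \<tau>])
      have "\<bar>h (insert_coord k u \<tau>)\<bar> \<le> D * exp (- \<nu> * (u + (\<Sum>l<q. \<tau> l)))"
        using D(3)[of "insert_coord k u \<tau>"] p sum_insert_coord[OF k, of u \<tau>] by simp
      also have "\<dots> = D * exp (- \<nu> * u) * exp (- \<nu> * (\<Sum>l<q. \<tau> l))"
        by (simp add: algebra_simps flip: exp_add)
      finally have 1: "\<bar>h (insert_coord k u \<tau>)\<bar> \<le> D * exp (- \<nu> * u) * exp (- \<nu> * (\<Sum>l<q. \<tau> l))" .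
      have 2: "norm (exp (- (z * of_real u))) \<le> 1" using z u by simp
      have 3: "norm (exp (- (\<Sum>l<q. w l * of_real (\<tau> l)))) \<le> 1"
        using w orthant_nonneg[OF \<tau>] by (auto intro!: sum_nonneg)
      have "\<bar>h (insert_coord k u \<tau>)\<bar> * norm (exp (- (z * of_real u)))
          * norm (exp (- (\<Sum>l<q. w l * of_real (\<tau> l)))) \<le> \<bar>h (insert_coord k u \<tau>)\<bar> * 1 * 1"
        using 2 3 by (intro mult_mono) auto
      with 1 D(1) show "norm (?G x) \<le> norm ((D * exp (- \<nu> * fst x)) * exp (- \<nu> * (\<Sum>l<q. snd x l)))"
        by (simp add: norm_mult del: norm_exp_eq_Re)
    qed
  qed (simp add: case_prod_unfold, measurable)
qed

lemma pair_sigma_finite_half_line_orthant: "pair_sigma_finite half_line (orthant q)"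
  by (intro pair_sigma_finite.intro sigma_finite_half_line sigma_finite_orthant)

lemma integrable_partial_laplace:
  assumes "decaying_kernel (Suc q) h" "k \<le> q" "0 \<le> Re z" "\<And>l. l < q \<Longrightarrow> 0 \<le> Re (w l)"
  shows "integrable (orthant q) (\<lambda>\<tau>. partial_laplace k z h \<tau> * exp (- (\<Sum>l<q. w l * of_real (\<tau> l))))"
  using pair_sigma_finite.integrable_snd[OF pair_sigma_finite_half_line_orthant
      integrable_partial_laplace_integrand[OF assms]]
  by (simp add: partial_laplace_def)

text \<open>Fubini along \<open>orthant_Suc_eq_distr\<close>, after
  \<open>exp_sum_insert_coord\<close> has split off the factor of the k-th variable.\<close>

lemma laplace_eq_partial_laplace:
  assumes h: "decaying_kernel (Suc q) h" and k: "k \<le> q" and z: "0 \<le> Re z" and w: "\<And>l. l < q \<Longrightarrow> 0 \<le> Re (w l)"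
  shows "integrable (orthant (Suc q)) (\<lambda>t. of_real (h t) * exp (- (\<Sum>l<Suc q. insert_coord k z w l * of_real (t l))))"
    and "(\<integral>t. of_real (h t) * exp (- (\<Sum>l<Suc q. insert_coord k z w l * of_real (t l))) \<partial>orthant (Suc q))
    = (\<integral>\<tau>. partial_laplace k z h \<tau> * exp (- (\<Sum>l<q. w l * of_real (\<tau> l))) \<partial>orthant q)"
proof -
  let ?F = "\<lambda>(u, \<tau>). restrict (insert_coord k u \<tau>) {..<Suc q}"
  let ?S = "half_line \<Otimes>\<^sub>M orthant q"
  let ?g = "\<lambda>t. of_real (h t) * exp (- (\<Sum>l<Suc q. insert_coord k z w l * of_real (t l)))"
  let ?G = "\<lambda>(u, \<tau>). of_real (h (insert_coord k u \<tau>)) *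
      exp (- (z * of_real u)) * exp (- (\<Sum>l<q. w l * of_real (\<tau> l)))"
  note F = measurable_insert_coord[OF k] and distr = orthant_Suc_eq_distr[OF k]
  have gm: "?g \<in> borel_measurable (orthant (Suc q))"
    using h by (auto simp: decaying_kernel_def intro!: borel_measurable_times borel_measurable_exp borel_measurable_sum
        borel_measurable_uminus simp del: sum.lessThan_Suc)
  have eq: "?g (?F x) = ?G x" if "x \<in> space ?S" for x
  proof -
    obtain u \<tau> where [simp]: "x = (u, \<tau>)" by (cases x)
    have "h (restrict (insert_coord k u \<tau>) {..<Suc q}) = h (insert_coord k u \<tau>)"
      using that k by (intro decaying_kernel_cong[OF h]) (auto simp: space_pair_measure intro!: insert_coord_pos[of q] intro: orthant_pos)
    moreover have "(\<Sum>l<Suc q. insert_coord k z w l * of_real (restrict (insert_coord k u \<tau>) {..<Suc q} l))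
        = (\<Sum>l<Suc q. insert_coord k z w l * of_real (insert_coord k u \<tau> l))"
      by (rule sum.cong) auto
    ultimately show ?thesis by (simp add: exp_sum_insert_coord[OF k] mult.assoc del: sum.lessThan_Suc)
  qed
  have Gi: "integrable ?S ?G" by (rule integrable_partial_laplace_integrand[OF assms])
  then have "integrable ?S (\<lambda>x. ?g (?F x))"
    by (subst Bochner_Integration.integrable_cong[OF refl eq]) auto
  then show "integrable (orthant (Suc q)) ?g"
    by (subst distr, subst integrable_distr_eq[OF F gm]) simp
  have "(\<integral>t. ?g t \<partial>orthant (Suc q)) = (\<integral>x. ?g (?F x) \<partial>?S)"
    by (subst distr) (rule integral_distr[OF F gm])
  also have "\<dots> = (\<integral>x. ?G x \<partial>?S)"
    by (rule Bochner_Integration.integral_cong[OF refl eq])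
  also have "\<dots> = (\<integral>\<tau>. \<integral>u. ?G (u, \<tau>) \<partial>half_line \<partial>orthant q)"
    using pair_sigma_finite.integral_snd[OF pair_sigma_finite_half_line_orthant Gi] by simp
  also have "\<dots> = (\<integral>\<tau>. partial_laplace k z h \<tau> * exp (- (\<Sum>l<q. w l * of_real (\<tau> l))) \<partial>orthant q)"
    by (simp add: partial_laplace_def)
  finally show "(\<integral>t. ?g t \<partial>orthant (Suc q)) = \<dots>" .
qed

lemma measurable_fourier:
  fixes f :: "(nat \<Rightarrow> real) \<Rightarrow> complex"
  assumes [measurable]: "f \<in> borel_measurable (orthant q)"
  shows "(\<lambda>y. \<integral>t. f t * iexp (- (\<Sum>l<q. y l * t l)) \<partial>orthant q) \<in> borel_measurable (PiM {..<q} (\<lambda>_. lborel))"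
proof -
  interpret sigma_finite_measure "orthant q" by (rule sigma_finite_orthant)
  have [measurable]: "(\<lambda>y. y l) \<in> borel_measurable (PiM {..<q} (\<lambda>_. lborel :: real measure))" if "l < q" for l
    using that measurable_component_singleton[of l "{..<q}" "\<lambda>_. lborel :: real measure"] by simp
  show ?thesis by (rule borel_measurable_lebesgue_integral) measurable
qed

text \<open>Plancherel for the partial Laplace transform damped by exp(-<x, tau>). The damping has
  modulus at most 1, so the bound is the same for all \<open>x\<close>, which settles the supremum
  over \<open>x\<close> in the Hardy norm.\<close>

lemma nn_integral_laplace_le:
  assumes h: "decaying_kernel (Suc q) h" and k: "k \<le> q" and z: "0 \<le> Re z" and x: "\<And>l. l < q \<Longrightarrow> 0 \<le> x l"
  defines "G \<equiv> \<lambda>y. \<integral>t. of_real (h t) * exp (- (\<Sum>l<Suc q. insert_coord k z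
      (\<lambda>l. of_real (x l) + \<i> * of_real (y l)) l * of_real (t l))) \<partial>orthant (Suc q)"
  shows "(\<lambda>y. (cmod (G y))\<^sup>2) \<in> borel_measurable (PiM {..<q} (\<lambda>_. lborel))"
    and "(\<integral>\<^sup>+y. ennreal ((cmod (G y))\<^sup>2) \<partial>PiM {..<q} (\<lambda>_. lborel))
      \<le> ennreal ((2 * pi) ^ q) * (\<integral>\<^sup>+\<tau>. ennreal ((cmod (partial_laplace k z h \<tau>))\<^sup>2) \<partial>orthant q)"
proof -
  define f where "f \<tau> = partial_laplace k z h \<tau> * exp (- (\<Sum>l<q. of_real (x l) * of_real (\<tau> l)))" for \<tau>
  have fi: "integrable (orthant q) f"
    unfolding f_def by (rule integrable_partial_laplace[OF h k z]) (use x in simp)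
  have G: "G = (\<lambda>y. \<integral>t. f t * iexp (- (\<Sum>l<q. y l * t l)) \<partial>orthant q)"
  proof
    fix y
    have "G y = (\<integral>\<tau>. partial_laplace k z h \<tau> *
        exp (- (\<Sum>l<q. (of_real (x l) + \<i> * of_real (y l)) * of_real (\<tau> l))) \<partial>orthant q)"
      unfolding G_def by (rule laplace_eq_partial_laplace(2)[OF h k z]) (use x in simp)
    also have "\<dots> = (\<integral>t. f t * iexp (- (\<Sum>l<q. y l * t l)) \<partial>orthant q)"
      by (simp add: f_def mult.assoc flip: exp_add)
        (simp add: algebra_simps sum.distrib sum_distrib_left)
    finally show "G y = (\<integral>t. f t * iexp (- (\<Sum>l<q. y l * t l)) \<partial>orthant q)" .
  qed
  show "(\<lambda>y. (cmod (G y))\<^sup>2) \<in> borel_measurable (PiM {..<q} (\<lambda>_. lborel))"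
    using measurable_fourier[of f q] fi by (simp add: G)
  have "(\<integral>\<^sup>+y. ennreal ((cmod (G y))\<^sup>2) \<partial>PiM {..<q} (\<lambda>_. lborel))
     \<le> ennreal ((2 * pi) ^ q) * (\<integral>\<^sup>+\<tau>. ennreal ((cmod (f \<tau>))\<^sup>2) \<partial>orthant q)"
    unfolding G by (rule plancherel_le[OF fi])
  also have "\<dots> \<le> ennreal ((2 * pi) ^ q) * (\<integral>\<^sup>+\<tau>. ennreal ((cmod (partial_laplace k z h \<tau>))\<^sup>2) \<partial>orthant q)"
  proof (intro mult_left_mono nn_integral_mono ennreal_leI power_mono)
    fix \<tau> assume \<tau>: "\<tau> \<in> space (orthant q)"
    have "norm (exp (- (\<Sum>l<q. complex_of_real (x l) * of_real (\<tau> l)))) \<le> 1"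
      using x orthant_nonneg[OF \<tau>] by (auto intro!: sum_nonneg)
    then show "cmod (f \<tau>) \<le> cmod (partial_laplace k z h \<tau>)"
      by (simp add: f_def norm_mult mult_left_le del: norm_exp_eq_Re)
  qed auto
  finally show "(\<integral>\<^sup>+y. ennreal ((cmod (G y))\<^sup>2) \<partial>PiM {..<q} (\<lambda>_. lborel))
      \<le> ennreal ((2 * pi) ^ q) * (\<integral>\<^sup>+\<tau>. ennreal ((cmod (partial_laplace k z h \<tau>))\<^sup>2) \<partial>orthant q)" .
qed

section \<open>Refining the cells\<close>

definition cells :: "nat \<Rightarrow> nat \<Rightarrow> (nat \<Rightarrow> real) \<Rightarrow> nat list" where
  "cells r q \<tau> = map (\<lambda>l. cell_index r (\<tau> l)) [0..<q]"

text \<open>The outer times stay within one mesh width of \<open>\<tau>\<close>. The merged time is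
  a sum of two times in the cell of \<open>u\<close>, so it is near \<open>2 * u\<close> with twice
  that error.\<close>

lemma hankel_times_close:
  assumes \<tau>: "\<tau> \<in> space (orthant (k + L))" and u: "0 < u" and l: "l < Suc (k + L)"
    and t: "t \<in> cell r (Suc k) (take k (cells r (k + L) \<tau>) @ [cell_index r u])"
    and s: "s \<in> cell r (Suc L) (rev (drop k (cells r (k + L) \<tau>)) @ [cell_index r u])"
  shows "\<bar>hankel_times k L t s l - insert_coord k (2 * u) \<tau> l\<bar> \<le> 2 / real (Suc r)"
proof -
  have ts: "t \<in> space (orthant (Suc k))" "s \<in> space (orthant (Suc L))" using t s by (auto simp: cell_def)
  have half: "1 / real (Suc r) \<le> 2 / real (Suc r)" by (simp add: divide_right_mono)
  consider "l < k" | "l = k" | "k < l" by linarith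
  then show ?thesis
  proof cases
    case 1
    then have "cell_index r (t l) = cell_index r (\<tau> l)"
      using t by (auto simp: cell_def cells_def nth_append)
    then have "\<bar>t l - \<tau> l\<bar> \<le> 1 / real (Suc r)"
      using 1 by (intro cell_index_close orthant_pos[OF ts(1)] orthant_pos[OF \<tau>]) auto
    then show ?thesis using 1 half by (simp add: hankel_times_def insert_coord_def del: of_nat_Suc)
  next
    case 2
    have "cell_index r (t k) = cell_index r u" "cell_index r (s L) = cell_index r u"
      using t s by (auto simp: cell_def cells_def nth_append)
    then have "\<bar>t k - u\<bar> \<le> 1 / real (Suc r)" "\<bar>s L - u\<bar> \<le> 1 / real (Suc r)"
      using u by (simp_all only: cell_index_close orthant_pos[OF ts(1)] orthant_pos[OF ts(2)] lessI)
    then show ?thesis using 2 by (simp add: hankel_times_def insert_coord_def del: of_nat_Suc)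
  next
    case 3
    have "cell_index r (s (k + L - l)) = cell_index r (\<tau> (l - 1))"
    proof -
      have "k + L - l < L" using 3 l by linarith
      then have "cell_index r (s (k + L - l)) = rev (drop k (cells r (k + L) \<tau>)) ! (k + L - l)"
        using s by (auto simp: cell_def cells_def nth_append)
      also have "\<dots> = drop k (cells r (k + L) \<tau>) ! (L - Suc (k + L - l))"
        using \<open>k + L - l < L\<close> by (subst rev_nth) (auto simp: cells_def)
      also have "\<dots> = cells r (k + L) \<tau> ! (l - 1)"
        using 3 l by (subst nth_drop) (auto simp: cells_def intro!: arg_cong[where f = "(!) _"])
      finally show ?thesis using 3 l by (simp add: cells_def)
    qed
    then have "\<bar>s (k + L - l) - \<tau> (l - 1)\<bar> \<le> 1 / real (Suc r)"
      using 3 l by (intro cell_index_close orthant_pos[OF ts(2)] orthant_pos[OF \<tau>]) auto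
    then show ?thesis using 3 half by (simp add: hankel_times_def insert_coord_def del: of_nat_Suc)
  qed
qed

text \<open>(r+1)^2 intervals of length 1/(r+1) cover the times below r+1, so the cut-off (r+1)^2
  exhausts the half line while the mesh shrinks.\<close>

lemma eventually_cell_index_less:
  assumes u: "0 < u"
  shows "\<forall>\<^sub>F r in sequentially. cell_index r u < (Suc r)\<^sup>2"
proof (rule eventually_sequentiallyI)
  fix r assume "nat \<lceil>u\<rceil> \<le> r"
  then have "u < real (Suc r)" by linarith
  have "real (cell_index r u) \<le> u * real (Suc r)"
    using cell_index_bounds(1)[OF u, of r] by (simp add: pos_divide_le_eq)
  also have "\<dots> < real (Suc r) * real (Suc r)"
    using \<open>u < real (Suc r)\<close> by (intro mult_strict_right_mono) auto
  also have "\<dots> = real ((Suc r)\<^sup>2)" by (simp only: power2_eq_square of_nat_mult)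
  finally show "cell_index r u < (Suc r)\<^sup>2" by (simp only: of_nat_less_iff)
qed

lemma length_cells [simp]: "length (cells r q \<tau>) = q"
  by (simp add: cells_def)

context kernel_family
begin

text \<open>Normalised indicators make an entry the kernel mean times the roots of the two volumes.
  Undoing these roots leaves the mean over a product of two cubes, estimated first in
  \<open>s\<close>, then in \<open>t\<close>.\<close>

lemma hankel_entry_close:
  assumes j: "j < m" "i < n" and ns: "ns \<in> idxs n k" "ms \<in> idxs n L" and len: "length D = Suc L"
    and close: "\<And>t s. t \<in> cell r (Suc k) C \<Longrightarrow> s \<in> cell r (Suc L) D \<Longrightarrow>
      \<bar>\<Delta> j (ns @ rev ms) i (hankel_times k L t s) - c\<bar> \<le> \<epsilon>"
  shows "\<bar>sqrt (real (Suc r) ^ Suc k) * sqrt (real (Suc r) ^ Suc L) *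
      hankel_entry r \<Delta> (k, C, j, ns) (L, D, i, ms) - c\<bar> \<le> \<epsilon>"
proof -
  let ?a = "real (Suc r) ^ Suc k" and ?b = "real (Suc r) ^ Suc L"
  let ?row = "\<lambda>t. hankel_row r \<Delta> (L, D, i, ms) k t j ns"
  have sq: "sqrt ?a * sqrt ?a = ?a" "sqrt ?b * sqrt ?b = ?b"
    by (rule real_sqrt_mult_self[THEN trans], simp)+
  have ci: "(L, D, i, ms) \<in> cell_indices n n" using j ns len by (simp add: cell_indices_def)
  have "\<bar>sqrt ?b * ?row t - c\<bar> \<le> \<epsilon>" if t: "t \<in> cell r (Suc k) C" for t
  proof -
    have ts: "t \<in> space (orthant (Suc k))" using t by (simp add: cell_def)
    have "sqrt ?b * ?row t = ?b * (\<integral>s. indicator (cell r (Suc L) D) s *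
        \<Delta> j (ns @ rev ms) i (hankel_times k L t s) \<partial>orthant (Suc L))"
      unfolding hankel_row_def prod.case mult.assoc[symmetric] sq ..
    with integral_cell_close(2)[OF measurable_hankel_kernel_snd[OF j ns ts] close[OF t]]
    show ?thesis by simp
  qed
  then have "\<bar>?a * (\<integral>t. indicator (cell r (Suc k) C) t * (sqrt ?b * ?row t) \<partial>orthant (Suc k)) - c\<bar> \<le> \<epsilon>"
    by (intro integral_cell_close(2) borel_measurable_times measurable_hankel_row[OF ci j(1) ns(1)]) auto
  also have "(\<integral>t. indicator (cell r (Suc k) C) t * (sqrt ?b * ?row t) \<partial>orthant (Suc k))
      = sqrt ?b * (\<integral>t. indicator (cell r (Suc k) C) t * ?row t \<partial>orthant (Suc k))"
    by (simp only: mult.left_commute[of _ "sqrt ?b"] integral_mult_right_zero)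
  also have "?a * (sqrt ?b * (\<integral>t. indicator (cell r (Suc k) C) t * ?row t \<partial>orthant (Suc k)))
      = sqrt ?a * sqrt ?b * hankel_entry r \<Delta> (k, C, j, ns) (L, D, i, ms)"
    unfolding hankel_entry_def cell_pairing_def prod.case real_scaleR_def
    by (subst sq(1)[symmetric]) (simp only: mult_ac)
  finally show ?thesis .
qed

text \<open>The weight exp(-2 z s) of the partial trace, sampled at the left end p/(r+1) of the
  middle cell.\<close>

definition twist :: "nat \<Rightarrow> complex \<Rightarrow> nat \<Rightarrow> complex" where
  "twist r z p = exp (- (2 * z * of_real (real p / real (Suc r))))"

text \<open>\<open>E\<close> and \<open>ns\<close> list the outer cells and operator indices in the
  order of the merged kernel: the first \<open>k\<close> belong to the output side, the others, read
  backwards, to the input side. The middle cell \<open>p\<close> is appended to both.\<close>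

definition twisted_trace :: "nat \<Rightarrow> complex \<Rightarrow> nat \<Rightarrow> nat \<Rightarrow> nat \<Rightarrow> nat list \<Rightarrow> nat \<Rightarrow> nat list \<Rightarrow> nat \<Rightarrow> complex" where
  "twisted_trace r z k L R E j ns i = (\<Sum>p<R. twist r z p * of_real (hankel_entry r \<Delta>
     (k, take k E @ [p], j, take k ns) (L, rev (drop k E) @ [p], i, rev (drop k ns))))"

text \<open>Of the normalisation for k + L + 2 time variables, the two middle ones account for a
  factor r+1, which is used up as the inverse step length of a Riemann sum in \<open>u\<close>.
  Dominated convergence then gives the integral of the kernel at merged time 2 u, and the
  substitution produces 1/2.\<close>

lemma twisted_trace_tendsto:
  assumes j: "j < m" "i < n" "ns \<in> idxs n (k + L)" and \<tau>: "\<tau> \<in> space (orthant (k + L))" and z: "0 < Re z"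
  shows "(\<lambda>r. of_real (sqrt (real (Suc r) ^ (k + L))) * twisted_trace r z k L ((Suc r)\<^sup>2) (cells r (k + L) \<tau>) j ns i)
    \<longlonglongrightarrow> (1 / 2) *\<^sub>R partial_laplace k z (\<Delta> j ns i) \<tau>"
proof -
  let ?q = "k + L" and ?h = "\<Delta> j ns i"
  note h = decaying[OF j]
  obtain D a where D: "0 \<le> D" "0 < a"
    "\<And>t. (\<And>l. l < Suc ?q \<Longrightarrow> 0 < t l) \<Longrightarrow> \<bar>?h t\<bar> \<le> D * exp (- a * (\<Sum>l<Suc ?q. t l))"
    using decaying_kernelE[OF h] by blast
  have ns: "take k ns \<in> idxs n k" "rev (drop k ns) \<in> idxs n L" "take k ns @ rev (rev (drop k ns)) = ns"
    using j(3) set_take_subset[of k ns] set_drop_subset[of k ns] by (auto simp: idxs_def)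
  define B where "B r p = sqrt (real (Suc r) ^ Suc k) * sqrt (real (Suc r) ^ Suc L) * hankel_entry r \<Delta>
     (k, take k (cells r ?q \<tau>) @ [p], j, take k ns) (L, rev (drop k (cells r ?q \<tau>)) @ [p], i, rev (drop k ns))" for r p
  have Bclose: "\<bar>B r (cell_index r u) - c\<bar> \<le> \<epsilon>"
    if "\<And>t s. t \<in> cell r (Suc k) (take k (cells r ?q \<tau>) @ [cell_index r u]) \<Longrightarrow>
       s \<in> cell r (Suc L) (rev (drop k (cells r ?q \<tau>)) @ [cell_index r u]) \<Longrightarrow>
       \<bar>?h (hankel_times k L t s) - c\<bar> \<le> \<epsilon>" for r u c \<epsilon>
    unfolding B_def by (rule hankel_entry_close[OF j(1,2) ns(1,2)]) (use that ns(3) in auto)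
  \<comment> \<open>Step functions in the middle variable, set to 0 beyond the cut-off; their
    integrals are the scaled twisted traces.\<close>
  define g where "g r u = (if cell_index r u < (Suc r)\<^sup>2 then twist r z (cell_index r u) * of_real (B r (cell_index r u)) else 0)"
    for r u
  define g0 where "g0 u = of_real (?h (insert_coord k (2 * u) \<tau>)) * exp (- (z * of_real (2 * u)))" for u
  have lim: "(\<lambda>r. g r u) \<longlonglongrightarrow> g0 u" if u: "0 < u" for u
  proof -
    have inv: "(\<lambda>r. 1 / real (Suc r)) \<longlonglongrightarrow> 0"
      using LIMSEQ_inverse_real_of_nat by (simp add: inverse_eq_divide)
    have "(\<lambda>r. B r (cell_index r u)) \<longlonglongrightarrow> ?h (insert_coord k (2 * u) \<tau>)"
    proof (rule LIMSEQ_I)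
      fix \<epsilon> :: real assume \<epsilon>: "0 < \<epsilon>"
      have ip: "0 < insert_coord k (2 * u) \<tau> l" if "l < Suc ?q" for l
        using that u by (intro insert_coord_pos[of ?q]) (auto intro: orthant_pos[OF \<tau>])
      obtain \<delta> where \<delta>: "0 < \<delta>" "\<And>t'. (\<And>l. l < Suc ?q \<Longrightarrow> 0 < t' l) \<Longrightarrow>
        (\<And>l. l < Suc ?q \<Longrightarrow> \<bar>t' l - insert_coord k (2 * u) \<tau> l\<bar> < \<delta>) \<Longrightarrow>
          \<bar>?h t' - ?h (insert_coord k (2 * u) \<tau>)\<bar> < \<epsilon> / 2"
        by (rule decaying_kernel_continuous[OF h ip half_gt_zero[OF \<epsilon>]]) blast+
      obtain r0 where r0: "\<And>r. r0 \<le> r \<Longrightarrow> 1 / real (Suc r) < \<delta> / 2"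
        using LIMSEQ_D[OF inv, of "\<delta> / 2"] \<delta>(1) by auto
      have "norm (B r (cell_index r u) - ?h (insert_coord k (2 * u) \<tau>)) < \<epsilon>" if r: "r0 \<le> r" for r
      proof -
        have "\<bar>B r (cell_index r u) - ?h (insert_coord k (2 * u) \<tau>)\<bar> \<le> \<epsilon> / 2"
        proof (rule Bclose, rule less_imp_le, rule \<delta>(2))
          fix t s l assume t: "t \<in> cell r (Suc k) (take k (cells r ?q \<tau>) @ [cell_index r u])"
            and s: "s \<in> cell r (Suc L) (rev (drop k (cells r ?q \<tau>)) @ [cell_index r u])" and l: "l < Suc ?q"
          show "0 < hankel_times k L t s l"
            using t s l by (intro hankel_times_pos) (auto simp: cell_def)
          show "\<bar>hankel_times k L t s l - insert_coord k (2 * u) \<tau> l\<bar> < \<delta>"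
            using hankel_times_close[OF \<tau> u l t s] r0[OF r] by simp
        qed
        then show ?thesis using \<epsilon> by simp
      qed
      then show "\<exists>r0. \<forall>r\<ge>r0. norm (B r (cell_index r u) - ?h (insert_coord k (2 * u) \<tau>)) < \<epsilon>" by blast
    qed
    moreover have "(\<lambda>r. real (cell_index r u) / real (Suc r)) \<longlonglongrightarrow> u"
    proof (rule real_tendsto_sandwich[OF _ _ _ tendsto_const])
      show "(\<lambda>r. u - 1 / real (Suc r)) \<longlonglongrightarrow> u" using tendsto_diff[OF tendsto_const inv, of u] by simp
    qed (use cell_index_bounds[OF u] in \<open>auto intro!: always_eventually less_imp_le simp: add_divide_distrib algebra_simps\<close>)
    ultimately have "(\<lambda>r. twist r z (cell_index r u) * of_real (B r (cell_index r u)))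
        \<longlonglongrightarrow> exp (- (2 * z * of_real u)) * of_real (?h (insert_coord k (2 * u) \<tau>))"
      unfolding twist_def by (intro tendsto_intros)
    moreover have "\<forall>\<^sub>F r in sequentially. twist r z (cell_index r u) * of_real (B r (cell_index r u)) = g r u"
      using eventually_cell_index_less[OF u] by eventually_elim (simp add: g_def)
    ultimately have "(\<lambda>r. g r u) \<longlonglongrightarrow> exp (- (2 * z * of_real u)) * of_real (?h (insert_coord k (2 * u) \<tau>))"
      by (rule Lim_transform_eventually)
    then show ?thesis by (simp add: g0_def mult_ac)
  qed
  have bound: "norm (g r u) \<le> D * exp (2 * a) * exp (- (2 * a) * u)" if u: "0 < u" for r u
  proof -
    have "\<bar>B r (cell_index r u) - 0\<bar> \<le> D * exp (2 * a) * exp (- (2 * a) * u)"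
    proof (rule Bclose)
      fix t s assume t: "t \<in> cell r (Suc k) (take k (cells r ?q \<tau>) @ [cell_index r u])"
        and s: "s \<in> cell r (Suc L) (rev (drop k (cells r ?q \<tau>)) @ [cell_index r u])"
      have pos: "0 < hankel_times k L t s l" if "l < Suc ?q" for l
        using t s that by (intro hankel_times_pos) (auto simp: cell_def)
      have "2 * u - 2 / real (Suc r) \<le> hankel_times k L t s k"
        using hankel_times_close[OF \<tau> u _ t s, of k] by (simp add: insert_coord_def)
      \<comment> \<open>The merged time falls short of 2 u by at most 2, even on the coarsest mesh.
        This is the origin of the factor exp(2 a) in the majorant, which must not depend on
        \<open>r\<close>.\<close>
      moreover have "2 / real (Suc r) \<le> 2" by (simp add: pos_divide_le_eq)
      moreover have "hankel_times k L t s k \<le> (\<Sum>l<Suc ?q. hankel_times k L t s l)"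
        using pos by (intro member_le_sum) (auto intro: less_imp_le)
      ultimately have "2 * u - 2 \<le> (\<Sum>l<Suc ?q. hankel_times k L t s l)" by linarith
      then have "a * (2 * u - 2) \<le> a * (\<Sum>l<Suc ?q. hankel_times k L t s l)"
        using D(2) by (intro mult_left_mono) auto
      then have "exp (- a * (\<Sum>l<Suc ?q. hankel_times k L t s l)) \<le> exp (2 * a) * exp (- (2 * a) * u)"
        by (simp add: algebra_simps flip: exp_add)
      then have "D * exp (- a * (\<Sum>l<Suc ?q. hankel_times k L t s l)) \<le> D * (exp (2 * a) * exp (- (2 * a) * u))"
        using D(1) by (rule mult_left_mono)
      then show "\<bar>?h (hankel_times k L t s) - 0\<bar> \<le> D * exp (2 * a) * exp (- (2 * a) * u)"
        using D(3)[of "hankel_times k L t s"] pos by (simp add: mult.assoc)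
    qed
    moreover have "norm (twist r z (cell_index r u)) \<le> 1"
      using z by (simp add: twist_def)
    ultimately show ?thesis
      using D(1) by (auto simp: g_def norm_mult intro: order_trans[OF mult_left_le_one_le])
  qed
  have gint: "integrable half_line (g r)"
    and gval: "(\<integral>u. g r u \<partial>half_line) = of_real (sqrt (real (Suc r) ^ ?q)) *
       twisted_trace r z k L ((Suc r)\<^sup>2) (cells r ?q \<tau>) j ns i" for r
  proof -
    show "integrable half_line (g r)"
      unfolding g_def by (rule integral_half_line_step(1))
    have sq: "sqrt (real (Suc r) ^ Suc k) * sqrt (real (Suc r) ^ Suc L) = real (Suc r) * sqrt (real (Suc r) ^ ?q)"
    proof -
      have "real (Suc r) ^ Suc k * real (Suc r) ^ Suc L = (real (Suc r))\<^sup>2 * real (Suc r) ^ ?q"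
        by (simp add: power2_eq_square power_add mult_ac del: of_nat_Suc)
      then show ?thesis by (simp only: real_sqrt_mult[symmetric]) (simp add: real_sqrt_mult)
    qed
    have "(\<integral>u. g r u \<partial>half_line) = (\<Sum>p<(Suc r)\<^sup>2. (twist r z p * of_real (B r p)) /\<^sub>R real (Suc r))"
      unfolding g_def by (rule integral_half_line_step(2))
    also have "\<dots> = of_real (sqrt (real (Suc r) ^ ?q)) * twisted_trace r z k L ((Suc r)\<^sup>2) (cells r ?q \<tau>) j ns i"
      unfolding twisted_trace_def sum_distrib_left B_def sq
      by (intro sum.cong refl) (simp add: scaleR_conv_of_real field_simps del: of_nat_Suc)
    finally show "(\<integral>u. g r u \<partial>half_line) = \<dots>" .
  qed
  have "(\<lambda>r. \<integral>u. g r u \<partial>half_line) \<longlonglongrightarrow> (\<integral>u. g0 u \<partial>half_line)"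
  proof (rule integral_dominated_convergence[where w = "\<lambda>u. D * exp (2 * a) * exp (- (2 * a) * u)"])
    show gm: "g r \<in> borel_measurable half_line" for r using gint[of r] by auto
    show "g0 \<in> borel_measurable half_line"
      by (rule borel_measurable_LIMSEQ_metric[OF gm lim]) simp
    show "integrable half_line (\<lambda>u. D * exp (2 * a) * exp (- (2 * a) * u))"
      using D(2) by (intro integrable_mult_right integrable_half_line_exp) simp
    show "AE u in half_line. (\<lambda>r. g r u) \<longlonglongrightarrow> g0 u" using lim by (intro AE_I2) simp
    show "AE u in half_line. norm (g r u) \<le> D * exp (2 * a) * exp (- (2 * a) * u)" for r
      using bound by (intro AE_I2) simp
  qed
  also have "(\<integral>u. g0 u \<partial>half_line) = (1 / 2) *\<^sub>R partial_laplace k z ?h \<tau>"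
    unfolding g0_def partial_laplace_def by (rule integral_half_line_scale)
  finally show ?thesis by (simp only: gval)
qed

end

lemma sum_le_if_lower_approximations:
  fixes f :: "nat \<Rightarrow> ennreal"
  assumes "\<And>c. (\<And>k. k < K \<Longrightarrow> c k = 0 \<or> 0 < c k \<and> ennreal (c k) < f k) \<Longrightarrow> ennreal (\<Sum>k<K. c k) \<le> B"
  shows "(\<Sum>k<K. f k) \<le> B"
proof -
  have "(\<Sum>k<K. f k) + ennreal a \<le> B"
    if "0 \<le> a" "\<And>c. (\<And>k. k < K \<Longrightarrow> c k = 0 \<or> 0 < c k \<and> ennreal (c k) < f k) \<Longrightarrow> ennreal ((\<Sum>k<K. c k) + a) \<le> B"
    for a
    using that
  proof (induction K arbitrary: a)
    case 0
    then show ?case by auto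
  next
    case (Suc K)
    let ?y = "(\<Sum>k<K. f k) + ennreal a"
    have step: "(\<Sum>k<K. f k) + ennreal (a + x) \<le> B" if x: "x = 0 \<or> 0 < x \<and> ennreal x < f K" for x
    proof (rule Suc.IH)
      show "0 \<le> a + x" using x Suc.prems(1) by auto
      fix c assume c: "\<And>k. k < K \<Longrightarrow> c k = 0 \<or> 0 < c k \<and> ennreal (c k) < f k"
      have "ennreal ((\<Sum>k<Suc K. (c(K := x)) k) + a) \<le> B"
        by (rule Suc.prems(2)) (use c x in \<open>auto simp: less_Suc_eq\<close>)
      then show "ennreal ((\<Sum>k<K. c k) + (a + x)) \<le> B" by (simp add: add_ac)
    qed
    have y: "?y \<le> B" using step[of 0] by simp
    show ?case
    proof (cases "?y = \<infinity>")
      case True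
      then have "B = \<infinity>" using y by (metis infinity_ennreal_def top_unique)
      then show ?thesis by simp
    next
      case False
      have "f K \<le> B - ?y"
      proof (rule dense_le)
        fix e assume e: "e < f K"
        then obtain x where x: "e = ennreal x" "0 \<le> x" by (cases e) auto
        then have "(\<Sum>k<K. f k) + ennreal (a + x) \<le> B" using e by (intro step) auto
        then have "e + ?y \<le> B" using x Suc.prems(1) by (simp add: ennreal_plus add_ac)
        then show "e \<le> B - ?y" by (simp add: ennreal_le_minus_iff)
      qed
      then have "f K + ?y \<le> B - ?y + ?y" by (rule add_right_mono)
      also have "\<dots> = B" using y False by (simp add: diff_add_cancel_ennreal)
      finally show ?thesis by (simp add: add_ac)
    qed
  qed
  from this[of 0] assms show ?thesis by simp
qed

lemma ensqrt_mult:
  assumes a: "0 < a"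
  shows "ensqrt (ennreal a * e) = ennreal (sqrt a) * ensqrt e"
proof (cases e)
  case (real x)
  then show ?thesis using a by (simp add: ensqrt_def real_sqrt_mult flip: ennreal_mult)
qed (use a in \<open>simp add: ensqrt_def ennreal_mult_eq_top_iff\<close>)

lemma nn_integral_triple_sum:
  assumes "\<And>a b c. a \<in> A \<Longrightarrow> b \<in> B \<Longrightarrow> c \<in> S \<Longrightarrow> f a b c \<in> borel_measurable M"
  shows "(\<integral>\<^sup>+x. (\<Sum>a\<in>A. \<Sum>b\<in>B. \<Sum>c\<in>S. f a b c x) \<partial>M) = (\<Sum>a\<in>A. \<Sum>b\<in>B. \<Sum>c\<in>S. \<integral>\<^sup>+x. f a b c x \<partial>M)"
proof -
  have "(\<integral>\<^sup>+x. (\<Sum>a\<in>A. \<Sum>b\<in>B. \<Sum>c\<in>S. f a b c x) \<partial>M) = (\<Sum>a\<in>A. \<integral>\<^sup>+x. (\<Sum>b\<in>B. \<Sum>c\<in>S. f a b c x) \<partial>M)"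
    by (rule nn_integral_sum) (intro borel_measurable_sum assms)
  also have "\<dots> = (\<Sum>a\<in>A. \<Sum>b\<in>B. \<integral>\<^sup>+x. (\<Sum>c\<in>S. f a b c x) \<partial>M)"
    by (intro sum.cong refl nn_integral_sum borel_measurable_sum assms)
  also have "\<dots> = (\<Sum>a\<in>A. \<Sum>b\<in>B. \<Sum>c\<in>S. \<integral>\<^sup>+x. f a b c x \<partial>M)"
    by (intro sum.cong refl nn_integral_sum assms)
  finally show ?thesis .
qed

lemma ensqrt_mono: "a \<le> b \<Longrightarrow> ensqrt a \<le> ensqrt b"
  by (auto simp: ensqrt_def top_unique less_top intro!: ennreal_leI enn2real_mono)

lemma less_ensqrtD:
  assumes "0 \<le> c" "ennreal c < ensqrt e"
  shows "ennreal (c\<^sup>2) < e"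
proof (cases e)
  case (real x)
  then have "c < sqrt x" using assms by (simp add: ensqrt_def ennreal_less_iff)
  then have "c\<^sup>2 < (sqrt x)\<^sup>2" using assms(1) by (intro power_strict_mono) auto
  then show ?thesis using real by (simp add: ennreal_less_iff)
qed simp

section \<open>Hardy norms, outer energies and partial traces\<close>

context kernel_family
begin

definition energy :: "nat \<Rightarrow> nat \<Rightarrow> complex \<Rightarrow> (nat \<Rightarrow> real) \<Rightarrow> real" where
  "energy q k z \<tau> = (\<Sum>j<m. \<Sum>ns\<in>idxs n q. \<Sum>i<n. (cmod (partial_laplace k z (\<Delta> j ns i) \<tau>))\<^sup>2)"

text \<open>Counterpart of \<open>dG_sq\<close> for a single kernel family, with the difference
  taken under the integral.\<close>

definition laplace_sq :: "nat \<Rightarrow> (nat \<Rightarrow> complex) \<Rightarrow> real" where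
  "laplace_sq q s = (\<Sum>j<m. \<Sum>ns\<in>idxs n q. \<Sum>i<n.
     (cmod (\<integral>t. of_real (\<Delta> j ns i t) * exp (- (\<Sum>l<Suc q. s l * of_real (t l))) \<partial>orthant (Suc q)))\<^sup>2)"

lemma measurable_partial_laplace:
  assumes "j < m" "i < n" "ns \<in> idxs n q" "k \<le> q" "0 \<le> Re z"
  shows "partial_laplace k z (\<Delta> j ns i) \<in> borel_measurable (orthant q)"
  using borel_measurable_integrable[OF integrable_partial_laplace[OF decaying[OF assms(1-3)] assms(4,5), of "\<lambda>_. 0"]]
  by simp

lemma measurable_energy:
  assumes "k \<le> q" "0 \<le> Re z"
  shows "energy q k z \<in> borel_measurable (orthant q)"
proof -
  have "(\<lambda>\<tau>. (cmod (partial_laplace k z (\<Delta> j ns i) \<tau>))\<^sup>2) \<in> borel_measurable (orthant q)"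
    if "j \<in> {..<m}" "ns \<in> idxs n q" "i \<in> {..<n}" for j ns i
    using measurable_partial_laplace[of j i ns q k z] that assms by simp
  then show ?thesis unfolding energy_def by (intro borel_measurable_sum)
qed

lemma nn_integral_laplace_sq_le:
  assumes k: "k \<le> q" and z: "0 \<le> Re z" and x: "\<And>l. l < q \<Longrightarrow> 0 \<le> x l"
  shows "(\<integral>\<^sup>+y. ennreal (laplace_sq q (insert_coord k z (\<lambda>l. of_real (x l) + \<i> * of_real (y l))))
       \<partial>PiM {..<q} (\<lambda>_. lborel))
    \<le> ennreal ((2 * pi) ^ q) * (\<integral>\<^sup>+\<tau>. ennreal (energy q k z \<tau>) \<partial>orthant q)"
proof -
  let ?Y = "PiM {..<q} (\<lambda>_. lborel :: real measure)" and ?c = "ennreal ((2 * pi) ^ q)"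
  let ?P = "\<lambda>j ns i \<tau>. (cmod (partial_laplace k z (\<Delta> j ns i) \<tau>))\<^sup>2"
  define G where "G j ns i y = (\<integral>t. of_real (\<Delta> j ns i t) * exp (- (\<Sum>l<Suc q. insert_coord k z
      (\<lambda>l. of_real (x l) + \<i> * of_real (y l)) l * of_real (t l))) \<partial>orthant (Suc q))"
    for j ns i and y :: "nat \<Rightarrow> real"
  have G: "(\<lambda>y. ennreal ((cmod (G j ns i y))\<^sup>2)) \<in> borel_measurable ?Y"
    "(\<integral>\<^sup>+y. ennreal ((cmod (G j ns i y))\<^sup>2) \<partial>?Y) \<le> ?c * (\<integral>\<^sup>+\<tau>. ennreal (?P j ns i \<tau>) \<partial>orthant q)"
    if "j < m" "i < n" "ns \<in> idxs n q" for j ns i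
  proof -
    have "(\<lambda>y. (cmod (G j ns i y))\<^sup>2) \<in> borel_measurable ?Y"
      unfolding G_def by (rule nn_integral_laplace_le(1)[OF decaying[OF that] k z x])
    then show "(\<lambda>y. ennreal ((cmod (G j ns i y))\<^sup>2)) \<in> borel_measurable ?Y" by measurable
    show "(\<integral>\<^sup>+y. ennreal ((cmod (G j ns i y))\<^sup>2) \<partial>?Y) \<le> ?c * (\<integral>\<^sup>+\<tau>. ennreal (?P j ns i \<tau>) \<partial>orthant q)"
      unfolding G_def by (rule nn_integral_laplace_le(2)[OF decaying[OF that] k z x])
  qed
  have "(\<integral>\<^sup>+y. ennreal (laplace_sq q (insert_coord k z (\<lambda>l. of_real (x l) + \<i> * of_real (y l)))) \<partial>?Y)
     = (\<integral>\<^sup>+y. (\<Sum>j<m. \<Sum>ns\<in>idxs n q. \<Sum>i<n. ennreal ((cmod (G j ns i y))\<^sup>2)) \<partial>?Y)"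
    by (simp add: laplace_sq_def G_def sum_nonneg del: sum.lessThan_Suc)
  also have "\<dots> = (\<Sum>j<m. \<Sum>ns\<in>idxs n q. \<Sum>i<n. \<integral>\<^sup>+y. ennreal ((cmod (G j ns i y))\<^sup>2) \<partial>?Y)"
    by (rule nn_integral_triple_sum) (use G(1) in simp)
  also have "\<dots> \<le> (\<Sum>j<m. \<Sum>ns\<in>idxs n q. \<Sum>i<n. ?c * (\<integral>\<^sup>+\<tau>. ennreal (?P j ns i \<tau>) \<partial>orthant q))"
    by (intro sum_mono G) auto
  also have "\<dots> = ?c * (\<Sum>j<m. \<Sum>ns\<in>idxs n q. \<Sum>i<n. \<integral>\<^sup>+\<tau>. ennreal (?P j ns i \<tau>) \<partial>orthant q)"
    by (simp add: sum_distrib_left)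
  also have "(\<Sum>j<m. \<Sum>ns\<in>idxs n q. \<Sum>i<n. \<integral>\<^sup>+\<tau>. ennreal (?P j ns i \<tau>) \<partial>orthant q)
      = (\<integral>\<^sup>+\<tau>. (\<Sum>j<m. \<Sum>ns\<in>idxs n q. \<Sum>i<n. ennreal (?P j ns i \<tau>)) \<partial>orthant q)"
  proof -
    have "(\<lambda>\<tau>. ennreal (?P j ns i \<tau>)) \<in> borel_measurable (orthant q)" if "j < m" "i < n" "ns \<in> idxs n q" for j ns i
      using measurable_partial_laplace[OF that k z] by simp
    then show ?thesis by (intro nn_integral_triple_sum[symmetric]) simp
  qed
  also have "\<dots> = (\<integral>\<^sup>+\<tau>. ennreal (energy q k z \<tau>) \<partial>orthant q)"
    by (simp add: energy_def sum_nonneg)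
  finally show ?thesis .
qed

text \<open>The normalisation of the Hardy norm cancels the Plancherel constant exactly, and the
  bound is uniform in x; only the supremum over the singled-out variable survives.\<close>

lemma mixed_norm_le_energy:
  assumes k: "k \<le> q"
  shows "mixed_norm k (Suc q) (laplace_sq q)
    \<le> (SUP z\<in>{z. 0 < Re z}. ensqrt (\<integral>\<^sup>+\<tau>. ennreal (energy q k z \<tau>) \<partial>orthant q))"
  unfolding mixed_norm_def H2_norm_def diff_Suc_1
proof (intro SUP_mono SUP_least bexI)
  fix z and x :: "nat \<Rightarrow> real" assume z: "z \<in> {z. 0 < Re z}" and x: "x \<in> PiE {..<q} (\<lambda>_. {0<..})"
  let ?c = "(2 * pi) ^ q" and ?p = "(2 * pi) powr (- real q / 2)"
  let ?A = "\<integral>\<^sup>+y. ennreal (laplace_sq q (ins_at k z (\<lambda>l. of_real (x l) + \<i> * of_real (y l))))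
       \<partial>PiM {..<q} (\<lambda>_. lborel)"
  let ?E = "\<integral>\<^sup>+\<tau>. ennreal (energy q k z \<tau>) \<partial>orthant q"
  have "?A \<le> ennreal ?c * ?E"
    unfolding ins_at_eq_insert_coord
    by (intro nn_integral_laplace_sq_le k) (use z x in \<open>auto simp: PiE_iff less_imp_le\<close>)
  then have "ensqrt ?A \<le> ennreal (sqrt ?c) * ensqrt ?E"
    using ensqrt_mult[of ?c ?E] ensqrt_mono by fastforce
  then have "ennreal ?p * ensqrt ?A \<le> ennreal ?p * (ennreal (sqrt ?c) * ensqrt ?E)"
    by (rule mult_left_mono) simp
  also have "\<dots> = ennreal (?p * sqrt ?c) * ensqrt ?E"
    by (simp add: ennreal_mult mult.assoc)
  also have "?p * sqrt ?c = 1"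
  proof -
    have "sqrt ?c = (2 * pi) powr (real q / 2)"
      by (rule real_sqrt_unique) (simp_all add: power2_eq_square powr_realpow flip: powr_add)
    then show ?thesis by (simp flip: powr_add)
  qed
  finally show "ennreal ?p * ensqrt ?A \<le> ensqrt ?E" by simp
qed

text \<open>One level of the twisted partial traces, with the cut-off (r+1)^2 tied to the
  mesh.\<close>

definition trace_sum :: "nat \<Rightarrow> complex \<Rightarrow> nat \<Rightarrow> nat \<Rightarrow> real" where
  "trace_sum r z k off = L2_set (\<lambda>(x, y). norm (\<Sum>p<(Suc r)\<^sup>2. twist r z p *
       of_real (hankel_entry r \<Delta> (output_index (k, x, p)) (input_index off (k, y, p)))))
       (outer_indices m n ((Suc r)\<^sup>2) k \<times> outer_indices n n ((Suc r)\<^sup>2) (k + off))"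

text \<open>Pairs of outer indices correspond to merged lists: cutting at position \<open>k\<close>
  and reversing the second half is a bijection, for the cells as well as for the operator
  indices.\<close>

lemma trace_sum_eq:
  assumes q: "q = k + (k + off)"
  shows "(trace_sum r z k off)\<^sup>2 = (\<Sum>E\<in>idxs ((Suc r)\<^sup>2) q. \<Sum>j<m. \<Sum>ns\<in>idxs n q. \<Sum>i<n.
    (cmod (twisted_trace r z k (k + off) ((Suc r)\<^sup>2) E j ns i))\<^sup>2)"
proof -
  let ?R = "(Suc r)\<^sup>2" and ?L = "k + off"
  let ?X = "\<lambda>(x, y). norm (\<Sum>p<?R. twist r z p *
       of_real (hankel_entry r \<Delta> (output_index (k, x, p)) (input_index off (k, y, p))))"
  let ?O = "outer_indices m n ?R k \<times> outer_indices n n ?R ?L"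
  let ?\<Omega> = "idxs ?R q \<times> {..<m} \<times> idxs n q \<times> {..<n}"
  define \<Theta> where "\<Theta> = (\<lambda>(E :: nat list, j :: nat, ns :: nat list, i :: nat).
      ((take k E, j, take k ns), (rev (drop k E), i, rev (drop k ns))))"
  have "bij_betw \<Theta> ?\<Omega> ?O"
  proof (rule bij_betw_byWitness[where f' = "\<lambda>((c, j, ns), (d, i, ms)). (c @ rev d, j, ns @ rev ms, i)"])
    have td: "take k E \<in> idxs R k" "rev (drop k E) \<in> idxs R ?L" if "E \<in> idxs R q" for E R
      using that set_take_subset[of k E] set_drop_subset[of k E] by (auto simp: idxs_def q)
    then show "\<Theta> ` ?\<Omega> \<subseteq> ?O" by (auto simp: \<Theta>_def outer_indices_def)
    show "(\<lambda>((c, j, ns), (d, i, ms)). (c @ rev d, j, ns @ rev ms, i)) ` ?O \<subseteq> ?\<Omega>"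
      by (auto simp: outer_indices_def q append_rev_idxs)
  qed (auto simp: \<Theta>_def outer_indices_def length_idxs)
  then have "(trace_sum r z k off)\<^sup>2 = (\<Sum>\<omega>\<in>?\<Omega>. (?X (\<Theta> \<omega>))\<^sup>2)"
    by (simp add: trace_sum_def L2_set_def sum_nonneg sum.reindex_bij_betw[of \<Theta> ?\<Omega> ?O "\<lambda>w. (?X w)\<^sup>2", symmetric])
  also have "\<dots> = (\<Sum>(E, j, ns, i)\<in>?\<Omega>. (cmod (twisted_trace r z k ?L ?R E j ns i))\<^sup>2)"
    by (intro sum.cong) (auto simp: \<Theta>_def twisted_trace_def output_index_def input_index_def)
  finally show ?thesis by (simp add: sum.cartesian_product case_prod_unfold)
qed

text \<open>Fatou's lemma for the step functions \<open>F r\<close> of the outer variables, scaled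
  so that their integral is exactly the squared trace sum. They converge pointwise by
  \<open>twisted_trace_tendsto\<close>, whose factor 1/2 becomes 1/4 after squaring.\<close>

lemma energy_le_liminf:
  assumes q: "q = k + (k + off)" and z: "0 < Re z"
  shows "(\<integral>\<^sup>+\<tau>. ennreal (energy q k z \<tau> / 4) \<partial>orthant q) \<le> liminf (\<lambda>r. ennreal ((trace_sum r z k off)\<^sup>2))"
proof -
  let ?R = "\<lambda>r. (Suc r)\<^sup>2" and ?L = "k + off"
  define S where "S r E = (\<Sum>j<m. \<Sum>ns\<in>idxs n q. \<Sum>i<n. (cmod (twisted_trace r z k ?L (?R r) E j ns i))\<^sup>2)" for r E
  have S0: "0 \<le> S r E" for r E by (auto simp: S_def intro!: sum_nonneg)
  define F where "F r \<tau> = (\<Sum>E\<in>idxs (?R r) q. ennreal (real (Suc r) ^ q * S r E) * indicator (cell r q E) \<tau>)" for r \<tau>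
  have Fint: "(\<integral>\<^sup>+\<tau>. F r \<tau> \<partial>orthant q) = ennreal ((trace_sum r z k off)\<^sup>2)" for r
  proof -
    have "(\<integral>\<^sup>+\<tau>. F r \<tau> \<partial>orthant q) = (\<Sum>E\<in>idxs (?R r) q. ennreal (real (Suc r) ^ q * S r E) * ennreal (1 / real (Suc r) ^ q))"
      unfolding F_def by (subst nn_integral_sum) (auto simp: nn_integral_cmult_indicator emeasure_cell)
    also have "\<dots> = (\<Sum>E\<in>idxs (?R r) q. ennreal (S r E))"
      using S0 by (intro sum.cong refl) (simp flip: ennreal_mult)
    also have "\<dots> = ennreal ((trace_sum r z k off)\<^sup>2)"
      using S0 by (simp add: trace_sum_eq[OF q] S_def[symmetric])
    finally show ?thesis .
  qed
  have lim: "(\<lambda>r. F r \<tau>) \<longlonglongrightarrow> ennreal (energy q k z \<tau> / 4)" if \<tau>: "\<tau> \<in> space (orthant q)" for \<tau>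
  proof -
    define V where "V r j ns i = of_real (sqrt (real (Suc r) ^ q)) * twisted_trace r z k ?L (?R r) (cells r q \<tau>) j ns i"
      for r j ns i
    have "(\<lambda>r. \<Sum>j<m. \<Sum>ns\<in>idxs n q. \<Sum>i<n. (cmod (V r j ns i))\<^sup>2)
       \<longlonglongrightarrow> (\<Sum>j<m. \<Sum>ns\<in>idxs n q. \<Sum>i<n. (cmod ((1 / 2) *\<^sub>R partial_laplace k z (\<Delta> j ns i) \<tau>))\<^sup>2)"
      unfolding V_def q
      by (intro tendsto_intros twisted_trace_tendsto) (use \<tau> z q in auto)
    also have "(\<Sum>j<m. \<Sum>ns\<in>idxs n q. \<Sum>i<n. (cmod ((1 / 2) *\<^sub>R partial_laplace k z (\<Delta> j ns i) \<tau>))\<^sup>2) = energy q k z \<tau> / 4"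
      by (simp add: energy_def sum_divide_distrib power_mult_distrib power_divide)
    finally have 1: "(\<lambda>r. ennreal (\<Sum>j<m. \<Sum>ns\<in>idxs n q. \<Sum>i<n. (cmod (V r j ns i))\<^sup>2)) \<longlonglongrightarrow> ennreal (energy q k z \<tau> / 4)"
      by (rule tendsto_ennrealI)
    have V: "(\<Sum>j<m. \<Sum>ns\<in>idxs n q. \<Sum>i<n. (cmod (V r j ns i))\<^sup>2) = real (Suc r) ^ q * S r (cells r q \<tau>)" for r
      by (simp add: V_def S_def norm_mult power_mult_distrib sum_distrib_left del: of_nat_Suc)
    have "\<forall>\<^sub>F r in sequentially. ennreal (\<Sum>j<m. \<Sum>ns\<in>idxs n q. \<Sum>i<n. (cmod (V r j ns i))\<^sup>2) = F r \<tau>"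
    proof -
      \<comment> \<open>Once all outer times are below the cut-off, the cube containing
        \<open>\<tau>\<close> occurs in the sum, and it is the only one that contributes.\<close>
      have "\<forall>\<^sub>F r in sequentially. \<forall>l\<in>{..<q}. cell_index r (\<tau> l) < ?R r"
        by (intro eventually_ball_finite ballI eventually_cell_index_less) (auto intro: orthant_pos[OF \<tau>])
      then show ?thesis
      proof eventually_elim
        case (elim r)
        then have "cells r q \<tau> \<in> idxs (?R r) q" by (auto simp: idxs_def cells_def)
        moreover have "indicator (cell r q E) \<tau> = (if E = cells r q \<tau> then 1 else 0 :: ennreal)"
          if "E \<in> idxs (?R r) q" for E
          using in_cell_iff[OF \<tau> length_idxs[OF that], of r] by (auto simp: cells_def indicator_def)
        ultimately have "F r \<tau> = ennreal (real (Suc r) ^ q * S r (cells r q \<tau>))"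
          by (simp add: F_def if_distrib[of "\<lambda>y. _ * y"] cong: if_cong)
        then show ?case by (simp add: V)
      qed
    qed
    with 1 show ?thesis by (rule Lim_transform_eventually)
  qed
  have "(\<integral>\<^sup>+\<tau>. ennreal (energy q k z \<tau> / 4) \<partial>orthant q) = (\<integral>\<^sup>+\<tau>. liminf (\<lambda>r. F r \<tau>) \<partial>orthant q)"
    using lim_imp_Liminf[OF _ lim] by (intro nn_integral_cong) simp
  also have "\<dots> \<le> liminf (\<lambda>r. \<integral>\<^sup>+\<tau>. F r \<tau> \<partial>orthant q)"
    unfolding F_def by (intro nn_integral_liminf) measurable
  finally show ?thesis by (simp only: Fint)
qed

text \<open>The strict inequality turns a bound on the lower limit into one for all large
  \<open>r\<close>, which lets several levels share a mesh later. The 2 is the square root of the 4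
  in the energy estimate.\<close>

lemma eventually_le_trace_sum:
  assumes q: "q = k + (k + off)" and z: "0 < Re z" and c: "0 < c"
    and less: "ennreal c < ensqrt (\<integral>\<^sup>+\<tau>. ennreal (energy q k z \<tau>) \<partial>orthant q)"
  shows "\<forall>\<^sub>F r in sequentially. c \<le> 2 * trace_sum r z k off"
proof -
  have "ennreal (c\<^sup>2) < (\<integral>\<^sup>+\<tau>. ennreal (energy q k z \<tau>) \<partial>orthant q)"
    using less_ensqrtD[OF _ less] c by simp
  also have "\<dots> = 4 * (\<integral>\<^sup>+\<tau>. ennreal (energy q k z \<tau> / 4) \<partial>orthant q)"
  proof -
    have "(\<lambda>\<tau>. ennreal (energy q k z \<tau> / 4)) \<in> borel_measurable (orthant q)"
      using measurable_energy[of k q z] q z by simp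
    moreover have "ennreal (energy q k z \<tau>) = 4 * ennreal (energy q k z \<tau> / 4)" for \<tau>
      by (subst ennreal_numeral[symmetric], subst ennreal_mult[symmetric])
        (auto simp: energy_def intro!: sum_nonneg divide_nonneg_pos)
    ultimately show ?thesis by (simp add: nn_integral_cmult)
  qed
  also have "\<dots> \<le> 4 * liminf (\<lambda>r. ennreal ((trace_sum r z k off)\<^sup>2))"
    by (intro mult_left_mono energy_le_liminf[OF q z]) simp
  finally have less': "ennreal (c\<^sup>2) < 4 * liminf (\<lambda>r. ennreal ((trace_sum r z k off)\<^sup>2))" .
  have "ennreal (c\<^sup>2 / 4) < liminf (\<lambda>r. ennreal ((trace_sum r z k off)\<^sup>2))"
  proof (rule ccontr)
    assume "\<not> ?thesis"
    then have "4 * liminf (\<lambda>r. ennreal ((trace_sum r z k off)\<^sup>2)) \<le> 4 * ennreal (c\<^sup>2 / 4)"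
      by (intro mult_left_mono) (auto simp: not_less)
    also have "\<dots> = ennreal (c\<^sup>2)"
      by (subst ennreal_numeral[symmetric], subst ennreal_mult[symmetric]) auto
    finally show False using less' by simp
  qed
  then have "\<forall>\<^sub>F r in sequentially. ennreal (c\<^sup>2 / 4) < ennreal ((trace_sum r z k off)\<^sup>2)"
    by (rule less_LiminfD)
  then show ?thesis
  proof eventually_elim
    case (elim r)
    have "c\<^sup>2 / 4 < (trace_sum r z k off)\<^sup>2" using elim by (simp add: ennreal_less_iff)
    then have "(c / 2)\<^sup>2 < (trace_sum r z k off)\<^sup>2" by (simp add: power_divide)
    then have "c / 2 < trace_sum r z k off"
      by (rule power2_less_imp_less) (simp add: trace_sum_def)
    then show ?case by simp
  qed
qed

text \<open>For every level a point z_k is chosen at which the given number below the mixed norm is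
  still exceeded. A single matrix with level-dependent weights then treats all levels
  simultaneously.\<close>

theorem sum_mixed_norm_le_trace_norm:
  fixes K :: "fock \<Rightarrow> fock"
  assumes K: "\<And>r (J :: (nat \<times> (nat list \<times> nat \<times> nat list) \<times> nat) set) \<iota> b k t j ns.
      finite J \<Longrightarrow> \<iota> ` J \<subseteq> cell_indices n n \<Longrightarrow> j < m \<Longrightarrow> ns \<in> idxs n k \<Longrightarrow> t \<in> space (orthant (Suc k)) \<Longrightarrow>
      K (cell_comb r J \<iota> b) k t j ns = (\<Sum>\<beta>\<in>J. b \<beta> * hankel_row r \<Delta> (\<iota> \<beta>) k t j ns)"
  shows "(\<Sum>k<k0. mixed_norm k (Suc (k + (k + off))) (laplace_sq (k + (k + off)))) \<le> 2 * trace_norm_fock n m n K"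
proof (rule sum_le_if_lower_approximations)
  fix c assume c: "\<And>k. k < k0 \<Longrightarrow> c k = 0 \<or> 0 < c k \<and>
      ennreal (c k) < mixed_norm k (Suc (k + (k + off))) (laplace_sq (k + (k + off)))"
  have "\<exists>z. 0 < Re z \<and> (\<forall>\<^sub>F r in sequentially. c k \<le> 2 * trace_sum r z k off)" if k: "k < k0" for k
  proof (cases "c k = 0")
    case True
    have "0 < Re 1" by simp
    moreover have "\<forall>r. c k \<le> 2 * trace_sum r 1 k off" using True by (simp add: trace_sum_def)
    ultimately show ?thesis by (blast intro: always_eventually)
  next
    case False
    with c[OF k] have pos: "0 < c k"
      and less: "ennreal (c k) < mixed_norm k (Suc (k + (k + off))) (laplace_sq (k + (k + off)))" by auto
    have "ennreal (c k) < (SUP z\<in>{z. 0 < Re z}. ensqrt (\<integral>\<^sup>+\<tau>. ennreal (energy (k + (k + off)) k z \<tau>) \<partial>orthant (k + (k + off))))"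
      by (rule less_le_trans[OF less mixed_norm_le_energy]) simp
    then obtain z where "0 < Re z" "ennreal (c k) < ensqrt (\<integral>\<^sup>+\<tau>. ennreal (energy (k + (k + off)) k z \<tau>) \<partial>orthant (k + (k + off)))"
      by (auto simp: less_SUP_iff)
    then show ?thesis using eventually_le_trace_sum[OF refl _ pos] by blast
  qed
  then obtain z where z: "\<And>k. k < k0 \<Longrightarrow> 0 < Re (z k)"
    and ev: "\<And>k. k < k0 \<Longrightarrow> \<forall>\<^sub>F r in sequentially. c k \<le> 2 * trace_sum r (z k) k off" by metis
  \<comment> \<open>Only finitely many levels are involved, so one mesh \<open>r\<close> is fine
    enough for all of them.\<close>
  have "\<forall>\<^sub>F r in sequentially. \<forall>k\<in>{..<k0}. c k \<le> 2 * trace_sum r (z k) k off"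
    by (intro eventually_ball_finite ballI ev) auto
  then obtain r where r: "\<And>k. k < k0 \<Longrightarrow> c k \<le> 2 * trace_sum r (z k) k off"
    by (auto simp: eventually_sequentially)
  \<comment> \<open>The points z_k are available below \<open>k0\<close> only; the value 0 elsewhere
    keeps the modulus bound valid for every \<open>k\<close>.\<close>
  define w where "w k p = (if k < k0 then twist r (z k) p else 0)" for k p
  have w: "norm (w k p) \<le> 1" for k p
    using z[of k] by (auto simp: w_def twist_def intro!: divide_nonneg_pos mult_nonneg_nonneg)
  have "(\<Sum>k<k0. c k) \<le> 2 * (\<Sum>k<k0. trace_sum r (z k) k off)"
    unfolding sum_distrib_left by (intro sum_mono r) simp
  moreover have "ennreal (\<Sum>k<k0. trace_sum r (z k) k off) \<le> trace_norm_fock n m n K"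
  proof -
    have "(\<Sum>k<k0. trace_sum r (z k) k off) = (\<Sum>k<k0. L2_set (\<lambda>(x, y). norm (\<Sum>p<(Suc r)\<^sup>2. w k p *
       of_real (hankel_entry r \<Delta> (output_index (k, x, p)) (input_index off (k, y, p)))))
       (outer_indices m n ((Suc r)\<^sup>2) k \<times> outer_indices n n ((Suc r)\<^sup>2) (k + off)))"
      by (intro sum.cong refl) (simp add: trace_sum_def w_def)
    also have "ennreal \<dots> \<le> trace_norm_fock n m n K"
      by (rule partial_traces_le_trace_norm[OF _ w]) (rule K)
    finally show ?thesis .
  qed
  ultimately have "ennreal (\<Sum>k<k0. c k) \<le> 2 * ennreal (\<Sum>k<k0. trace_sum r (z k) k off)"
    by (subst ennreal_numeral[symmetric], subst ennreal_mult[symmetric])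
      (auto intro!: ennreal_leI sum_nonneg simp: trace_sum_def)
  also have "\<dots> \<le> 2 * trace_norm_fock n m n K"
    by (intro mult_left_mono) (fact, simp)
  finally show "ennreal (\<Sum>k<k0. c k) \<le> 2 * trace_norm_fock n m n K" .
qed

end

theorem theorem1p3:
  fixes n m :: nat
    and T :: "real \<Rightarrow> 'a::{real_inner,banach,second_countable_topology} \<Rightarrow> 'a"
    and N :: "nat \<Rightarrow> 'a \<Rightarrow> 'a" and psi :: "nat \<Rightarrow> 'a" and C :: "nat \<Rightarrow> 'a \<Rightarrow> real"
    and M \<nu> :: real
    and T' :: "real \<Rightarrow> 'b::{real_inner,banach,second_countable_topology} \<Rightarrow> 'b"
    and N' :: "nat \<Rightarrow> 'b \<Rightarrow> 'b" and psi' :: "nat \<Rightarrow> 'b" and C' :: "nat \<Rightarrow> 'b \<Rightarrow> real"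
    and M' \<nu>' :: real
  assumes "stable_bilinear_system n m T N psi C M \<nu>"
    and "stable_bilinear_system n m T' N' psi' C' M' \<nu>'"
  shows "(\<Sum>k. mixed_norm k (2 * k + 1) (dG_sq n m T N psi C T' N' psi' C' (2 * k))
             + mixed_norm k (2 * k + 2) (dG_sq n m T N psi C T' N' psi' C' (2 * k + 1)))
         \<le> 4 * trace_norm_fock n m n (\<lambda>f. \<lambda>k t j ns. hankel n T N psi C f k t j ns - hankel n T' N' psi' C' f k t j ns)"
proof -
  interpret S: stable_system n m T N psi C M \<nu> by unfold_locales fact
  interpret S': stable_system n m T' N' psi' C' M' \<nu>' by unfold_locales fact
  let ?V = "volterra T N psi C" and ?V' = "volterra T' N' psi' C'"
  let ?K = "\<lambda>f. \<lambda>k t j ns. hankel n T N psi C f k t j ns - hankel n T' N' psi' C' f k t j ns"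
  define \<Delta> where "\<Delta> j ns i t = ?V j ns i t - ?V' j ns i t" for j ns i t
  interpret kernel_family n m \<Delta>
    unfolding \<Delta>_def by (rule kernel_family_diff[OF S.kernel_family_volterra S'.kernel_family_volterra])
  let ?TN = "trace_norm_fock n m n ?K"
  have K: "?K (cell_comb r J \<iota> b) k t j ns = (\<Sum>\<beta>\<in>J. b \<beta> * hankel_row r \<Delta> (\<iota> \<beta>) k t j ns)"
    if "finite J" "\<iota> ` J \<subseteq> cell_indices n n" "j < m" "ns \<in> idxs n k" "t \<in> space (orthant (Suc k))"
    for r and J :: "(nat \<times> (nat list \<times> nat \<times> nat list) \<times> nat) set" and \<iota> b k t j ns
  proof -
    have "hankel_row r \<Delta> (\<iota> \<beta>) k t j ns = hankel_row r ?V (\<iota> \<beta>) k t j ns - hankel_row r ?V' (\<iota> \<beta>) k t j ns"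
      if "\<beta> \<in> J" for \<beta>
      unfolding \<Delta>_def
      by (rule hankel_row_diff[OF S.kernel_family_volterra S'.kernel_family_volterra]) (use that \<open>\<iota> ` J \<subseteq> _\<close> \<open>j < m\<close> \<open>ns \<in> _\<close> \<open>t \<in> _\<close> in auto)
    then show ?thesis
      by (simp add: S.hankel_cell_comb[OF that] S'.hankel_cell_comb[OF that] right_diff_distrib sum_subtractf)
  qed
  \<comment> \<open>Subtracting under the integral requires both transfer integrals to converge.
    This is available for nonnegative real parts, and the suprema defining the norm visit only such
    points.\<close>
  have dG: "mixed_norm k (Suc q) (dG_sq n m T N psi C T' N' psi' C' q) = mixed_norm k (Suc q) (laplace_sq q)"
    if k: "k \<le> q" for k q
  proof -
    have "dG_sq n m T N psi C T' N' psi' C' q (ins_at k z (\<lambda>l. of_real (x l) + \<i> * of_real (y l)))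
        = laplace_sq q (ins_at k z (\<lambda>l. of_real (x l) + \<i> * of_real (y l)))"
      if z: "0 < Re z" and x: "x \<in> PiE {..<q} (\<lambda>_. {0<..})" for z and x y :: "nat \<Rightarrow> real"
      unfolding dG_sq_def laplace_sq_def ins_at_eq_insert_coord
    proof (intro sum.cong refl arg_cong[where f = "\<lambda>c. (cmod c)\<^sup>2"])
      fix j ns i assume "j \<in> {..<m}" "ns \<in> idxs n q" "i \<in> {..<n}"
      then have ji: "j < m" "ns \<in> idxs n q" by auto
      let ?w = "\<lambda>l. of_real (x l) + \<i> * of_real (y l)"
      have w: "0 \<le> Re (?w l)" if "l < q" for l using x that by (auto simp: PiE_iff less_imp_le)
      have 1: "integrable (orthant (Suc q)) (\<lambda>t. of_real (v j ns i t) *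
           exp (- (\<Sum>l<Suc q. insert_coord k z ?w l * of_real (t l))))"
        if "decaying_kernel (Suc q) (v j ns i)" for v
        by (rule laplace_eq_partial_laplace(1)[OF that k _ w]) (use z in auto)
      show "transfer T N psi C q (insert_coord k z ?w) j ns i - transfer T' N' psi' C' q (insert_coord k z ?w) j ns i
        = (\<integral>t. of_real (\<Delta> j ns i t) * exp (- (\<Sum>l<Suc q. insert_coord k z ?w l * of_real (t l))) \<partial>orthant (Suc q))"
        unfolding transfer_def Tmeas_eq_orthant lessThan_Suc_atMost[symmetric] volterra_def[symmetric] \<Delta>_def
        using 1[of ?V, OF S.decaying_volterra[OF ji]] 1[of ?V', OF S'.decaying_volterra[OF ji]]
        by (simp add: left_diff_distrib del: sum.lessThan_Suc)
    qed
    then show ?thesis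
      unfolding mixed_norm_def H2_norm_def diff_Suc_1 by (intro SUP_cong refl) auto
  qed
  \<comment> \<open>The levels \<open>2 k\<close> and \<open>2 k + 1\<close> are written
    \<open>k + (k + off)\<close>: output level \<open>k\<close>, input level \<open>k + off\<close>.
    Counted from 0, variable \<open>k\<close> is then the merged time, the one that the mixed norm
    singles out.\<close>
  have part: "(\<Sum>k. mixed_norm k (Suc (k + (k + off))) (dG_sq n m T N psi C T' N' psi' C' (k + (k + off)))) \<le> 2 * ?TN" for off
  proof (rule suminf_le_const[OF summableI])
    fix k0
    have "(\<Sum>k<k0. mixed_norm k (Suc (k + (k + off))) (laplace_sq (k + (k + off)))) \<le> 2 * ?TN"
      by (rule sum_mixed_norm_le_trace_norm) (rule K)
    then show "(\<Sum>k<k0. mixed_norm k (Suc (k + (k + off))) (dG_sq n m T N psi C T' N' psi' C' (k + (k + off)))) \<le> 2 * ?TN"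
      by (simp add: dG)
  qed
  \<comment> \<open>The two parities are separated and each is bounded by twice the trace norm,
    because each of them uses all output levels.\<close>
  have "(\<Sum>k. mixed_norm k (2 * k + 1) (dG_sq n m T N psi C T' N' psi' C' (2 * k))
             + mixed_norm k (2 * k + 2) (dG_sq n m T N psi C T' N' psi' C' (2 * k + 1)))
      = (\<Sum>k. mixed_norm k (Suc (k + (k + 0))) (dG_sq n m T N psi C T' N' psi' C' (k + (k + 0))))
        + (\<Sum>k. mixed_norm k (Suc (k + (k + 1))) (dG_sq n m T N psi C T' N' psi' C' (k + (k + 1))))"
    by (subst suminf_add) (auto intro: summableI simp: mult_2)
  also have "\<dots> \<le> 2 * ?TN + 2 * ?TN"
    by (intro add_mono part)
  also have "\<dots> = 4 * ?TN"
    by (simp flip: distrib_right)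
  finally show ?thesis .
qed

end
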